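(* Let $\mu\in T(\mathbb R)$ with Thorin measure $\tau$ and $0\le\gamma=\inf_{[0,\infty)}\operatorname{supp}\tau_+$ (with $\tau_+\neq0$). If $\hat\mu(-i\gamma)=\int_{\mathbb R}e^{\gamma x}\mu(dx)<\infty$ and the distribution function $F_{\tau_+^\gamma}(x)=\tau_+^\gamma((-\infty,x])$ of the translated measure $\tau_+^\gamma(B)=\tau_+(B+\gamma)$ is regularly varying at $0$ (from the right), then $\mu\in\mathcal S(\gamma)$.
   Context: $T(\mathbb R)$ is the set of weak limits of finite convolutions of laws of $Vx$, $V$ a gamma random variable, $x\in\mathbb R\setminus\{0\}$. Each $\mu\in T(\mathbb R)$ is infinitely divisible with Lévy measure $\nu(dx)=\frac{k(x)}{|x|}dx$, $k(x)=\int_0^\infty e^{-s|x|}\tau_\pm(ds)$ for $\pm x>0$, where $\tau_+,\tau_-$ are measures on $(0,\infty)$ with $\int_{(0,1]}(1+|\log s|)\tau_\pm(ds)+\int_{(1,\infty)}s^{-2}\tau_\pm(ds)<\infty$. The Thorin measure of $\mu$ is $\tau(B)=\tau_+(B\cap(0,\infty))+\tau_-((-B)\cap(0,\infty))$. $\mu$ may have a Gaussian component and arbitrary drift. A function $F$ is regularly varying at $0$ if $F(\lambda x)/F(x)\to\lambda^{\rho}$ as $x\to0^+$ for all $\lambda>0$ and some $\rho\in\mathbb R$. For a probability law $\mu$ on $\mathbb R$ let $\overline\mu(x)=\mu((x,\infty))$. For $\gamma\ge0$, $\mu\in L(\gamma)$ if $\overline\mu(x)>0$ for all $x$ and $\lim_{x\to\infty}\overline\mu(x+y)/\overline\mu(x)=e^{-\gamma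 y}$ for all $y\in\mathbb R$. $\mu$ is convolution equivalent of order $\gamma$, $\mu\in\mathcal S(\gamma)$, if $\int e^{\gamma x}\mu(dx)<\infty$, $\mu\in L(\gamma)$ and $\lim_{x\to\infty}\overline{\mu*\mu}(x)/\overline\mu(x)=2\int e^{\gamma x}\mu(dx)$. *)

theory Defs
  imports "HOL-Probability.Probability"
begin

subsection \<open>The extended Thorin class on the real line\<close>

text \<open>\<open>a\<close> is the shape and \<open>b\<close> the rate; \<^const>\<open>erlang_density\<close> covers integer shapes only.\<close>

definition gamma_density :: "real \<Rightarrow> real \<Rightarrow> real \<Rightarrow> real" where
  "gamma_density a b v =
     (if v > 0 then b powr a / Gamma a * v powr (a - 1) * exp (- (b * v)) else 0)"

definition gamma_law :: "real \<Rightarrow> real \<Rightarrow> real measure" where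
  "gamma_law a b = density lborel (\<lambda>v. ennreal (gamma_density a b v))"

inductive_set gamma_convolutions :: "real measure set" where
  elementary: "a > 0 \<Longrightarrow> b > 0 \<Longrightarrow> x \<noteq> 0 \<Longrightarrow>
    distr (gamma_law a b) borel (\<lambda>v. v * x) \<in> gamma_convolutions"
| conv: "M \<in> gamma_convolutions \<Longrightarrow> N \<in> gamma_convolutions \<Longrightarrow>
    (M \<star> N) \<in> gamma_convolutions"

definition thorin_class :: "real measure set" where
  "thorin_class =
     {\<mu>. real_distribution \<mu> \<and>
         (\<exists>M. (\<forall>n. M n \<in> gamma_convolutions) \<and> weak_conv_m M \<mu>)}"

subsection \<open>Levy triplets and Thorin measures\<close>

definition is_levy_measure :: "real measure \<Rightarrow> bool" where
  "is_levy_measure \<nu> \<longleftrightarrow>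
     sets \<nu> = sets borel \<and> emeasure \<nu> {0} = 0 \<and>
     (\<integral>\<^sup>+ x. ennreal (min 1 (x\<^sup>2)) \<partial>\<nu>) < \<infinity>"

text \<open>Levy-Khintchine representation with drift \<open>b\<close> (relative to the truncation function
  \<open>x \<mapsto> x\<close> on \<open>[-1, 1]\<close>), Gaussian variance \<open>A\<close> and Levy measure \<open>\<nu>\<close>.\<close>

definition has_levy_triplet :: "real measure \<Rightarrow> real \<Rightarrow> real \<Rightarrow> real measure \<Rightarrow> bool" where
  "has_levy_triplet \<mu> b A \<nu> \<longleftrightarrow>
     real_distribution \<mu> \<and> A \<ge> 0 \<and> is_levy_measure \<nu> \<and>
     (\<forall>t. char \<mu> t =
        exp (\<i> * complex_of_real (b * t) - complex_of_real (A * t\<^sup>2 / 2)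
             + (CLINT x|\<nu>. iexp (t * x) - 1
                  - \<i> * complex_of_real (t * x * indicator {-1..1} x))))"

text \<open>A measure on \<open>(0,\<infinity>)\<close> is represented as a Borel measure on the real line
  that does not charge \<open>(-\<infinity>,0]\<close>.\<close>

definition thorin_half_measure :: "real measure \<Rightarrow> bool" where
  "thorin_half_measure \<tau> \<longleftrightarrow>
     sets \<tau> = sets borel \<and> emeasure \<tau> {..0} = 0 \<and>
     (\<integral>\<^sup>+ s. ennreal (1 + \<bar>ln s\<bar>) * indicator {0<..1} s \<partial>\<tau>)
       + (\<integral>\<^sup>+ s. ennreal (1 / s\<^sup>2) * indicator {1<..} s \<partial>\<tau>) < \<infinity>"

definition thorin_k :: "real measure \<Rightarrow> real measure \<Rightarrow> real \<Rightarrow> ennreal" where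
  "thorin_k \<tau>p \<tau>m x =
     (if x > 0 then \<integral>\<^sup>+ s. ennreal (exp (- (s * \<bar>x\<bar>))) \<partial>\<tau>p
      else if x < 0 then \<integral>\<^sup>+ s. ennreal (exp (- (s * \<bar>x\<bar>))) \<partial>\<tau>m
      else 0)"

definition thorin_levy_measure :: "real measure \<Rightarrow> real measure \<Rightarrow> real measure" where
  "thorin_levy_measure \<tau>p \<tau>m = density lborel (\<lambda>x. thorin_k \<tau>p \<tau>m x / ennreal \<bar>x\<bar>)"

text \<open>\<open>\<tau>\<close> is the Thorin measure of \<open>\<mu>\<close>, with halves \<open>\<tau>p\<close> and \<open>\<tau>m\<close>, both
  carried by \<open>(0,\<infinity>)\<close>; drift and Gaussian part of \<open>\<mu>\<close> are arbitrary.\<close>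

definition has_thorin_measure ::
  "real measure \<Rightarrow> real measure \<Rightarrow> real measure \<Rightarrow> real measure \<Rightarrow> bool" where
  "has_thorin_measure \<mu> \<tau> \<tau>p \<tau>m \<longleftrightarrow>
     thorin_half_measure \<tau>p \<and> thorin_half_measure \<tau>m \<and>
     (\<exists>b A. has_levy_triplet \<mu> b A (thorin_levy_measure \<tau>p \<tau>m)) \<and>
     sets \<tau> = sets borel \<and>
     (\<forall>B\<in>sets borel. emeasure \<tau> B =
        emeasure \<tau>p (B \<inter> {0<..}) + emeasure \<tau>m (uminus ` B \<inter> {0<..}))"

definition measure_support :: "real measure \<Rightarrow> real set" where
  "measure_support M = {x. \<forall>U. open U \<longrightarrow> x \<in> U \<longrightarrow> emeasure M U > 0}"

text \<open>The translate \<open>B \<mapsto> M (B + c)\<close>.\<close>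

definition translated_measure :: "real measure \<Rightarrow> real \<Rightarrow> real measure" where
  "translated_measure M c = distr M borel (\<lambda>s. s - c)"

definition regularly_varying_at_0 :: "(real \<Rightarrow> real) \<Rightarrow> bool" where
  "regularly_varying_at_0 F \<longleftrightarrow>
     (\<exists>\<rho>::real. \<forall>l>0. ((\<lambda>x. F (l * x) / F x) \<longlongrightarrow> l powr \<rho>) (at_right 0))"

subsection \<open>Convolution equivalence\<close>

definition tail :: "real measure \<Rightarrow> real \<Rightarrow> real" where
  "tail \<mu> x = measure \<mu> {x<..}"

definition class_L :: "real \<Rightarrow> real measure set" where
  "class_L \<gamma> =
     {\<mu>. real_distribution \<mu> \<and> (\<forall>x. tail \<mu> x > 0) \<and>
         (\<forall>y. ((\<lambda>x. tail \<mu> (x + y) / tail \<mu> x) \<longlongrightarrow> exp (- (\<gamma> * y))) at_top)}"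

definition class_S :: "real \<Rightarrow> real measure set" where
  "class_S \<gamma> =
     {\<mu>. real_distribution \<mu> \<and> integrable \<mu> (\<lambda>x. exp (\<gamma> * x)) \<and> \<mu> \<in> class_L \<gamma> \<and>
         ((\<lambda>x. tail (\<mu> \<star> \<mu>) x / tail \<mu> x) \<longlongrightarrow> 2 * (\<integral>x. exp (\<gamma> * x) \<partial>\<mu>)) at_top}"

end

theory Submission
  imports Defs "HOL-Real_Asymp.Real_Asymp"
begin

text \<open>Split \<open>\<mu> = M * CP\<close>, where \<open>CP\<close> is compound Poisson and carries the jumps larger than \<open>1\<close>, and \<open>M\<close>
  has all exponential moments of nonnegative order. The large jumps have density
  \<open>exp (- \<gamma> x) h(x)\<close> with \<open>h(x) = \<kappa>(x) / x\<close> and \<open>\<kappa>\<close> the Laplace transform of the translate of \<open>\<tau>p\<close>.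
  Regular variation is needed only through the doubling property \<open>F(2t) \<le> C F(t)\<close> near \<open>0\<close>: it
  passes to \<open>\<kappa>(x/2) \<le> K \<kappa>(x)\<close> and, the integrand being exponential, to \<open>\<kappa>(x - y) \<sim> \<kappa>(x)\<close>.
  As the tilt \<open>exp (- \<gamma> x)\<close> commutes with convolution and \<open>h\<close> is decreasing and integrable, dominated
  convergence gives \<open>h^{*n} \<sim> n m^{n-1} h\<close> with \<open>m\<close> the integral of \<open>h\<close>. The crude bound
  \<open>h^{*n} \<le> (2Km)^{n-1} h\<close> suffices to sum over \<open>n\<close> because of the factor \<open>1/n!\<close> in \<open>CP\<close>. Hence the tail of \<open>\<mu>\<close> is
  asymptotic to \<open>C g\<close>, where \<open>g\<close> is the tail of the Levy measure and \<open>C\<close> the exponential moment of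
  order \<open>\<gamma>\<close>. The same result for \<open>\<mu> * \<mu>\<close>, with \<open>M * M\<close> and \<open>2 h\<close>, gives \<open>2 C\<^sup>2 g\<close>.\<close>

subsection \<open>Compound Poisson laws\<close>

text \<open>The cut at \<open>1\<close> is forced by the singularity \<open>1/x\<close> of the Levy
  density at the origin: only the large jumps form a finite measure with bounded density. Whatever
  is cut off goes into the factor \<open>M\<close>, of which nothing is used except that it is a law
  with finite exponential moments of every order \<theta> \<ge> 0. Such an \<open>M\<close> has an
  upper tail negligible against \<open>g\<close> as soon as \<open>g\<close> does not decay faster
  than every exponential, which is why a lower bound \<open>c * exp (- (b * x))\<close> for
  \<open>h\<close> is carried along. The finite moment of \<open>\<mu>\<close> of order \<gamma>
  enters as integrability of \<open>h\<close>; it is not automatic, since removing the tilt leaves a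
  function that decays slower than every exponential. Asymptotics are derived for densities and
  integrated to tails only afterwards, because the tilt factors exactly out of a convolution of
  densities. The constant in the limit for \<open>\<mu> * \<mu>\<close> is not computed: it is read
  off from the moment of order \<gamma>, which is multiplicative.\<close>

lemma emeasure_measure_series:
  fixes M :: "nat \<Rightarrow> real measure" and w :: "nat \<Rightarrow> ennreal"
  assumes "\<And>n. sets (M n) = sets borel"
  defines "S \<equiv> measure_of UNIV (sets borel) (\<lambda>A. \<Sum>n. w n * emeasure (M n) A)"
  shows sets_measure_series: "sets S = sets borel"
    and space_measure_series: "space S = UNIV"
    and emeasure_measure_series_eq: "A \<in> sets borel \<Longrightarrow> emeasure S A = (\<Sum>n. w n * emeasure (M n) A)"
proof -
  have sig: "sigma_sets UNIV (sets (borel :: real measure)) = sets borel"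
    using sets.sigma_sets_eq[of "borel :: real measure"] by simp
  show *: "sets S = sets borel" "space S = UNIV"
    unfolding S_def by (simp_all add: sig space_measure_of sets_measure_of)
  assume A: "A \<in> sets borel"
  show "emeasure S A = (\<Sum>n. w n * emeasure (M n) A)"
  proof (rule emeasure_measure_of[of S UNIV "sets borel"])
    show "S = measure_of UNIV (sets borel) (\<lambda>A. \<Sum>n. w n * emeasure (M n) A)"
      by (simp add: S_def)
    show "positive (sets S) (\<lambda>A. \<Sum>n. w n * emeasure (M n) A)"
      by (simp add: positive_def)
    show "A \<in> sets S" using A * by simp
    show "countably_additive (sets S) (\<lambda>A. \<Sum>n. w n * emeasure (M n) A)"
    proof (rule countably_additiveI)
      fix B :: "nat \<Rightarrow> real set"
      assume B: "range B \<subseteq> sets S" "disjoint_family B" "(\<Union>i. B i) \<in> sets S"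
      \<comment> \<open>Exchange of two nonnegative series, read as Fubini for two counting
        measures.\<close>
      have "(\<Sum>i. \<Sum>n. w n * emeasure (M n) (B i)) = (\<Sum>n. \<Sum>i. w n * emeasure (M n) (B i))"
        unfolding nn_integral_count_space_nat[symmetric]
        by (rule pair_sigma_finite.Fubini')
          (auto intro!: pair_sigma_finite.intro sigma_finite_measure_count_space)
      also have "\<dots> = (\<Sum>n. w n * emeasure (M n) (\<Union>i. B i))"
        using B * assms(1) by (intro suminf_cong) (simp add: suminf_emeasure)
      finally show "(\<Sum>i. \<Sum>n. w n * emeasure (M n) (B i)) = (\<Sum>n. w n * emeasure (M n) (\<Union> (range B)))"
        by simp
    qed
  qed simp
qed

lemma nn_integral_measure_series:
  fixes M :: "nat \<Rightarrow> real measure" and w :: "nat \<Rightarrow> ennreal"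
  assumes M: "\<And>n. sets (M n) = sets borel" and f: "f \<in> borel_measurable borel"
  defines "S \<equiv> measure_of UNIV (sets borel) (\<lambda>A. \<Sum>n. w n * emeasure (M n) A)"
  shows "(\<integral>\<^sup>+x. f x \<partial>S) = (\<Sum>n. w n * (\<integral>\<^sup>+x. f x \<partial>M n))"
proof -
  note S = emeasure_measure_series[where M=M and w=w, OF M, folded S_def]
  have [measurable_cong]: "sets S = sets borel" "sets (M n) = sets borel" for n
    by (simp_all add: M S)
  show ?thesis using f
  proof (induction rule: borel_measurable_induct)
    case (cong f g)
    then show ?case by (simp cong: nn_integral_cong)
  next
    case (set A)
    then show ?case by (simp add: S M)
  next
    case (mult u c)
    then show ?case
      by (simp add: nn_integral_cmult ennreal_suminf_cmult mult.left_commute)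
  next
    case (add u v)
    have "w n * (\<integral>\<^sup>+x. v x + u x \<partial>M n) = w n * (\<integral>\<^sup>+x. v x \<partial>M n) + w n * (\<integral>\<^sup>+x. u x \<partial>M n)" for n
      using add.hyps by (simp add: nn_integral_add distrib_left)
    then show ?case
      using add by (simp add: nn_integral_add suminf_add)
  next
    case (seq U)
    have [measurable]: "U i \<in> borel_measurable borel" for i using seq by simp
    have "(\<integral>\<^sup>+x. (SUP i. U i) x \<partial>S) = (SUP i. \<integral>\<^sup>+x. U i x \<partial>S)"
      using seq.hyps by (simp add: nn_integral_monotone_convergence_SUP image_comp)
    also have "\<dots> = (SUP i. \<Sum>n. w n * (\<integral>\<^sup>+x. U i x \<partial>M n))"
      using seq by simp
    \<comment> \<open>Monotone convergence for the series in its directed form: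
      \<open>U (max i j)\<close> dominates \<open>U i\<close> and \<open>U j\<close> simultaneously
      for all \<open>n\<close>.\<close>
    also have "\<dots> = (\<Sum>n. SUP i. w n * (\<integral>\<^sup>+x. U i x \<partial>M n))"
    proof (rule ennreal_suminf_SUP_eq_directed[symmetric])
      fix N :: "nat set" and i j :: nat
      have "U i x \<le> U (max i j) x" "U j x \<le> U (max i j) x" for x
        using seq.hyps by (auto simp: incseq_def le_fun_def)
      then show "\<exists>k\<in>UNIV. \<forall>n\<in>N. w n * (\<integral>\<^sup>+x. U i x \<partial>M n) \<le> w n * (\<integral>\<^sup>+x. U k x \<partial>M n) \<and>
            w n * (\<integral>\<^sup>+x. U j x \<partial>M n) \<le> w n * (\<integral>\<^sup>+x. U k x \<partial>M n)"
        by (intro bexI[of _ "max i j"]) (auto intro!: mult_left_mono nn_integral_mono)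
    qed
    also have "\<dots> = (\<Sum>n. w n * (\<integral>\<^sup>+x. (SUP i. U i) x \<partial>M n))"
      using seq.hyps by (simp add: nn_integral_monotone_convergence_SUP image_comp SUP_mult_left_ennreal)
    finally show ?case .
  qed
qed

section \<open>Characteristic functions and exponential moments of convolutions\<close>

lemma char_convolution:
  assumes "finite_measure M" "finite_measure N"
    and M[measurable_cong]: "sets M = sets borel" and N[measurable_cong]: "sets N = sets borel"
  shows "char (M \<star> N) t = char M t * char N t"
proof -
  interpret M: finite_measure M by fact
  interpret N: finite_measure N by fact
  interpret P: pair_sigma_finite M N ..
  interpret MN: finite_measure "M \<Otimes>\<^sub>M N" by (intro finite_measure_pair_measure assms)
  have "char (M \<star> N) t = (CLINT z|(M \<Otimes>\<^sub>M N). iexp (t * fst z) * iexp (t * snd z))"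
    unfolding char_def convolution_def
    by (subst integral_distr)
      (auto simp: case_prod_beta distrib_left distrib_right exp_add intro!: Bochner_Integration.integral_cong)
  also have "\<dots> = (CLINT x|M. CLINT y|N. iexp (t * x) * iexp (t * y))"
    by (subst P.integral_fst'[symmetric])
      (auto intro!: MN.integrable_const_bound[where B=1] simp: norm_mult)
  also have "\<dots> = char M t * char N t"
    unfolding char_def by simp
  finally show ?thesis .
qed

lemma real_distribution_convolution:
  assumes "real_distribution M" "real_distribution N"
  shows "real_distribution (M \<star> N)"
proof -
  interpret M: real_distribution M by fact
  interpret N: real_distribution N by fact
  interpret P: pair_prob_space M N ..
  have "prob_space (M \<star> N)"
    unfolding convolution_def by (rule P.prob_space_distr) measurable
  then show ?thesis
    by (simp add: real_distribution_def real_distribution_axioms_def)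
qed

text \<open>Kept in \<open>ennreal\<close> so that infinite moments are allowed and the identity can
  be read backwards: a finite product forces a factor to be finite if the other one does not
  vanish.\<close>

lemma nn_integral_exp_convolution:
  assumes "finite_measure M" "finite_measure N"
    and M[measurable_cong]: "sets M = sets borel" and N[measurable_cong]: "sets N = sets borel"
  shows "(\<integral>\<^sup>+x. ennreal (exp (\<theta> * x)) \<partial>(M \<star> N)) =
    (\<integral>\<^sup>+x. ennreal (exp (\<theta> * x)) \<partial>M) * (\<integral>\<^sup>+x. ennreal (exp (\<theta> * x)) \<partial>N)"
  using assms
  by (simp add: nn_integral_convolution distrib_left exp_add ennreal_mult nn_integral_cmult nn_integral_multc)

text \<open>The zeroth power is the unit of convolution; in the compound Poisson series it stands
  for the event of no jump.\<close>

primrec conv_pow :: "real measure \<Rightarrow> nat \<Rightarrow> real measure" where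
  "conv_pow \<nu> 0 = return borel 0"
| "conv_pow \<nu> (Suc n) = (\<nu> \<star> conv_pow \<nu> n)"

lemma sets_conv_pow [simp, measurable_cong]: "sets (conv_pow \<nu> n) = sets borel"
  by (cases n) auto

lemma finite_measure_conv_pow:
  assumes "finite_measure \<nu>" "sets \<nu> = sets borel"
  shows "finite_measure (conv_pow \<nu> n)"
proof (induction n)
  case 0
  show ?case by (simp add: prob_space.finite_measure prob_space_return)
next
  case (Suc n)
  then show ?case using assms by (simp add: convolution_finite)
qed

lemma char_conv_pow:
  assumes "finite_measure \<nu>" "sets \<nu> = sets borel"
  shows "char (conv_pow \<nu> n) t = char \<nu> t ^ n"
proof (induction n)
  case 0
  show ?case by (simp add: char_def integral_return)
next
  case (Suc n)
  then show ?case
    using assms by (simp add: char_convolution finite_measure_conv_pow)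
qed

lemma nn_integral_exp_conv_pow:
  assumes "finite_measure \<nu>" "sets \<nu> = sets borel"
  shows "(\<integral>\<^sup>+x. ennreal (exp (\<theta> * x)) \<partial>conv_pow \<nu> n) = (\<integral>\<^sup>+x. ennreal (exp (\<theta> * x)) \<partial>\<nu>) ^ n"
proof (induction n)
  case 0
  show ?case by (simp add: nn_integral_return)
next
  case (Suc n)
  then show ?case
    using assms by (simp add: nn_integral_exp_convolution finite_measure_conv_pow)
qed

definition compound_poisson :: "real measure \<Rightarrow> real measure" where
  "compound_poisson \<nu> = measure_of UNIV (sets borel)
     (\<lambda>A. \<Sum>n. ennreal (exp (- measure \<nu> UNIV) / fact n) * emeasure (conv_pow \<nu> n) A)"

lemma nn_integral_compound_poisson:
  assumes "f \<in> borel_measurable borel"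
  shows "(\<integral>\<^sup>+x. f x \<partial>compound_poisson \<nu>) =
    (\<Sum>n. ennreal (exp (- measure \<nu> UNIV) / fact n) * (\<integral>\<^sup>+x. f x \<partial>conv_pow \<nu> n))"
  unfolding compound_poisson_def using assms by (intro nn_integral_measure_series) auto

lemma sets_compound_poisson [simp, measurable_cong]: "sets (compound_poisson \<nu>) = sets borel"
  unfolding compound_poisson_def by (rule sets_measure_series) auto

lemma space_compound_poisson [simp]: "space (compound_poisson \<nu>) = UNIV"
  unfolding compound_poisson_def by (rule space_measure_series) auto

lemma exp_sums: "(\<lambda>n. x ^ n / fact n) sums exp (x :: real)"
  using exp_converges[of x] by (simp add: divide_inverse mult.commute)

lemma nn_integral_exp_compound_poisson:
  assumes "finite_measure \<nu>" "sets \<nu> = sets borel"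
    and m: "(\<integral>\<^sup>+x. ennreal (exp (\<theta> * x)) \<partial>\<nu>) = ennreal m" "0 \<le> m"
  shows "(\<integral>\<^sup>+x. ennreal (exp (\<theta> * x)) \<partial>compound_poisson \<nu>) = ennreal (exp (m - measure \<nu> UNIV))"
proof -
  let ?l = "measure \<nu> UNIV"
  have "(\<integral>\<^sup>+x. ennreal (exp (\<theta> * x)) \<partial>compound_poisson \<nu>) =
      (\<Sum>n. ennreal (exp (- ?l) / fact n) * ennreal m ^ n)"
    using assms by (simp add: nn_integral_compound_poisson nn_integral_exp_conv_pow)
  also have "\<dots> = (\<Sum>n. ennreal (exp (- ?l) * (m ^ n / fact n)))"
    using m(2) by (simp add: ennreal_mult' ennreal_power ennreal_mult''[symmetric] zero_le_power)
  also have "\<dots> = ennreal (exp (- ?l) * exp m)"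
    using m(2) sums_mult[OF exp_sums[of m], of "exp (- ?l)"]
    by (intro suminf_ennreal_eq) auto
  finally show ?thesis by (simp add: exp_diff exp_minus divide_inverse mult.commute)
qed

text \<open>The term of exactly one jump is a positive multiple of the moment of
  \<open>\<nu>\<close>. This turns the moment assumption on the law into one on its Levy
  measure.\<close>

lemma nn_integral_exp_compound_poisson_finite:
  assumes "finite_measure \<nu>" "sets \<nu> = sets borel"
    and fin: "(\<integral>\<^sup>+x. ennreal (exp (\<theta> * x)) \<partial>compound_poisson \<nu>) < \<infinity>"
  shows "(\<integral>\<^sup>+x. ennreal (exp (\<theta> * x)) \<partial>\<nu>) < \<infinity>"
proof (rule ccontr)
  assume "\<not> ?thesis"
  then have top: "(\<integral>\<^sup>+x. ennreal (exp (\<theta> * x)) \<partial>\<nu>) = \<top>"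
    by (simp add: less_top[symmetric])
  let ?a = "\<lambda>n. ennreal (exp (- measure \<nu> UNIV) / fact n) * (\<integral>\<^sup>+x. ennreal (exp (\<theta> * x)) \<partial>conv_pow \<nu> n)"
  have "?a 1 = \<top>"
    using assms top by (subst nn_integral_exp_conv_pow) (auto simp: ennreal_mult_eq_top_iff)
  moreover have "?a 1 \<le> (\<Sum>n. ?a n)"
    using sum_le_suminf[of ?a "{1}"] by simp
  ultimately show False
    using fin by (simp add: nn_integral_compound_poisson)
qed

lemma real_distribution_compound_poisson:
  assumes "finite_measure \<nu>" "sets \<nu> = sets borel"
  shows "real_distribution (compound_poisson \<nu>)"
proof -
  interpret finite_measure \<nu> by fact
  have "space \<nu> = UNIV" using assms(2) by (metis sets_eq_imp_space_eq space_borel)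
  \<comment> \<open>The moment formula at order \<open>0\<close> computes the total mass:
    \<open>m\<close> is then the mass of \<open>\<nu>\<close> and the exponent vanishes.\<close>
  then have "(\<integral>\<^sup>+x. ennreal (exp (0 * x)) \<partial>\<nu>) = ennreal (measure \<nu> UNIV)"
    by (simp add: emeasure_eq_measure)
  from nn_integral_exp_compound_poisson[OF assms this]
  have "emeasure (compound_poisson \<nu>) (space (compound_poisson \<nu>)) = 1"
    by (simp add: nn_integral_const)
  then show ?thesis
    by (simp add: real_distribution_def real_distribution_axioms_def prob_spaceI)
qed

lemma integral_compound_poisson_sums:
  fixes f :: "real \<Rightarrow> real"
  assumes fin: "finite_measure \<nu>" and sets: "sets \<nu> = sets borel"
    and [measurable]: "f \<in> borel_measurable borel" and bound: "\<And>x. \<bar>f x\<bar> \<le> 1"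
  shows "(\<lambda>n. exp (- measure \<nu> UNIV) / fact n * (\<integral>x. f x \<partial>conv_pow \<nu> n))
    sums (\<integral>x. f x \<partial>compound_poisson \<nu>)"
proof -
  interpret CP: real_distribution "compound_poisson \<nu>"
    by (rule real_distribution_compound_poisson[OF fin sets])
  interpret finite_measure "conv_pow \<nu> n" for n by (rule finite_measure_conv_pow[OF fin sets])
  let ?w = "\<lambda>n::nat. exp (- measure \<nu> UNIV) / fact n"
  \<comment> \<open>The nonnegative case is inherited from
    \<open>nn_integral_compound_poisson\<close>. The bound \<open>2\<close> is what
    \<open>1 + f\<close> needs; the constant \<open>1\<close> is subtracted at the end.\<close>
  have main: "(\<lambda>n. ?w n * (\<integral>x. g x \<partial>conv_pow \<nu> n)) sums (\<integral>x. g x \<partial>compound_poisson \<nu>)"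
    if [measurable]: "g \<in> borel_measurable borel" and g: "\<And>x. 0 \<le> g x" "\<And>x. g x \<le> 2" for g :: "real \<Rightarrow> real"
  proof -
    have i: "integrable (conv_pow \<nu> n) g" for n
      by (rule integrable_const_bound[where B=2]) (use g in auto)
    have i': "integrable (compound_poisson \<nu>) g"
      by (rule CP.integrable_const_bound[where B=2]) (use g in auto)
    have "ennreal (\<integral>x. g x \<partial>compound_poisson \<nu>) = (\<integral>\<^sup>+x. g x \<partial>compound_poisson \<nu>)"
      using i' g by (simp add: nn_integral_eq_integral)
    also have "\<dots> = (\<Sum>n. ennreal (?w n) * (\<integral>\<^sup>+x. g x \<partial>conv_pow \<nu> n))"
      by (rule nn_integral_compound_poisson) measurable
    also have "\<dots> = (\<Sum>n. ennreal (?w n * (\<integral>x. g x \<partial>conv_pow \<nu> n)))"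
      using i g by (simp add: nn_integral_eq_integral ennreal_mult[symmetric] del: times_divide_eq_left)
    finally have eq: "(\<Sum>n. ennreal (?w n * (\<integral>x. g x \<partial>conv_pow \<nu> n))) = ennreal (\<integral>x. g x \<partial>compound_poisson \<nu>)" ..
    have nn: "0 \<le> ?w n * (\<integral>x. g x \<partial>conv_pow \<nu> n)" for n
      using g by (simp add: integral_nonneg)
    have "(\<lambda>n. ennreal (?w n * (\<integral>x. g x \<partial>conv_pow \<nu> n))) sums ennreal (\<integral>x. g x \<partial>compound_poisson \<nu>)"
      using eq by (metis summableI summable_sums)
    then show ?thesis
      by (subst (asm) sums_ennreal) (use nn g in \<open>auto simp: integral_nonneg\<close>)
  qed
  have i: "integrable (conv_pow \<nu> n) f" "integrable (compound_poisson \<nu>) f" for n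
    using bound by (auto intro!: integrable_const_bound[where B=1] CP.integrable_const_bound[where B=1])
  have "(\<lambda>n. ?w n * (\<integral>x. 1 + f x \<partial>conv_pow \<nu> n) - ?w n * (\<integral>x. 1 \<partial>conv_pow \<nu> n))
      sums ((\<integral>x. 1 + f x \<partial>compound_poisson \<nu>) - (\<integral>x. 1 \<partial>compound_poisson \<nu>))"
  proof (intro sums_diff main)
    show "0 \<le> 1 + f x" "1 + f x \<le> 2" for x using bound[of x] by auto
  qed auto
  then show ?thesis
    using i by (simp add: add_divide_distrib distrib_left)
qed

lemma char_compound_poisson:
  assumes fin: "finite_measure \<nu>" and sets[measurable_cong]: "sets \<nu> = sets borel"
  shows "char (compound_poisson \<nu>) t = exp (CLINT x|\<nu>. iexp (t * x) - 1)"
proof -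
  interpret CP: real_distribution "compound_poisson \<nu>"
    by (rule real_distribution_compound_poisson[OF fin sets])
  interpret N: finite_measure \<nu> by fact
  interpret finite_measure "conv_pow \<nu> n" for n by (rule finite_measure_conv_pow[OF fin sets])
  have sp: "space \<nu> = UNIV" using sets by (metis sets_eq_imp_space_eq space_borel)
  let ?w = "\<lambda>n::nat. exp (- measure \<nu> UNIV) / fact n"
  have i: "integrable (conv_pow \<nu> n) (\<lambda>x. iexp (t * x))" for n
    by (rule integrable_const_bound[where B=1]) auto
  have i': "integrable (compound_poisson \<nu>) (\<lambda>x. iexp (t * x))"
    by (rule CP.integrable_const_bound[where B=1]) auto
  have iN: "integrable \<nu> (\<lambda>x. iexp (t * x))"
    by (rule N.integrable_const_bound[where B=1]) auto
  have Re: "Re (char (conv_pow \<nu> n) t) = (\<integral>x. cos (t * x) \<partial>conv_pow \<nu> n)"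
    and Im: "Im (char (conv_pow \<nu> n) t) = (\<integral>x. sin (t * x) \<partial>conv_pow \<nu> n)" for n
    using integral_Re[OF i[of n]] integral_Im[OF i[of n]] by (simp_all add: char_def Re_exp Im_exp)
  have Re': "Re (char (compound_poisson \<nu>) t) = (\<integral>x. cos (t * x) \<partial>compound_poisson \<nu>)"
    and Im': "Im (char (compound_poisson \<nu>) t) = (\<integral>x. sin (t * x) \<partial>compound_poisson \<nu>)"
    using integral_Re[OF i'] integral_Im[OF i'] by (simp_all add: char_def Re_exp Im_exp)
  have Re_mult_real: "Re (complex_of_real a * z) = a * Re z"
    and Im_mult_real: "Im (complex_of_real a * z) = a * Im z" for a z
    by simp_all
  \<comment> \<open>Real and imaginary part separately, since the series formula is available for
    real functions bounded by \<open>1\<close>, here cosine and sine.\<close>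
  have "(\<lambda>n. complex_of_real (?w n) * char (conv_pow \<nu> n) t) sums char (compound_poisson \<nu>) t"
    unfolding sums_complex_iff using integral_compound_poisson_sums[OF fin sets, of "\<lambda>x. cos (t * x)"]
      integral_compound_poisson_sums[OF fin sets, of "\<lambda>x. sin (t * x)"]
    by (simp add: Re Im Re' Im' Re_mult_real Im_mult_real del: of_real_mult of_real_divide)
  moreover have "(\<lambda>n. complex_of_real (?w n) * char (conv_pow \<nu> n) t) sums
      (complex_of_real (exp (- measure \<nu> UNIV)) * exp (char \<nu> t))"
  proof -
    have "(\<lambda>n. complex_of_real (exp (- measure \<nu> UNIV)) * (char \<nu> t ^ n /\<^sub>R fact n)) sums
      (complex_of_real (exp (- measure \<nu> UNIV)) * exp (char \<nu> t))"
      by (intro sums_mult exp_converges)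
    moreover have "complex_of_real (?w n) * char (conv_pow \<nu> n) t =
        complex_of_real (exp (- measure \<nu> UNIV)) * (char \<nu> t ^ n /\<^sub>R fact n)" for n
      using fin sets by (simp add: char_conv_pow scaleR_conv_of_real divide_inverse mult.assoc)
    ultimately show ?thesis by simp
  qed
  ultimately have "char (compound_poisson \<nu>) t = complex_of_real (exp (- measure \<nu> UNIV)) * exp (char \<nu> t)"
    by (rule sums_unique2)
  also have "\<dots> = exp (char \<nu> t - of_real (measure \<nu> UNIV))"
    by (simp add: exp_diff exp_of_real exp_minus divide_inverse mult.commute)
  \<comment> \<open>The mass of \<open>\<nu>\<close> from the Poisson normalisation becomes the
    \<open>- 1\<close> under the integral.\<close>
  also have "char \<nu> t - of_real (measure \<nu> UNIV) = (CLINT x|\<nu>. iexp (t * x) - 1)"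
    using iN sp by (simp add: char_def scaleR_conv_of_real)
  finally show ?thesis .
qed

subsection \<open>Decomposition by jump size\<close>

text \<open>Second-order Taylor formula; \<bar>x\<bar> \<le> 1 confines the intermediate point to
  \<bar>\<theta>\<bar>, so the constant does not depend on \<open>x\<close>. It does for exponential
  moments what \<open>iexp_remainder_bound\<close> does for characteristic functions.\<close>

lemma exp_remainder_bound:
  fixes \<theta> x :: real
  assumes "\<bar>x\<bar> \<le> 1"
  shows "exp (\<theta> * x) - 1 - \<theta> * x \<le> \<theta>\<^sup>2 * exp \<bar>\<theta>\<bar> * x\<^sup>2"
proof -
  obtain t where t: "\<bar>t\<bar> \<le> \<bar>\<theta> * x\<bar>" "exp (\<theta> * x) = (\<Sum>m<2. (\<theta> * x) ^ m / fact m) + exp t / fact 2 * (\<theta> * x) ^ 2"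
    using Maclaurin_exp_le[of "\<theta> * x" 2] by blast
  have "\<bar>\<theta> * x\<bar> \<le> \<bar>\<theta>\<bar>"
    using assms by (simp add: abs_mult mult_left_le)
  then have "exp t \<le> exp \<bar>\<theta>\<bar>" using t(1) by simp
  then have "exp t / 2 \<le> exp \<bar>\<theta>\<bar>"
    using exp_gt_zero[of t] by linarith
  then have "exp t / 2 * (\<theta> * x)\<^sup>2 \<le> exp \<bar>\<theta>\<bar> * (\<theta> * x)\<^sup>2"
    by (intro mult_right_mono) auto
  with t(2) show ?thesis
    by (simp add: numeral_2_eq_2 power_mult_distrib algebra_simps)
qed

text \<open>Phrased through \<open>\<theta> * x\<close> so that both signs of
  \<open>\<theta>\<close> are covered: orders \<open>1\<close> and \<open>-1\<close> control the two
  tails for tightness, a large order gives decay at a prescribed rate.\<close>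

lemma measure_exp_Markov:
  assumes "real_distribution M"
    and B: "(\<integral>\<^sup>+x. ennreal (exp (\<theta> * x)) \<partial>M) \<le> ennreal B" "0 \<le> B"
  shows "measure M {x. R \<le> \<theta> * x} \<le> exp (- R) * B"
proof -
  interpret real_distribution M by fact
  have "emeasure M {x. R \<le> \<theta> * x} = (\<integral>\<^sup>+x. indicator {x. R \<le> \<theta> * x} x \<partial>M)"
    by simp
  also have "\<dots> \<le> (\<integral>\<^sup>+x. ennreal (exp (- R)) * ennreal (exp (\<theta> * x)) \<partial>M)"
    by (intro nn_integral_mono) (auto simp: indicator_def ennreal_mult[symmetric] exp_add[symmetric])
  also have "\<dots> \<le> ennreal (exp (- R)) * ennreal B"
    using B by (simp add: nn_integral_cmult mult_left_mono)
  also have "\<dots> = ennreal (exp (- R) * B)"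
    by (simp add: ennreal_mult')
  finally show ?thesis
    using B by (simp add: emeasure_eq_measure)
qed

lemma tight_exp_moments:
  assumes M: "\<And>n. real_distribution (M n)"
    and B1: "\<And>n. (\<integral>\<^sup>+x. ennreal (exp x) \<partial>M n) \<le> ennreal B"
    and B2: "\<And>n. (\<integral>\<^sup>+x. ennreal (exp (- x)) \<partial>M n) \<le> ennreal B"
    and "0 \<le> B"
  shows "tight M"
  unfolding tight_def
proof (intro conjI allI impI M)
  fix \<epsilon> :: real assume "\<epsilon> > 0"
  have "((\<lambda>R. exp (- R) * B + exp (- R) * B) \<longlongrightarrow> 0 * B + 0 * B) at_top"
    by (intro tendsto_intros filterlim_compose[OF exp_at_bot] filterlim_uminus_at_bot_at_top)
  then have "\<forall>\<^sub>F R in at_top. exp (- R) * B + exp (- R) * B < \<epsilon>"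
    using \<open>\<epsilon> > 0\<close> by (intro order_tendstoD(2)) auto
  then obtain R where R: "exp (- R) * B + exp (- R) * B < \<epsilon>" "R > 0"
    using eventually_happens'[OF trivial_limit_at_top_linorder, OF eventually_conj[OF _ eventually_gt_at_top[of 0]]] by blast
  show "\<exists>a b. a < b \<and> (\<forall>n. 1 - \<epsilon> < measure (M n) {a<..b})"
  proof (rule exI[of _ "- R"], rule exI[of _ R], intro conjI allI)
    show "- R < R" using R by simp
    fix n
    interpret real_distribution "M n" by (rule M)
    have "measure (M n) {x. R \<le> 1 * x} \<le> exp (- R) * B"
      using B1[of n] \<open>0 \<le> B\<close> by (intro measure_exp_Markov M) auto
    moreover have "measure (M n) {x. R \<le> -1 * x} \<le> exp (- R) * B"
      using B2[of n] \<open>0 \<le> B\<close> by (intro measure_exp_Markov M) auto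
    moreover have "measure (M n) (UNIV - {- R<..R}) \<le> measure (M n) ({x. R \<le> 1 * x} \<union> {x. R \<le> -1 * x})"
      by (intro finite_measure_mono) auto
    moreover have "\<dots> \<le> measure (M n) {x. R \<le> 1 * x} + measure (M n) {x. R \<le> -1 * x}"
      by (intro measure_Un_le) auto
    moreover have "measure (M n) (UNIV - {- R<..R}) = 1 - measure (M n) {- R<..R}"
      using prob_compl[of "{- R<..R}"] by simp
    ultimately show "1 - \<epsilon> < measure (M n) {- R<..R}"
      using R(1) by linarith
  qed
qed

text \<open>The exponential is unbounded, so weak convergence applies only to its truncations at
  \<open>N\<close>; Fatou's lemma removes the truncation.\<close>

lemma weak_conv_exp_moment_bound:
  assumes M: "\<And>n. real_distribution (M n)" and M': "real_distribution M'"
    and conv: "weak_conv_m M M'"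
    and B: "\<And>n. (\<integral>\<^sup>+x. ennreal (exp (\<theta> * x)) \<partial>M n) \<le> ennreal B" "0 \<le> B"
  shows "(\<integral>\<^sup>+x. ennreal (exp (\<theta> * x)) \<partial>M') \<le> ennreal B"
proof -
  interpret M': real_distribution M' by fact
  interpret M: real_distribution "M n" for n by fact
  have trunc: "(\<integral>\<^sup>+x. ennreal (min (exp (\<theta> * x)) (real N)) \<partial>M') \<le> ennreal B" for N :: nat
  proof -
    let ?f = "\<lambda>x. min (exp (\<theta> * x)) (real N)"
    have "(\<lambda>n. \<integral>x. ?f x \<partial>M n) \<longlonglongrightarrow> (\<integral>x. ?f x \<partial>M')"
      by (rule weak_conv_imp_integral_bdd_continuous_conv[OF M M' conv, where B="real N"])
        (auto intro!: continuous_intros)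
    moreover have "(\<integral>x. ?f x \<partial>M n) \<le> B" for n
    proof -
      have "ennreal (\<integral>x. ?f x \<partial>M n) = (\<integral>\<^sup>+x. ?f x \<partial>M n)"
        by (intro nn_integral_eq_integral[symmetric] M.integrable_const_bound[where B="real N"]) auto
      also have "\<dots> \<le> (\<integral>\<^sup>+x. ennreal (exp (\<theta> * x)) \<partial>M n)"
        by (intro nn_integral_mono) (auto intro!: ennreal_leI)
      also have "\<dots> \<le> ennreal B" by (rule B)
      finally show ?thesis using B(2) by simp
    qed
    ultimately have "(\<integral>x. ?f x \<partial>M') \<le> B"
      by (intro LIMSEQ_le_const2) auto
    moreover have "(\<integral>\<^sup>+x. ?f x \<partial>M') = ennreal (\<integral>x. ?f x \<partial>M')"
      by (intro nn_integral_eq_integral M'.integrable_const_bound[where B="real N"]) auto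
    ultimately show ?thesis by (simp add: ennreal_leI)
  qed
  have lim: "(\<lambda>N. ennreal (min (exp (\<theta> * x)) (real N))) \<longlonglongrightarrow> ennreal (exp (\<theta> * x))" for x
  proof (rule tendsto_eventually)
    obtain N0 :: nat where "exp (\<theta> * x) \<le> real N0" using real_arch_simple by blast
    then show "\<forall>\<^sub>F N in sequentially. ennreal (min (exp (\<theta> * x)) (real N)) = ennreal (exp (\<theta> * x))"
      unfolding eventually_sequentially
      by (intro exI[of _ N0]) (auto simp: min_def intro: order.antisym dest: order_trans)
  qed
  have "(\<integral>\<^sup>+x. ennreal (exp (\<theta> * x)) \<partial>M') =
      (\<integral>\<^sup>+x. liminf (\<lambda>N. ennreal (min (exp (\<theta> * x)) (real N))) \<partial>M')"
    by (intro nn_integral_cong) (simp add: lim_imp_Liminf[OF _ lim])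
  also have "\<dots> \<le> liminf (\<lambda>N. \<integral>\<^sup>+x. ennreal (min (exp (\<theta> * x)) (real N)) \<partial>M')"
    by (rule nn_integral_liminf) measurable
  also have "\<dots> \<le> liminf (\<lambda>N::nat. ennreal B)"
    by (intro Liminf_mono always_eventually allI trunc)
  finally show ?thesis by (simp add: Liminf_const)
qed

lemma nn_integral_exp_shift:
  assumes [measurable_cong]: "sets M = sets borel"
  shows "(\<integral>\<^sup>+x. ennreal (exp (\<theta> * x)) \<partial>distr M borel (\<lambda>x. x - a)) =
    ennreal (exp (- \<theta> * a)) * (\<integral>\<^sup>+x. ennreal (exp (\<theta> * x)) \<partial>M)"
  by (simp add: nn_integral_distr nn_integral_cmult[symmetric] ennreal_mult[symmetric]
      exp_add[symmetric] algebra_simps)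

lemma char_shift:
  assumes [measurable_cong]: "sets M = sets borel"
  shows "char (distr M borel (\<lambda>x. x - a)) t = iexp (- t * a) * char M t"
proof -
  have "char (distr M borel (\<lambda>x. x - a)) t = (CLINT x|M. iexp (- t * a) * iexp (t * x))"
    unfolding char_def by (subst integral_distr)
      (auto simp: exp_add[symmetric] algebra_simps intro!: Bochner_Integration.integral_cong)
  then show ?thesis by (simp add: char_def)
qed

lemma iexp_remainder_bound: "cmod (iexp y - 1 - \<i> * of_real y) \<le> y\<^sup>2"
proof -
  have "cmod (iexp y - (\<Sum>k \<le> 1. (\<i> * y)^k / fact k)) \<le> \<bar>y\<bar>^2 / 2"
    using iexp_approx1[of y 1] by (simp add: numeral_2_eq_2)
  also have "\<bar>y\<bar>^2 / 2 \<le> y\<^sup>2" by simp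
  finally show ?thesis by (simp add: diff_diff_eq)
qed

text \<open>Jumps of size at most \<open>1/(n+1)\<close> are discarded and the rest is compensated; the
  exponential moments of the resulting compound Poisson laws stay bounded, so they are tight.\<close>

lemma compensated_small_jumps_exist:
  assumes sets[measurable_cong]: "sets \<nu> = sets borel"
    and sq: "(\<integral>\<^sup>+x. ennreal (x\<^sup>2) \<partial>\<nu>) < \<infinity>"
    and small: "AE x in \<nu>. \<bar>x\<bar> \<le> 1" and zero: "emeasure \<nu> {0} = 0"
  obtains M where "real_distribution M"
    and "\<And>t. char M t = exp (CLINT x|\<nu>. iexp (t * x) - 1 - \<i> * of_real (t * x))"
    and "\<And>\<theta>. (\<integral>\<^sup>+x. ennreal (exp (\<theta> * x)) \<partial>M) < \<infinity>"
proof -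
  define A where "A n = {x::real. 1 / (real n + 1) < \<bar>x\<bar>}" for n
  define N where "N n = density \<nu> (\<lambda>x. ennreal (indicator (A n) x))" for n
  have [measurable]: "A n \<in> sets borel" for n unfolding A_def by measurable
  have setsN[simp, measurable_cong]: "sets (N n) = sets borel" for n by (simp add: N_def sets)
  have sp: "space \<nu> = UNIV" using sets by (metis sets_eq_imp_space_eq space_borel)
  have sqi: "integrable \<nu> (\<lambda>x. x\<^sup>2)"
    using sq by (intro integrableI_bounded) auto
  have finN: "finite_measure (N n)" for n
  proof
    have "emeasure (N n) (space (N n)) = (\<integral>\<^sup>+x. ennreal (indicator (A n) x) \<partial>\<nu>)"
      using sp by (simp add: N_def emeasure_density)
    \<comment> \<open>Chebyshev: a jump in \<open>A n\<close> satisfies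
      \<open>(n + 1) * \<bar>x\<bar> > 1\<close>, so the second moment bounds the mass.\<close>
    also have "\<dots> \<le> (\<integral>\<^sup>+x. ennreal ((real n + 1)\<^sup>2) * ennreal (x\<^sup>2) \<partial>\<nu>)"
    proof (intro nn_integral_mono)
      fix x
      have "1 \<le> (real n + 1)\<^sup>2 * x\<^sup>2" if "x \<in> A n"
      proof -
        have "1 \<le> (real n + 1) * \<bar>x\<bar>" using that by (simp add: A_def field_simps)
        then have "1 \<le> ((real n + 1) * \<bar>x\<bar>)\<^sup>2" by (rule one_le_power)
        then show ?thesis by (simp add: power_mult_distrib)
      qed
      then show "ennreal (indicator (A n) x) \<le> ennreal ((real n + 1)\<^sup>2) * ennreal (x\<^sup>2)"
        by (auto simp: indicator_def ennreal_mult[symmetric] simp flip: ennreal_1 intro!: ennreal_leI)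
    qed
    also have "\<dots> < \<infinity>"
      using sq by (simp add: nn_integral_cmult ennreal_mult_less_top)
    finally show "emeasure (N n) (space (N n)) \<noteq> \<infinity>" by simp
  qed
  have spN: "space (N n) = UNIV" for n by (simp add: N_def sp)
  have smallN: "AE x in N n. \<bar>x\<bar> \<le> 1" for n
    using small unfolding N_def by (subst AE_density) (auto elim!: eventually_mono)
  have iN: "integrable (N n) (f :: real \<Rightarrow> real)" if "f \<in> borel_measurable borel" "\<And>x. \<bar>x\<bar> \<le> 1 \<Longrightarrow> norm (f x) \<le> B" for n f B
    using that smallN[of n] finN[of n]
    by (intro finite_measure.integrable_const_bound[where B=B]) (auto elim!: eventually_mono)
  \<comment> \<open>Mean of the retained jumps. Shifting by it produces the compensator inside the
    exponent.\<close>
  define a where "a n = (\<integral>x. x \<partial>N n)" for n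
  define X where "X n = distr (compound_poisson (N n)) borel (\<lambda>x. x - a n)" for n
  have X: "real_distribution (X n)" for n
  proof -
    interpret real_distribution "compound_poisson (N n)"
      by (rule real_distribution_compound_poisson[OF finN setsN])
    show ?thesis unfolding X_def by (rule real_distribution_distr) auto
  qed
  have charX: "char (X n) t = exp (CLINT x|\<nu>. indicator (A n) x *\<^sub>R (iexp (t * x) - 1 - \<i> * of_real (t * x)))" for n t
  proof -
    interpret finite_measure "N n" by (rule finN)
    have i1: "complex_integrable (N n) (\<lambda>x. iexp (t * x) - 1)"
      by (rule integrable_const_bound[where B=2])
        (auto intro!: AE_I2 order_trans[OF norm_triangle_ineq4])
    have i2: "integrable (N n) (\<lambda>x. x)" by (rule iN[where B=1]) auto
    have "char (X n) t = iexp (- t * a n) * exp (CLINT x|N n. iexp (t * x) - 1)"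
      unfolding X_def by (simp add: char_shift char_compound_poisson finN)
    also have "\<dots> = exp ((CLINT x|N n. iexp (t * x) - 1) - (CLINT x|N n. \<i> * of_real (t * x)))"
      by (simp add: exp_diff exp_minus divide_inverse mult.commute a_def mult.left_commute)
    also have "(CLINT x|N n. iexp (t * x) - 1) - (CLINT x|N n. \<i> * of_real (t * x)) =
        (CLINT x|N n. iexp (t * x) - 1 - \<i> * of_real (t * x))"
      using i1 i2 by (intro Bochner_Integration.integral_diff[symmetric]) (auto intro!: integrable_mult_right)
    also have "\<dots> = (CLINT x|\<nu>. indicator (A n) x *\<^sub>R (iexp (t * x) - 1 - \<i> * of_real (t * x)))"
      unfolding N_def by (rule integral_density) auto
    finally show ?thesis .
  qed
  have charlim: "(\<lambda>n. char (X n) t) \<longlonglongrightarrow> exp (CLINT x|\<nu>. iexp (t * x) - 1 - \<i> * of_real (t * x))" for t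
    unfolding charX
  proof (intro tendsto_exp integral_dominated_convergence[where w="\<lambda>x. t\<^sup>2 * x\<^sup>2"])
    show "integrable \<nu> (\<lambda>x. t\<^sup>2 * x\<^sup>2)" using sqi by simp
    show "AE x in \<nu>. norm (indicator (A n) x *\<^sub>R (iexp (t * x) - 1 - \<i> * of_real (t * x))) \<le> t\<^sup>2 * x\<^sup>2" for n
    proof (rule AE_I2)
      fix x
      show "norm (indicator (A n) x *\<^sub>R (iexp (t * x) - 1 - \<i> * of_real (t * x))) \<le> t\<^sup>2 * x\<^sup>2"
        using iexp_remainder_bound[of "t * x"] by (auto simp: indicator_def power_mult_distrib)
    qed
    have "AE x in \<nu>. x \<noteq> 0"
      using zero by (intro AE_I[of _ _ "{0}"]) (auto simp: sets)
    then show "AE x in \<nu>. (\<lambda>n. indicator (A n) x *\<^sub>R (iexp (t * x) - 1 - \<i> * of_real (t * x)))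
        \<longlonglongrightarrow> iexp (t * x) - 1 - \<i> * of_real (t * x)"
    proof eventually_elim
      case (elim x)
      then have "\<forall>\<^sub>F n in sequentially. 1 / (real n + 1) < \<bar>x\<bar>"
        using LIMSEQ_inverse_real_of_nat by (intro order_tendstoD(2)[where y=0]) (auto simp: inverse_eq_divide add.commute)
      then show ?case
        by (intro tendsto_eventually) (auto elim!: eventually_mono simp: A_def)
    qed
  qed measurable
  define V where "V = (\<integral>x. x\<^sup>2 \<partial>\<nu>)"
  \<comment> \<open>Compensation removes the linear term, leaving the integral of a second-order
    remainder. The second moment \<open>V\<close> bounds it independently of \<open>n\<close>,
    although the masses of the \<open>N n\<close> may be unbounded.\<close>
  have expX: "(\<integral>\<^sup>+x. ennreal (exp (\<theta> * x)) \<partial>X n) \<le> ennreal (exp (\<theta>\<^sup>2 * exp \<bar>\<theta>\<bar> * V))" for \<theta> n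
  proof -
    interpret finite_measure "N n" by (rule finN)
    have bd: "exp (\<theta> * x) \<le> exp \<bar>\<theta>\<bar>" if "\<bar>x\<bar> \<le> 1" for x
    proof -
      have "\<theta> * x \<le> \<bar>\<theta>\<bar> * \<bar>x\<bar>" by (simp add: abs_mult[symmetric])
      also have "\<dots> \<le> \<bar>\<theta>\<bar>" using that by (intro mult_left_le) auto
      finally show ?thesis by simp
    qed
    have ie: "integrable (N n) (\<lambda>x. exp (\<theta> * x))" by (rule iN[where B="exp \<bar>\<theta>\<bar>"]) (use bd in \<open>simp_all del: exp_le_cancel_iff\<close>)
    have ix: "integrable (N n) (\<lambda>x. x)" by (rule iN[where B=1]) auto
    have "(\<integral>\<^sup>+x. ennreal (exp (\<theta> * x)) \<partial>X n) =
        ennreal (exp (- \<theta> * a n)) * ennreal (exp ((\<integral>x. exp (\<theta> * x) \<partial>N n) - measure (N n) UNIV))"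
      unfolding X_def nn_integral_exp_shift[OF sets_compound_poisson]
      by (subst nn_integral_exp_compound_poisson[OF finN setsN nn_integral_eq_integral[OF ie]]) auto
    also have "\<dots> = ennreal (exp ((\<integral>x. exp (\<theta> * x) \<partial>N n) - measure (N n) UNIV - \<theta> * a n))"
      by (simp add: ennreal_mult[symmetric] exp_add[symmetric])
    also have "(\<integral>x. exp (\<theta> * x) \<partial>N n) - measure (N n) UNIV - \<theta> * a n = (\<integral>x. exp (\<theta> * x) - 1 - \<theta> * x \<partial>N n)"
      using ie ix by (simp add: a_def spN)
    also have "\<dots> = (\<integral>x. indicator (A n) x *\<^sub>R (exp (\<theta> * x) - 1 - \<theta> * x) \<partial>\<nu>)"
      unfolding N_def by (rule integral_density) auto
    also have "\<dots> \<le> (\<integral>x. \<theta>\<^sup>2 * exp \<bar>\<theta>\<bar> * x\<^sup>2 \<partial>\<nu>)"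
    proof (rule integral_mono_AE')
      show "integrable \<nu> (\<lambda>x. \<theta>\<^sup>2 * exp \<bar>\<theta>\<bar> * x\<^sup>2)" using sqi by simp
      show "AE x in \<nu>. indicator (A n) x *\<^sub>R (exp (\<theta> * x) - 1 - \<theta> * x) \<le> \<theta>\<^sup>2 * exp \<bar>\<theta>\<bar> * x\<^sup>2"
        using small by eventually_elim (auto simp: indicator_def exp_remainder_bound)
      show "AE x in \<nu>. 0 \<le> \<theta>\<^sup>2 * exp \<bar>\<theta>\<bar> * x\<^sup>2" by simp
    qed
    also have "\<dots> = \<theta>\<^sup>2 * exp \<bar>\<theta>\<bar> * V" by (simp add: V_def)
    finally show ?thesis by (simp add: ennreal_leI)
  qed
  \<comment> \<open>A subsequential limit is enough: \<open>charlim\<close> determines its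
    characteristic function, and the uniform moment bounds pass to it.\<close>
  have "tight X"
    using expX[where \<theta>=1] expX[where \<theta>="-1"]
    by (intro tight_exp_moments[where B="exp (exp 1 * V)"] X) auto
  from tight_imp_convergent_subsubsequence[OF this strict_mono_id]
  obtain r M where r: "strict_mono r" "real_distribution M" "weak_conv_m (X \<circ> r) M" by auto
  show ?thesis
  proof (rule that[of M])
    show "real_distribution M" by fact
    show "char M t = exp (CLINT x|\<nu>. iexp (t * x) - 1 - \<i> * of_real (t * x))" for t
    proof (rule LIMSEQ_unique)
      show "(\<lambda>n. char ((X \<circ> r) n) t) \<longlonglongrightarrow> char M t"
        using X r by (intro levy_continuity1[where M="X \<circ> r"]) auto
      show "(\<lambda>n. char ((X \<circ> r) n) t) \<longlonglongrightarrow> exp (CLINT x|\<nu>. iexp (t * x) - 1 - \<i> * of_real (t * x))"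
        using LIMSEQ_subseq_LIMSEQ[OF charlim r(1)] by (simp add: o_def)
    qed
    show "(\<integral>\<^sup>+x. ennreal (exp (\<theta> * x)) \<partial>M) < \<infinity>" for \<theta>
      using weak_conv_exp_moment_bound[OF _ r(2,3), of \<theta> "exp (\<theta>\<^sup>2 * exp \<bar>\<theta>\<bar> * V)"] X expX
      by (auto simp: le_less_trans[OF _ ennreal_less_top])
  qed
qed

text \<open>Built as an affine image of the standard normal law, so that the degenerate case
  \<open>A = 0\<close> is included.\<close>

lemma normal_law_exists:
  fixes b A :: real
  assumes "0 \<le> A"
  obtains M where "real_distribution M"
    and "\<And>t. char M t = exp (\<i> * of_real (b * t) - of_real (A * t\<^sup>2 / 2))"
    and "\<And>\<theta>. (\<integral>\<^sup>+x. ennreal (exp (\<theta> * x)) \<partial>M) < \<infinity>"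
proof -
  interpret S: real_distribution std_normal_distribution by (rule real_dist_normal_dist)
  define M where "M = distr std_normal_distribution borel (\<lambda>x. b + sqrt A * x)"
  show ?thesis
  proof (rule that[of M])
    show "real_distribution M" unfolding M_def by (rule S.real_distribution_distr) auto
    show "char M t = exp (\<i> * of_real (b * t) - of_real (A * t\<^sup>2 / 2))" for t
    proof -
      have "char M t = (CLINT x|std_normal_distribution. iexp (t * b) * iexp ((t * sqrt A) * x))"
        unfolding char_def M_def by (subst integral_distr)
          (auto simp: exp_add[symmetric] algebra_simps intro!: Bochner_Integration.integral_cong)
      also have "\<dots> = iexp (t * b) * char std_normal_distribution (t * sqrt A)"
        by (simp add: char_def)
      also have "\<dots> = iexp (t * b) * exp (of_real (- (A * t\<^sup>2) / 2))"
        using assms by (simp add: char_std_normal_distribution power_mult_distrib mult.commute flip: exp_of_real of_real_power)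
      also have "\<dots> = exp (\<i> * of_real (b * t) - of_real (A * t\<^sup>2 / 2))"
        by (simp add: exp_add[symmetric] algebra_simps)
      finally show ?thesis .
    qed
    show "(\<integral>\<^sup>+x. ennreal (exp (\<theta> * x)) \<partial>M) < \<infinity>" for \<theta>
    proof -
      define c where "c = \<theta> * sqrt A"
      \<comment> \<open>Completion of the square.\<close>
      have eq: "std_normal_density x * exp (\<theta> * (b + sqrt A * x)) = exp (\<theta> * b + c\<^sup>2 / 2) * normal_density c 1 x" for x
        by (simp add: normal_density_def c_def exp_add[symmetric] power2_eq_square field_simps)
      have "(\<integral>\<^sup>+x. ennreal (exp (\<theta> * x)) \<partial>M) = (\<integral>\<^sup>+x. ennreal (exp (\<theta> * b + c\<^sup>2 / 2)) * ennreal (normal_density c 1 x) \<partial>lborel)"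
        unfolding M_def by (simp add: nn_integral_distr nn_integral_density ennreal_mult[symmetric] eq)
      also have "\<dots> = ennreal (exp (\<theta> * b + c\<^sup>2 / 2))"
        using prob_space.emeasure_space_1[OF prob_space_normal_density[of 1 c]]
        by (simp add: nn_integral_cmult emeasure_density)
      finally show ?thesis by simp
    qed
  qed
qed

text \<open>The factor \<open>M\<close> collects the Gaussian part, the drift, and all jumps not exceeding \<open>1\<close>, negative ones included.\<close>

lemma levy_large_jump_decomposition:
  assumes mu: "has_levy_triplet \<mu> b A \<nu>"
  defines "P \<equiv> density \<nu> (\<lambda>x. ennreal (indicator {1<..} x))"
  obtains M where "real_distribution M" and "finite_measure P"
    and "\<And>\<theta>. 0 \<le> \<theta> \<Longrightarrow> (\<integral>\<^sup>+x. ennreal (exp (\<theta> * x)) \<partial>M) < \<infinity>"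
    and "\<mu> = (M \<star> compound_poisson P)"
proof -
  have A: "0 \<le> A" and rd: "real_distribution \<mu>" and lv: "is_levy_measure \<nu>"
    and ch: "\<And>t. char \<mu> t = exp (\<i> * complex_of_real (b * t) - complex_of_real (A * t\<^sup>2 / 2)
             + (CLINT x|\<nu>. iexp (t * x) - 1 - \<i> * complex_of_real (t * x * indicator {-1..1} x)))"
    using mu by (auto simp: has_levy_triplet_def)
  have sets[measurable_cong]: "sets \<nu> = sets borel" and zero: "emeasure \<nu> {0} = 0"
    and fin: "(\<integral>\<^sup>+ x. ennreal (min 1 (x\<^sup>2)) \<partial>\<nu>) < \<infinity>"
    using lv by (auto simp: is_levy_measure_def)
  have sp: "space \<nu> = UNIV" using sets by (metis sets_eq_imp_space_eq space_borel)
  \<comment> \<open>\<open>S\<close> keeps the compensated jumps. \<open>N\<close> and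
    \<open>P\<close> stay uncompensated and are finite because \<open>min 1 (x\<^sup>2)\<close>
    equals \<open>1\<close> on them.\<close>
  define N where "N = density \<nu> (\<lambda>x. ennreal (indicator {..< -1} x))"
  define S where "S = density \<nu> (\<lambda>x. ennreal (indicator {-1..1} x))"
  have sets'[simp, measurable_cong]: "sets N = sets borel" "sets S = sets borel" "sets P = sets borel"
    by (simp_all add: N_def S_def P_def sets)
  have big: "finite_measure (density \<nu> (\<lambda>x. ennreal (indicator B x)))"
    if [measurable]: "B \<in> sets borel" and "\<And>x. x \<in> B \<Longrightarrow> 1 \<le> x\<^sup>2" for B
  proof
    have "(\<integral>\<^sup>+x. ennreal (indicator B x) \<partial>\<nu>) \<le> (\<integral>\<^sup>+ x. ennreal (min 1 (x\<^sup>2)) \<partial>\<nu>)"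
      using that by (intro nn_integral_mono ennreal_leI) (auto simp: indicator_def)
    then show "emeasure (density \<nu> (\<lambda>x. ennreal (indicator B x))) (space (density \<nu> (\<lambda>x. ennreal (indicator B x)))) \<noteq> \<infinity>"
      using fin sp by (auto simp: emeasure_density top_unique)
  qed
  have finN: "finite_measure N" unfolding N_def
  proof (rule big)
    show "1 \<le> x\<^sup>2" if "x \<in> {..< -1}" for x :: real
      using that power_mono[of 1 "-x" 2] by simp
  qed auto
  have finP: "finite_measure P" unfolding P_def by (rule big) auto
  obtain G where G: "real_distribution G"
      "\<And>t. char G t = exp (\<i> * of_real (b * t) - of_real (A * t\<^sup>2 / 2))"
      "\<And>\<theta>. (\<integral>\<^sup>+x. ennreal (exp (\<theta> * x)) \<partial>G) < \<infinity>"
    using normal_law_exists[OF A] by blast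
  have AES: "AE x in S. \<bar>x\<bar> \<le> 1"
    unfolding S_def by (subst AE_density) (auto simp: indicator_def)
  have zeroS: "emeasure S {0} = 0"
  proof -
    have "emeasure S {0} \<le> (\<integral>\<^sup>+x. indicator {0} x \<partial>\<nu>)"
      unfolding S_def
      by (subst emeasure_density, simp, simp add: sets, intro nn_integral_mono) (auto simp: indicator_def)
    then show ?thesis using zero by (simp add: sets)
  qed
  have "(\<integral>\<^sup>+x. ennreal (x\<^sup>2) \<partial>S) = (\<integral>\<^sup>+x. ennreal (indicator {-1..1} x) * ennreal (x\<^sup>2) \<partial>\<nu>)"
    unfolding S_def by (subst nn_integral_density) auto
  also have "\<dots> \<le> (\<integral>\<^sup>+ x. ennreal (min 1 (x\<^sup>2)) \<partial>\<nu>)"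
  proof (rule nn_integral_mono)
    fix x :: real
    have "x\<^sup>2 \<le> 1" if "x \<in> {-1..1}" using that by (simp add: abs_le_iff abs_square_le_1)
    then show "ennreal (indicator {-1..1} x) * ennreal (x\<^sup>2) \<le> ennreal (min 1 (x\<^sup>2))"
      by (auto simp: indicator_def min_def)
  qed
  also note fin
  finally have sqS: "(\<integral>\<^sup>+x. ennreal (x\<^sup>2) \<partial>S) < \<infinity>" .
  obtain Z where Z: "real_distribution Z"
      "\<And>t. char Z t = exp (CLINT x|S. iexp (t * x) - 1 - \<i> * of_real (t * x))"
      "\<And>\<theta>. (\<integral>\<^sup>+x. ennreal (exp (\<theta> * x)) \<partial>Z) < \<infinity>"
    using compensated_small_jumps_exist[OF sets'(2) sqS AES zeroS] by blast
  define M where "M = (G \<star> (Z \<star> compound_poisson N))"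
  have cpN: "real_distribution (compound_poisson N)" and cpP: "real_distribution (compound_poisson P)"
    by (intro real_distribution_compound_poisson finN finP sets')+
  have fm: "finite_measure Q" "sets Q = sets borel" if "real_distribution Q" for Q
    using that by (auto simp: real_distribution_def real_distribution_axioms_def prob_space.finite_measure)
  have ZN: "real_distribution (Z \<star> compound_poisson N)"
    by (intro real_distribution_convolution Z cpN)
  have M: "real_distribution M"
    unfolding M_def by (intro real_distribution_convolution G ZN)
  have int: "complex_integrable \<nu> (\<lambda>x. iexp (t * x) - 1 - \<i> * complex_of_real (t * x * indicator {-1..1} x))" (is "integrable _ ?f") for t
  \<comment> \<open>The constant serves both regions: \<open>t\<^sup>2\<close> comes from the
    quadratic remainder on [-1, 1], \<open>2\<close> from the trivial bound outside, where the
    compensator is absent.\<close>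
  proof (rule Bochner_Integration.integrable_bound)
    show "integrable \<nu> (\<lambda>x. (2 + t\<^sup>2) * min 1 (x\<^sup>2))"
      using fin by (intro integrable_mult_right integrableI_bounded) auto
    show "AE x in \<nu>. norm (?f x) \<le> norm ((2 + t\<^sup>2) * min 1 (x\<^sup>2))"
    proof (rule AE_I2)
      fix x :: real
      show "norm (?f x) \<le> norm ((2 + t\<^sup>2) * min 1 (x\<^sup>2))"
      proof (cases "x \<in> {-1..1}")
        case True
        then have "x\<^sup>2 \<le> 1" by (simp add: abs_le_iff abs_square_le_1)
        then show ?thesis
          using True iexp_remainder_bound[of "t * x"]
          by (auto simp: min_def power_mult_distrib abs_mult distrib_right intro: order_trans)
      next
        case False
        then have "1 \<le> x\<^sup>2" by (metis abs_square_le_1 abs_le_iff atLeastAtMost_iff linorder_linear minus_le_iff)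
        moreover have "norm (?f x) \<le> 2"
          using False norm_triangle_ineq4[of "iexp (t * x)" 1] by simp
        moreover have "2 \<le> 2 + t\<^sup>2" by simp
        ultimately have "norm (?f x) \<le> 2 + t\<^sup>2" by (meson order_trans)
        then show ?thesis using \<open>1 \<le> x\<^sup>2\<close> by (simp add: min_def)
      qed
    qed
  qed measurable
  have "char \<mu> = char (M \<star> compound_poisson P)"
  proof
    fix t
    let ?f = "\<lambda>x. iexp (t * x) - 1 - \<i> * complex_of_real (t * x * indicator {-1..1} x)"
    have part: "complex_integrable \<nu> (\<lambda>x. indicator B x *\<^sub>R ?f x)" if "B \<in> sets borel" for B
      using integrable_mult_indicator[OF _ int[of t], of B] that sets by simp
    have "(CLINT x|\<nu>. ?f x) = (CLINT x|\<nu>. indicator {-1..1} x *\<^sub>R ?f x + indicator {..< -1} x *\<^sub>R ?f x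
        + indicator {1<..} x *\<^sub>R ?f x)"
      by (intro Bochner_Integration.integral_cong) (auto simp: indicator_def)
    also have "\<dots> = (CLINT x|\<nu>. indicator {-1..1} x *\<^sub>R ?f x) + (CLINT x|\<nu>. indicator {..< -1} x *\<^sub>R ?f x)
        + (CLINT x|\<nu>. indicator {1<..} x *\<^sub>R ?f x)"
      using part by (simp add: integrable_add)
    also have "(CLINT x|\<nu>. indicator {-1..1} x *\<^sub>R ?f x) = (CLINT x|S. iexp (t * x) - 1 - \<i> * of_real (t * x))"
      unfolding S_def by (subst integral_density) (auto intro!: Bochner_Integration.integral_cong simp: indicator_def)
    also have "(CLINT x|\<nu>. indicator {..< -1} x *\<^sub>R ?f x) = (CLINT x|N. iexp (t * x) - 1)"
      unfolding N_def by (subst integral_density) (auto intro!: Bochner_Integration.integral_cong simp: indicator_def)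
    also have "(CLINT x|\<nu>. indicator {1<..} x *\<^sub>R ?f x) = (CLINT x|P. iexp (t * x) - 1)"
      unfolding P_def by (subst integral_density) (auto intro!: Bochner_Integration.integral_cong simp: indicator_def)
    finally have split: "(CLINT x|\<nu>. ?f x) = (CLINT x|S. iexp (t * x) - 1 - \<i> * of_real (t * x))
        + (CLINT x|N. iexp (t * x) - 1) + (CLINT x|P. iexp (t * x) - 1)" .
    have "char (M \<star> compound_poisson P) t =
        char G t * (char Z t * char (compound_poisson N) t) * char (compound_poisson P) t"
      unfolding M_def using fm[OF G(1)] fm[OF Z(1)] fm[OF cpN] fm[OF cpP] fm[OF ZN] fm[OF M[unfolded M_def]]
      by (simp add: char_convolution)
    also have "\<dots> = char \<mu> t"
      unfolding ch split G(2) Z(2) char_compound_poisson[OF finN sets'(1)] char_compound_poisson[OF finP sets'(3)]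
      by (simp add: exp_add[symmetric] add.assoc)
    finally show "char \<mu> t = char (M \<star> compound_poisson P) t" ..
  qed
  then have eq: "\<mu> = (M \<star> compound_poisson P)"
    by (intro Levy_uniqueness rd real_distribution_convolution M cpP)
  have "(\<integral>\<^sup>+x. ennreal (exp (\<theta> * x)) \<partial>M) < \<infinity>" if "0 \<le> \<theta>" for \<theta>
  proof -
    have "(\<integral>\<^sup>+x. ennreal (exp (\<theta> * x)) \<partial>N) = (\<integral>\<^sup>+x. ennreal (indicator {..< -1} x) * ennreal (exp (\<theta> * x)) \<partial>\<nu>)"
      unfolding N_def by (subst nn_integral_density) auto
    also have "\<dots> \<le> (\<integral>\<^sup>+x. ennreal (indicator {..< -1} x) \<partial>\<nu>)"
    proof (rule nn_integral_mono)
      fix x :: real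
      \<comment> \<open>The only place where the sign of \<open>\<theta>\<close> matters: large
        negative jumps can only lower a moment of nonnegative order.\<close>
      have "\<theta> * x \<le> 0" if "x < -1" using \<open>0 \<le> \<theta>\<close> that by (simp add: mult_nonneg_nonpos)
      then show "ennreal (indicator {..< -1} x) * ennreal (exp (\<theta> * x)) \<le> ennreal (indicator {..< -1} x)"
        by (auto simp: indicator_def)
    qed
    also have "\<dots> = emeasure N (space N)"
      using sp by (simp add: N_def emeasure_density)
    also have "\<dots> < \<infinity>"
      using finite_measure.emeasure_finite[OF finN, of "space N"] by (simp add: less_top)
    finally obtain m where m: "(\<integral>\<^sup>+x. ennreal (exp (\<theta> * x)) \<partial>N) = ennreal m" "0 \<le> m"
      by (metis ennreal_cases infinity_ennreal_def less_irrefl)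
    have "(\<integral>\<^sup>+x. ennreal (exp (\<theta> * x)) \<partial>compound_poisson N) < \<infinity>"
      using nn_integral_exp_compound_poisson[OF finN sets'(1) m] by simp
    then show ?thesis
      unfolding M_def using G(3)[of \<theta>] Z(3)[of \<theta>] fm[OF G(1)] fm[OF Z(1)] fm[OF cpN] fm[OF ZN]
      by (simp add: nn_integral_exp_convolution ennreal_mult_less_top)
  qed
  then show ?thesis using that[OF M finP _ eq] by blast
qed

subsection \<open>Laplace transforms near zero\<close>

lemma nn_integral_exp_atLeast:
  fixes u x :: real
  assumes "0 < x"
  shows "(\<integral>\<^sup>+w. ennreal (x * exp (- (w * x))) * indicator {u..} w \<partial>lborel) = ennreal (exp (- (u * x)))"
proof -
  have lim: "((\<lambda>w. - exp (- (w * x))) \<longlongrightarrow> - 0) at_top"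
    using assms
    by (intro tendsto_intros filterlim_compose[OF exp_at_bot]
        filterlim_compose[OF filterlim_uminus_at_bot_at_top] filterlim_at_top_mult_tendsto_pos[OF tendsto_const] filterlim_ident)
       (auto simp: mult.commute)
  have "(\<integral>\<^sup>+w. ennreal (x * exp (- (w * x))) * indicator {u..} w \<partial>lborel) = ennreal (- 0 - (- exp (- (u * x))))"
    using assms by (intro nn_integral_FTC_atLeast[OF _ _ _ lim])
      (auto intro!: derivative_eq_intros)
  then show ?thesis by simp
qed

text \<open>Writing \<open>exp (- u x)\<close> as an integral over \<open>{u..}\<close> turns the Laplace transform into an
  average of the distribution function, so that a doubling property of the latter carries over.\<close>

lemma laplace_doubling_finite:
  fixes T :: "real measure"
  assumes fin: "finite_measure T" and sets[measurable_cong]: "sets T = sets borel"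
    and dbl: "\<And>w. measure T {..2 * w} \<le> C * measure T {..w}"
    and "0 \<le> C" "0 < x"
  shows "(\<integral>\<^sup>+u. ennreal (exp (- (u * (x / 2)))) \<partial>T) \<le> ennreal C * (\<integral>\<^sup>+u. ennreal (exp (- (u * x))) \<partial>T)"
proof -
  interpret T: finite_measure T by fact
  interpret P: pair_sigma_finite T lborel ..
  let ?k = "\<lambda>w. ennreal (x * exp (- (w * x)))"
  \<comment> \<open>The scale \<open>a\<close> is put into the event instead of the kernel, so the
    Laplace transforms at \<open>x / 2\<close> and at \<open>x\<close> are integrals against the
    same kernel \<open>?k\<close> and can be compared pointwise in \<open>w\<close>.\<close>
  have rep: "(\<integral>\<^sup>+u. ennreal (exp (- (a * u * x))) \<partial>T) = (\<integral>\<^sup>+w. ?k w * emeasure T {u. a * u \<le> w} \<partial>lborel)" for a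
  proof -
    have "(\<integral>\<^sup>+u. ennreal (exp (- (a * u * x))) \<partial>T) = (\<integral>\<^sup>+u. \<integral>\<^sup>+w. ?k w * indicator {a * u..} w \<partial>lborel \<partial>T)"
      using nn_integral_exp_atLeast[OF \<open>0 < x\<close>] by simp
    also have "\<dots> = (\<integral>\<^sup>+w. \<integral>\<^sup>+u. ?k w * indicator {a * u..} w \<partial>T \<partial>lborel)"
    proof -
      have [measurable]: "Measurable.pred (T \<Otimes>\<^sub>M lborel) (\<lambda>z. a * fst z \<le> snd z)" by measurable
      have "(\<lambda>z. ?k (snd z) * indicator {z. a * fst z \<le> snd z} z) \<in> borel_measurable (T \<Otimes>\<^sub>M lborel)"
        by measurable
      also have "(\<lambda>z. ?k (snd z) * indicator {z. a * fst z \<le> snd z} z) =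
          (\<lambda>(u, w). ?k w * indicator {a * u..} w)"
        by (auto simp: indicator_def fun_eq_iff)
      finally show ?thesis
        by (rule P.Fubini'[symmetric])
    qed
    also have "\<dots> = (\<integral>\<^sup>+w. ?k w * emeasure T {u. a * u \<le> w} \<partial>lborel)"
    proof (rule nn_integral_cong)
      fix w
      have "(\<integral>\<^sup>+u. ?k w * indicator {a * u..} w \<partial>T) = (\<integral>\<^sup>+u. ?k w * indicator {u. a * u \<le> w} u \<partial>T)"
        by (intro nn_integral_cong) (auto simp: indicator_def)
      also have "\<dots> = ?k w * emeasure T {u. a * u \<le> w}"
        by (subst nn_integral_cmult_indicator) (auto simp: sets)
      finally show "(\<integral>\<^sup>+u. ?k w * indicator {a * u..} w \<partial>T) = ?k w * emeasure T {u. a * u \<le> w}" .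
    qed
    finally show ?thesis .
  qed
  have "(\<integral>\<^sup>+u. ennreal (exp (- (u * (x / 2)))) \<partial>T) = (\<integral>\<^sup>+w. ?k w * emeasure T {u. 1 / 2 * u \<le> w} \<partial>lborel)"
    using rep[of "1/2"] by simp
  also have "\<dots> \<le> (\<integral>\<^sup>+w. ennreal C * (?k w * emeasure T {u. 1 * u \<le> w}) \<partial>lborel)"
  proof (rule nn_integral_mono)
    fix w
    have "{u :: real. 1 / 2 * u \<le> w} = {..2 * w}" "{u :: real. 1 * u \<le> w} = {..w}" by auto
    then have "emeasure T {u. 1 / 2 * u \<le> w} \<le> ennreal C * emeasure T {u. 1 * u \<le> w}"
      using dbl[of w] \<open>0 \<le> C\<close> by (simp add: T.emeasure_eq_measure ennreal_mult'[symmetric] ennreal_leI)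
    then show "?k w * emeasure T {u. 1 / 2 * u \<le> w} \<le> ennreal C * (?k w * emeasure T {u. 1 * u \<le> w})"
      by (subst mult.left_commute) (rule mult_left_mono, auto)
  qed
  also have "\<dots> = ennreal C * (\<integral>\<^sup>+w. ?k w * emeasure T {u. 1 * u \<le> w} \<partial>lborel)"
  proof (rule nn_integral_cmult)
    have "mono (\<lambda>w. measure T {u. 1 * u \<le> w})"
      by (intro monoI T.finite_measure_mono) (auto simp: sets)
    then have [measurable]: "(\<lambda>w. measure T {u. 1 * u \<le> w}) \<in> borel_measurable borel"
      by (rule borel_measurable_mono)
    show "(\<lambda>w. ?k w * emeasure T {u. 1 * u \<le> w}) \<in> borel_measurable lborel"
      unfolding T.emeasure_eq_measure by measurable
  qed
  also have "\<dots> = ennreal C * (\<integral>\<^sup>+u. ennreal (exp (- (u * x))) \<partial>T)"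
    using rep[of 1] by simp
  finally show ?thesis .
qed

text \<open>Abstracts the translate of \<open>\<tau>p\<close>. Its total mass may be infinite, so
  only the exponentials are assumed integrable; \<open>cdf_pos\<close> expresses that
  \<open>0\<close> belongs to the support.\<close>

locale laplace_near_zero =
  fixes T :: "real measure"
  assumes sets_T [measurable_cong]: "sets T = sets borel"
    and AE_nonneg: "AE u in T. 0 \<le> u"
    and integrable_exp: "\<And>x. 0 < x \<Longrightarrow> integrable T (\<lambda>u. exp (- (u * x)))"
    and cdf_pos: "\<And>\<epsilon>. 0 < \<epsilon> \<Longrightarrow> 0 < cdf T \<epsilon>"
begin

definition \<kappa> :: "real \<Rightarrow> real" where
  "\<kappa> x = (\<integral>u. exp (- (u * x)) \<partial>T)"

text \<open>Mass arbitrarily close to \<open>0\<close> keeps the Laplace transform above every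
  decaying exponential. This absorbs the mass away from \<open>0\<close> in the doubling argument
  and later yields the lower bound for \<open>h\<close>.\<close>

lemma \<kappa>_lower:
  assumes "0 < x" "0 < \<epsilon>"
  shows "exp (- (\<epsilon> * x)) * cdf T \<epsilon> \<le> \<kappa> x"
proof -
  \<comment> \<open>\<open>measure\<close> is \<open>0\<close> on sets of infinite mass, so a
    positive \<open>cdf\<close> value already implies finiteness.\<close>
  have fin: "emeasure T {..\<epsilon>} < \<infinity>"
    using cdf_pos[OF assms(2)] by (auto simp: cdf_def measure_def enn2real_positive_iff)
  have "exp (- (\<epsilon> * x)) * cdf T \<epsilon> = (\<integral>u. exp (- (\<epsilon> * x)) * indicator {..\<epsilon>} u \<partial>T)"
    by (simp add: cdf_def sets_eq_imp_space_eq[OF sets_T])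
  also have "\<dots> \<le> \<kappa> x"
    unfolding \<kappa>_def
  proof (rule integral_mono_AE)
    show "integrable T (\<lambda>u. exp (- (\<epsilon> * x)) * indicator {..\<epsilon>} u)"
      using fin by (intro integrable_mult_right integrable_real_indicator) (auto simp: sets_T)
    show "AE u in T. exp (- (\<epsilon> * x)) * indicator {..\<epsilon>} u \<le> exp (- (u * x))"
      using assms by (auto simp: indicator_def mult_right_mono)
  qed (rule integrable_exp[OF assms(1)])
  finally show ?thesis .
qed

lemma \<kappa>_pos: "0 < x \<Longrightarrow> 0 < \<kappa> x"
  using \<kappa>_lower[of x 1] cdf_pos[of 1] by (smt (verit) exp_gt_zero mult_pos_pos)

lemma \<kappa>_antimono:
  assumes "0 < x" "x \<le> y"
  shows "\<kappa> y \<le> \<kappa> x"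
  unfolding \<kappa>_def
proof (rule integral_mono_AE)
  show "AE u in T. exp (- (u * y)) \<le> exp (- (u * x))"
    using AE_nonneg by eventually_elim (use assms in \<open>auto intro: mult_left_mono\<close>)
qed (use assms integrable_exp in auto)

text \<open>Doubling of the distribution function is known only up to \<delta>. Restricting
  \<open>T\<close> to \<open>{..2 * \<delta>}\<close> makes it global, as the restricted
  distribution function is constant from there on; the discarded mass contributes at most a multiple
  of \<open>exp (- (\<delta> * x))\<close>, which \<open>\<kappa>_lower\<close> absorbs.\<close>

lemma \<kappa>_doubling:
  assumes "0 < \<delta>" and dbl: "\<And>t. 0 < t \<Longrightarrow> t \<le> \<delta> \<Longrightarrow> cdf T (2 * t) \<le> C * cdf T t"
  obtains K where "\<And>x. 2 \<le> x \<Longrightarrow> \<kappa> (x / 2) \<le> K * \<kappa> x"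
proof -
  define R where "R = density T (\<lambda>u. ennreal (indicator {..2 * \<delta>} u))"
  \<comment> \<open>At least \<open>1\<close>, since doubling is an equality at
    \<open>w = 0\<close>, where the assumption on \<open>C\<close> says nothing.\<close>
  define D where "D = max C 1"
  have sp: "space T = UNIV" using sets_T by (metis sets_eq_imp_space_eq space_borel)
  have setsR[simp, measurable_cong]: "sets R = sets borel" by (simp add: R_def sets_T)
  have fin: "emeasure T {..c} < \<infinity>" if "0 < c" for c
    using cdf_pos[OF that] by (auto simp: cdf_def measure_def enn2real_positive_iff)
  have fin0: "emeasure T {..c} < \<infinity>" for c
    using fin[of "max c 1"] by (rule le_less_trans[rotated]) (auto intro!: emeasure_mono simp: sets_T)
  have emR: "emeasure R {..w} = emeasure T {..min w (2 * \<delta>)}" for w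
  proof -
    have "emeasure R {..w} = (\<integral>\<^sup>+u. indicator {..min w (2 * \<delta>)} u \<partial>T)"
      unfolding R_def
      by (subst emeasure_density, simp, simp add: sets_T, intro nn_integral_cong) (auto simp: indicator_def)
    then show ?thesis by (simp add: sets_T)
  qed
  have mR: "measure R {..w} = cdf T (min w (2 * \<delta>))" for w
    by (simp add: measure_def emR cdf_def)
  have finR: "finite_measure R"
  proof
    have "emeasure R (space R) = (\<integral>\<^sup>+u. indicator {..2 * \<delta>} u \<partial>T)"
      unfolding R_def
      by (subst emeasure_density, simp, simp, intro nn_integral_cong) (auto simp: indicator_def sp)
    then show "emeasure R (space R) \<noteq> \<infinity>" using fin0[of "2 * \<delta>"] by (simp add: sets_T)
  qed
  have cdf_mono: "cdf T a \<le> cdf T b" if "a \<le> b" for a b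
    unfolding cdf_def measure_def using that fin0[of b]
    by (intro enn2real_mono emeasure_mono) (auto simp: sets_T)
  have cdf_neg: "cdf T a = 0" if "a < 0" for a
  proof -
    have "emeasure T {..a} = 0"
    proof -
      have "AE u in T. \<not> u \<in> {..a}"
        using AE_nonneg by eventually_elim (use that in auto)
      from emeasure_eq_0_AE[OF this] show ?thesis by (simp add: sp atMost_def)
    qed
    then show ?thesis by (simp add: cdf_def measure_def)
  qed
  have cdf_nn: "0 \<le> cdf T a" for a by (simp add: cdf_def)
  have up: "y \<le> D * z" if "y \<le> C * z \<or> y \<le> z" "0 \<le> z" for y z :: real
    using that mult_right_mono[of C D z] mult_right_mono[of 1 D z] by (auto simp: D_def)
  have dblR: "measure R {..2 * w} \<le> D * measure R {..w}" for w
    unfolding mR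
  proof (rule up)
    consider "w < 0" | "w = 0" | "0 < w" "w \<le> \<delta>" | "\<delta> < w" by linarith
    then show "cdf T (min (2 * w) (2 * \<delta>)) \<le> C * cdf T (min w (2 * \<delta>)) \<or>
        cdf T (min (2 * w) (2 * \<delta>)) \<le> cdf T (min w (2 * \<delta>))"
    proof cases
      case 1
      then show ?thesis using cdf_neg[of "2 * w"] cdf_nn assms(1) by (simp add: min_def)
    next
      case 2
      then show ?thesis by simp
    next
      case 3
      then show ?thesis using dbl[of w] by (simp add: min_def)
    next
      case 4
      have "0 < C"
        using dbl[of \<delta>] assms(1) cdf_pos[of "2 * \<delta>"] cdf_pos[of \<delta>]
        by (smt (verit) mult_nonpos_nonneg)
      then have "cdf T (2 * \<delta>) \<le> C * cdf T (min w (2 * \<delta>))"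
        using dbl[of \<delta>] assms(1) 4 cdf_mono[of \<delta> "min w (2 * \<delta>)"]
        by (intro order_trans[OF dbl mult_left_mono]) auto
      then show ?thesis using 4 by (simp add: min_def)
    qed
  qed (rule cdf_nn)
  \<comment> \<open>For \<open>u > 2 * \<delta>\<close> and \<open>x \<ge> 2\<close> the product
    \<open>(u - 2 * \<delta>) * (x / 2 - 1)\<close> is nonnegative, which splits off
    \<open>exp (- u)\<close> and leaves \<open>exp (2 * \<delta> - \<delta> * x)\<close>.
    Integration gives \<open>\<kappa> 1\<close>; the denominator comes from
    \<open>\<kappa>_lower\<close> at \<open>\<delta> / 2\<close>.\<close>
  define K2 where "K2 = exp (2 * \<delta>) * \<kappa> 1 / cdf T (\<delta> / 2)"
  show ?thesis
  proof (rule that[of "D + K2"])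
    fix x :: real assume x: "2 \<le> x"
    have k: "ennreal (\<kappa> y) = (\<integral>\<^sup>+u. ennreal (exp (- (u * y))) \<partial>T)" if "0 < y" for y
      unfolding \<kappa>_def using integrable_exp[OF that] by (intro nn_integral_eq_integral[symmetric]) auto
    have "ennreal (\<kappa> (x / 2)) = (\<integral>\<^sup>+u. ennreal (exp (- (u * (x / 2)))) \<partial>T)"
      using x by (intro k) auto
    also have "\<dots> \<le> (\<integral>\<^sup>+u. ennreal (indicator {..2 * \<delta>} u) * ennreal (exp (- (u * (x / 2))))
        + ennreal (exp (- \<delta> * x + 2 * \<delta>)) * ennreal (exp (- (u * 1))) \<partial>T)"
    proof (rule nn_integral_mono)
      fix u :: real
      show "ennreal (exp (- (u * (x / 2)))) \<le> ennreal (indicator {..2 * \<delta>} u) * ennreal (exp (- (u * (x / 2))))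
        + ennreal (exp (- \<delta> * x + 2 * \<delta>)) * ennreal (exp (- (u * 1)))"
      proof (cases "u \<le> 2 * \<delta>")
        case False
        have "2 * \<delta> * (x / 2 - 1) \<le> u * (x / 2 - 1)"
          using x False by (intro mult_right_mono) auto
        then have "- (u * (x / 2)) \<le> - \<delta> * x + 2 * \<delta> + - (u * 1)" by (simp add: algebra_simps)
        then show ?thesis
          using False by (simp add: ennreal_mult[symmetric] exp_add[symmetric])
      qed auto
    qed
    also have "\<dots> = (\<integral>\<^sup>+u. ennreal (exp (- (u * (x / 2)))) \<partial>R) + ennreal (exp (- \<delta> * x + 2 * \<delta>)) * ennreal (\<kappa> 1)"
      unfolding R_def k[OF zero_less_one] by (simp add: nn_integral_add nn_integral_cmult nn_integral_density)
    also have "\<dots> \<le> ennreal D * ennreal (\<kappa> x) + ennreal (K2 * \<kappa> x)"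
    proof (intro add_mono)
      have "(\<integral>\<^sup>+u. ennreal (exp (- (u * (x / 2)))) \<partial>R) \<le> ennreal D * (\<integral>\<^sup>+u. ennreal (exp (- (u * x))) \<partial>R)"
        using x by (intro laplace_doubling_finite finR setsR dblR) (auto simp: D_def)
      also have "(\<integral>\<^sup>+u. ennreal (exp (- (u * x))) \<partial>R) \<le> (\<integral>\<^sup>+u. ennreal (exp (- (u * x))) \<partial>T)"
        unfolding R_def by (subst nn_integral_density) (auto intro!: nn_integral_mono simp: indicator_def)
      also have "\<dots> = ennreal (\<kappa> x)" using x by (intro k[symmetric]) auto
      finally show "(\<integral>\<^sup>+u. ennreal (exp (- (u * (x / 2)))) \<partial>R) \<le> ennreal D * ennreal (\<kappa> x)"
        by (simp add: mult_left_mono)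
      have "exp (- \<delta> * x + 2 * \<delta>) * \<kappa> 1 = K2 * (exp (- (\<delta> * x)) * cdf T (\<delta> / 2))"
      proof -
        have "exp (- \<delta> * x + 2 * \<delta>) = exp (2 * \<delta>) * exp (- (\<delta> * x))"
          by (simp add: exp_add[symmetric])
        then show ?thesis
          using cdf_pos[of "\<delta> / 2"] assms(1) by (simp only: K2_def) simp
      qed
      also have "\<dots> \<le> K2 * (exp (- (\<delta> / 2 * x)) * cdf T (\<delta> / 2))"
        using x assms(1) \<kappa>_pos[of 1] cdf_nn
        by (intro mult_left_mono mult_right_mono) (auto simp: K2_def)
      also have "\<dots> \<le> K2 * \<kappa> x"
        using x assms(1) \<kappa>_pos[of 1] cdf_nn by (intro mult_left_mono \<kappa>_lower) (auto simp: K2_def)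
      finally show "ennreal (exp (- \<delta> * x + 2 * \<delta>)) * ennreal (\<kappa> 1) \<le> ennreal (K2 * \<kappa> x)"
        using \<kappa>_pos[of 1] by (simp add: ennreal_mult[symmetric] ennreal_leI)
    qed
    also have "\<dots> = ennreal ((D + K2) * \<kappa> x)"
      using x \<kappa>_pos[of 1] \<kappa>_pos[of x] cdf_nn
      by (simp add: D_def K2_def ennreal_mult[symmetric] ennreal_plus[symmetric] distrib_right del: ennreal_plus)
    finally show "\<kappa> (x / 2) \<le> (D + K2) * \<kappa> x"
      using x \<kappa>_pos[of 1] \<kappa>_pos[of x] cdf_nn by (subst (asm) ennreal_le_iff) (auto simp: D_def K2_def)
  qed
qed

text \<open>Pointwise in \<open>u\<close>, a shift by \<open>y\<close> costs at most
  \<open>4 * y / x * exp (- (u * (x / 2)))\<close>. Its integral involves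
  \<open>\<kappa> (x / 2)\<close>, which doubling compares with \<open>\<kappa> x\<close>, so the
  relative error is \<open>4 * y * K / x\<close>.\<close>

lemma \<kappa>_long_tailed:
  assumes K: "\<And>x. 2 \<le> x \<Longrightarrow> \<kappa> (x / 2) \<le> K * \<kappa> x" and "0 \<le> y"
  shows "((\<lambda>x. \<kappa> (x - y) / \<kappa> x) \<longlongrightarrow> 1) at_top"
proof (rule tendsto_sandwich)
  show "((\<lambda>x. 1) \<longlongrightarrow> (1::real)) at_top" by simp
  have "((\<lambda>x. 1 + 4 * y * K * inverse x) \<longlongrightarrow> 1 + 4 * y * K * 0) at_top"
    by (intro tendsto_intros tendsto_inverse_0_at_top filterlim_ident)
  then show "((\<lambda>x. 1 + 4 * y * K * inverse x) \<longlongrightarrow> 1) at_top" by simp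
  show "\<forall>\<^sub>F x in at_top. 1 \<le> \<kappa> (x - y) / \<kappa> x"
    using eventually_gt_at_top[of y]
  proof eventually_elim
    case (elim x)
    then show ?case using \<kappa>_antimono[of "x - y" x] \<kappa>_pos[of x] \<open>0 \<le> y\<close> by simp
  qed
  show "\<forall>\<^sub>F x in at_top. \<kappa> (x - y) / \<kappa> x \<le> 1 + 4 * y * K * inverse x"
    using eventually_ge_at_top[of 2] eventually_gt_at_top[of "4 * y"]
  proof eventually_elim
    case (elim x)
    have "\<kappa> (x - y) \<le> (\<integral>u. exp (- (u * x)) + 4 * y / x * exp (- (u * (x / 2))) \<partial>T)"
      unfolding \<kappa>_def
    proof (rule integral_mono_AE)
      show "AE u in T. exp (- (u * (x - y))) \<le> exp (- (u * x)) + 4 * y / x * exp (- (u * (x / 2)))"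
        using AE_nonneg
      proof eventually_elim
        fix u :: real assume u: "0 \<le> u"
        have "1 - u * y \<le> exp (- (u * y))"
          using exp_ge_add_one_self[of "- (u * y)"] by simp
        then have "(1 - u * y) * exp (u * y) \<le> exp (- (u * y)) * exp (u * y)"
          by (intro mult_right_mono) auto
        then have "exp (u * y) - 1 \<le> u * y * exp (u * y)"
          by (simp add: exp_minus algebra_simps)
        then have "exp (- (u * x)) * (exp (u * y) - 1) \<le> exp (- (u * x)) * (u * y * exp (u * y))"
          by (intro mult_left_mono) auto
        also have "\<dots> = u * y * exp (u * y - u * x)" by (simp add: exp_diff exp_minus divide_inverse)
        \<comment> \<open>Since \<open>y < x / 4\<close>, of the exponent \<open>- (u * x)\<close>
          three quarters survive. Half is kept for \<open>\<kappa> (x / 2)\<close>; the remaining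
          quarter pays for the factor \<open>u\<close>, because \<open>t * exp (- t)\<close> is at
          most \<open>1\<close>.\<close>
        also have "\<dots> \<le> u * y * exp (- (u * x / 4) - u * x / 2)"
        proof -
          have "u * y \<le> u * (x / 4)" using u elim by (intro mult_left_mono) auto
          then show ?thesis using u \<open>0 \<le> y\<close> by (intro mult_left_mono) auto
        qed
        also have "exp (- (u * x / 4) - u * x / 2) = exp (- (u * (x / 2))) * exp (- (u * x / 4))"
          by (simp add: exp_add[symmetric])
        also have "u * y * (exp (- (u * (x / 2))) * exp (- (u * x / 4))) =
            4 * y / x * exp (- (u * (x / 2))) * (u * x / 4 * exp (- (u * x / 4)))" (is "_ * (?E1 * ?E2) = _")
        proof -
          have "u * y * (E1 * E2) = 4 * y / x * E1 * (u * x / 4 * E2)" for E1 E2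
            using elim by simp
          then show ?thesis .
        qed
        also have "\<dots> \<le> 4 * y / x * exp (- (u * (x / 2))) * 1"
        proof (rule mult_left_mono)
          have "u * x / 4 \<le> exp (u * x / 4)" using exp_ge_add_one_self[of "u * x / 4"] by linarith
          then have "u * x / 4 * exp (- (u * x / 4)) \<le> exp (u * x / 4) * exp (- (u * x / 4))"
            by (rule mult_right_mono) simp
          also have "\<dots> = 1" by (simp only: exp_add[symmetric]) simp
          finally show "u * x / 4 * exp (- (u * x / 4)) \<le> 1" .
          show "0 \<le> 4 * y / x * exp (- (u * (x / 2)))" using elim \<open>0 \<le> y\<close> by simp
        qed
        finally show "exp (- (u * (x - y))) \<le> exp (- (u * x)) + 4 * y / x * exp (- (u * (x / 2)))"
          by (simp add: algebra_simps exp_add[symmetric])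
      qed
    qed (use elim integrable_exp[of "x - y"] integrable_exp[of x] integrable_exp[of "x / 2"] \<open>0 \<le> y\<close> in auto)
    also have "\<dots> = \<kappa> x + 4 * y / x * \<kappa> (x / 2)"
      using elim integrable_exp[of x] integrable_exp[of "x / 2"] by (simp add: \<kappa>_def)
    also have "\<dots> \<le> \<kappa> x + 4 * y / x * (K * \<kappa> x)"
      using elim K[of x] \<open>0 \<le> y\<close> by (intro add_left_mono mult_left_mono) auto
    finally show ?case
      using elim \<kappa>_pos[of x] by (simp add: field_simps)
  qed
qed

end

subsection \<open>Convolution powers of subexponential densities\<close>

lemma convolution_return_zero:
  assumes "finite_measure M" and [measurable_cong]: "sets M = sets borel"
  shows "(M \<star> return borel 0) = (M :: real measure)"
proof (rule measure_eqI)
  fix B assume "B \<in> sets (M \<star> return borel 0)"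
  then have [measurable]: "B \<in> sets borel" by simp
  have "finite_measure (return borel (0::real))"
    by (simp add: prob_space.finite_measure prob_space_return)
  then have "emeasure (M \<star> return borel 0) B = (\<integral>\<^sup>+x. \<integral>\<^sup>+y. indicator B (x + y) \<partial>return borel 0 \<partial>M)"
    using assms by (intro convolution_emeasure') auto
  also have "\<dots> = (\<integral>\<^sup>+x. indicator B x \<partial>M)"
    by (intro nn_integral_cong) (subst nn_integral_return, auto)
  finally show "emeasure (M \<star> return borel 0) B = emeasure M B"
    by (simp add: assms)
qed (simp add: assms)

lemma tail_integral_pos:
  fixes v :: "real \<Rightarrow> real"
  assumes v: "integrable lborel v" and vpos: "\<And>z. a < z \<Longrightarrow> 0 < v z" and "a \<le> x"
  shows "0 < (\<integral>z. indicator {x<..} z * v z \<partial>lborel)"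
proof -
  have iv: "integrable lborel (\<lambda>z. indicator {x<..} z * v z)"
    using integrable_mult_indicator[OF _ v, of "{x<..}"] by auto
  have nn: "0 \<le> indicator {x<..} z * v z" for z
    using assms(3) vpos[of z] by (auto simp: indicator_def)
  have "(\<integral>z. indicator {x<..} z * v z \<partial>lborel) \<noteq> 0"
  proof
    assume "(\<integral>z. indicator {x<..} z * v z \<partial>lborel) = 0"
    then have "AE z in lborel. indicator {x<..} z * v z = 0"
      using integral_nonneg_eq_0_iff_AE[OF iv] nn by simp
    then have "AE z in lborel. z \<notin> {x<..<x+1}"
    proof eventually_elim
      case (elim z)
      show ?case
      proof
        assume "z \<in> {x<..<x + 1}"
        then show False using elim vpos[of z] \<open>a \<le> x\<close> by simp
      qed
    qed
    from emeasure_eq_0_AE[of "\<lambda>z. z \<in> {x<..<x+1}", OF this]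
    have "emeasure lborel {x<..<x+1} = 0"
      by (simp only: space_lborel space_borel UNIV_I simp_thms Collect_mem_eq)
    then show False by simp
  qed
  moreover have "0 \<le> (\<integral>z. indicator {x<..} z * v z \<partial>lborel)"
    by (rule Bochner_Integration.integral_nonneg) (rule nn)
  ultimately show ?thesis by linarith
qed

text \<open>Integrates the inequality \<bar>u - c v\<bar> \<le> (e/2) v, valid far out. It
  transports asymptotics of densities to tails without regularity of \<open>u\<close> beyond
  integrability.\<close>

lemma tendsto_tail_integral_ratio:
  fixes u v :: "real \<Rightarrow> real"
  assumes u: "integrable lborel u" and v: "integrable lborel v"
    and vpos: "\<And>z. a < z \<Longrightarrow> 0 < v z"
    and lim: "((\<lambda>z. u z / v z) \<longlongrightarrow> c) at_top"
  shows "((\<lambda>x. (\<integral>z. indicator {x<..} z * u z \<partial>lborel) / (\<integral>z. indicator {x<..} z * v z \<partial>lborel)) \<longlongrightarrow> c) at_top"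
proof (rule tendstoI)
  fix e :: real assume "0 < e"
  have iu: "integrable lborel (\<lambda>z. indicator {x<..} z * u z)"
    and iv: "integrable lborel (\<lambda>z. indicator {x<..} z * v z)" for x
    using integrable_mult_indicator[OF _ u, of "{x<..}"] integrable_mult_indicator[OF _ v, of "{x<..}"] by auto
  have "\<forall>\<^sub>F z in at_top. dist (u z / v z) c < e / 2"
    using lim \<open>0 < e\<close> by (intro tendstoD) auto
  then obtain Z where Z: "\<And>z. Z \<le> z \<Longrightarrow> dist (u z / v z) c < e / 2"
    by (auto simp: eventually_at_top_linorder)
  show "\<forall>\<^sub>F x in at_top. dist ((\<integral>z. indicator {x<..} z * u z \<partial>lborel) / (\<integral>z. indicator {x<..} z * v z \<partial>lborel)) c < e"
    using eventually_ge_at_top[of "max Z a"]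
  proof eventually_elim
    case (elim x)
    let ?U = "\<integral>z. indicator {x<..} z * u z \<partial>lborel" and ?V = "\<integral>z. indicator {x<..} z * v z \<partial>lborel"
    have V: "0 < ?V" using elim by (intro tail_integral_pos[OF v vpos]) auto
    have "\<bar>?U - c * ?V\<bar> = \<bar>\<integral>z. indicator {x<..} z * u z - c * (indicator {x<..} z * v z) \<partial>lborel\<bar>"
      using iu iv by simp
    also have "\<dots> \<le> (\<integral>z. \<bar>indicator {x<..} z * u z - c * (indicator {x<..} z * v z)\<bar> \<partial>lborel)"
      by (rule integral_abs_bound)
    also have "\<dots> \<le> (\<integral>z. e / 2 * (indicator {x<..} z * v z) \<partial>lborel)"
    proof (rule integral_mono)
      fix z :: real
      show "\<bar>indicator {x<..} z * u z - c * (indicator {x<..} z * v z)\<bar> \<le> e / 2 * (indicator {x<..} z * v z)"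
      proof (cases "x < z")
        case True
        then have "0 < v z" using elim by (intro vpos) auto
        moreover have "\<bar>u z / v z - c\<bar> < e / 2"
          using Z[of z] True elim by (simp add: dist_real_def)
        then have "\<bar>u z / v z - c\<bar> * v z \<le> e / 2 * v z" using \<open>0 < v z\<close> by (intro mult_right_mono) auto
        moreover have "\<bar>u z / v z - c\<bar> * v z = \<bar>u z - c * v z\<bar>"
        proof -
          have "\<bar>u z / v z - c\<bar> * v z = \<bar>(u z / v z - c) * v z\<bar>"
            using \<open>0 < v z\<close> by (simp only: abs_mult abs_of_pos)
          then show ?thesis using \<open>0 < v z\<close> by (simp add: left_diff_distrib)
        qed
        ultimately show ?thesis using True by simp
      qed simp
    qed (use iu iv in auto)
    also have "\<dots> = e / 2 * ?V" by simp
    also have "\<dots> < e * ?V" using V \<open>0 < e\<close> by simp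
    finally have "\<bar>?U - c * ?V\<bar> / ?V < e" using V by (simp add: pos_divide_less_eq)
    moreover have "\<bar>?U - c * ?V\<bar> / ?V = \<bar>?U / ?V - c\<bar>"
      using V by (simp add: field_simps abs_divide flip: abs_of_pos)
    ultimately show ?case by (simp add: dist_real_def)
  qed
qed

section \<open>Convolution of functions dominated by \<open>h\<close>\<close>

definition conv_fun :: "(real \<Rightarrow> real) \<Rightarrow> (real \<Rightarrow> real) \<Rightarrow> real \<Rightarrow> real" where
  "conv_fun f g x = (\<integral>y. f (x - y) * g y \<partial>lborel)"

text \<open>\<open>h_half\<close> starts at \<open>2\<close> because \<open>x / 2\<close> must lie
  to the right of \<open>1\<close>, where \<open>h\<close> is positive. Together with monotonicity
  it bounds \<open>h\<close> on \<open>{x / 2..}\<close> by \<open>K * h x\<close>, the source of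
  every majorant below.\<close>

locale subexponential_density =
  fixes h :: "real \<Rightarrow> real" and K :: real
  assumes measurable_h [measurable]: "h \<in> borel_measurable borel"
    and h_zero: "\<And>x. x \<le> 1 \<Longrightarrow> h x = 0"
    and h_pos: "\<And>x. 1 < x \<Longrightarrow> 0 < h x"
    and h_antimono: "\<And>x y. 1 < x \<Longrightarrow> x \<le> y \<Longrightarrow> h y \<le> h x"
    and h_half: "\<And>x. 2 < x \<Longrightarrow> h (x / 2) \<le> K * h x"
    and h_shift: "\<And>y. ((\<lambda>x. h (x - y) / h x) \<longlongrightarrow> 1) at_top"
    and integrable_h: "integrable lborel h"
begin

definition m :: real where "m = (\<integral>x. h x \<partial>lborel)"

lemma h_nonneg: "0 \<le> h x"
  using h_zero[of x] h_pos[of x] by (cases "x \<le> 1") auto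

lemma m_nonneg: "0 \<le> m"
  unfolding m_def by (intro Bochner_Integration.integral_nonneg) (simp add: h_nonneg)

lemma K_ge_1: "1 \<le> K"
proof -
  have "h 4 \<le> h 2" "h 2 \<le> K * h 4" "0 < h 4"
    using h_antimono[of 2 4] h_half[of 4] h_pos[of 4] by auto
  then show ?thesis by (smt (verit) mult_le_cancel_right1)
qed

lemma h_le_K_of_half_le: "2 < x \<Longrightarrow> x / 2 \<le> y \<Longrightarrow> h y \<le> K * h x"
  using h_antimono[of "x / 2" y] h_half[of x] by simp

text \<open>Monotonicity alone would allow a blow-up of \<open>h\<close> to the right of
  \<open>1\<close>; comparing \<open>x\<close> with \<open>2 * x\<close> excludes it.\<close>

lemma h_bounded: "h x \<le> K * h 2"
proof (cases "1 < x")
  case True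
  then have "h x \<le> K * h (2 * x)" using h_half[of "2 * x"] by simp
  also have "\<dots> \<le> K * h 2" using True K_ge_1 by (intro mult_left_mono h_antimono) auto
  finally show ?thesis .
next
  case False
  then show ?thesis using h_zero[of x] K_ge_1 h_nonneg[of 2] by simp
qed

text \<open>One of \<open>y\<close> and \<open>x - y\<close> is at least \<open>x / 2\<close>, so
  one factor is at most \<open>K * h x\<close>. The sum on the right covers both cases and is
  integrable in \<open>y\<close>.\<close>

lemma h_product_bound:
  assumes "2 < x"
  shows "h (x - y) * h y \<le> K * h x * (h y + h (x - y))"
proof (cases "x / 2 \<le> y")
  case True
  have "h (x - y) * h y \<le> h (x - y) * (K * h x)"
    by (intro mult_left_mono h_le_K_of_half_le assms True h_nonneg)
  moreover have "0 \<le> K * h x * h y" using K_ge_1 h_nonneg by simp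
  ultimately show ?thesis by (simp add: algebra_simps)
next
  case False
  have "h (x - y) * h y \<le> (K * h x) * h y"
    using False by (intro mult_right_mono h_le_K_of_half_le assms h_nonneg) auto
  moreover have "0 \<le> K * h x * h (x - y)" using K_ge_1 h_nonneg by simp
  ultimately show ?thesis by (simp add: algebra_simps)
qed

text \<open>Invariant of the induction over convolution powers. The constant is explicit because its
  growth has to be weighed against the factorial.\<close>

definition h_dominated :: "(real \<Rightarrow> real) \<Rightarrow> real \<Rightarrow> bool" where
  "h_dominated f A \<longleftrightarrow> f \<in> borel_measurable borel \<and> 0 \<le> A \<and> (\<forall>x. 0 \<le> f x \<and> f x \<le> A * h x)"

lemma h_dominatedD:
  assumes "h_dominated f A"
  shows "f \<in> borel_measurable borel" "0 \<le> A" "0 \<le> f x" "f x \<le> A * h x"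
  using assms by (auto simp: h_dominated_def)

lemma h_dominated_integrable:
  assumes "h_dominated f A"
  shows "integrable lborel f"
  by (rule Bochner_Integration.integrable_bound[of _ "\<lambda>x. A * h x"])
    (use integrable_h h_nonneg h_dominatedD[OF assms] in \<open>auto simp: abs_of_nonneg\<close>)

lemma integrable_reflect:
  fixes f :: "real \<Rightarrow> real"
  assumes "integrable lborel f"
  shows "integrable lborel (\<lambda>y. f (x - y))" "(\<integral>y. f (x - y) \<partial>lborel) = (\<integral>y. f y \<partial>lborel)"
  using assms lborel_integrable_real_affine_iff[of "-1" f x] lborel_integral_real_affine[of "-1" f x] by simp_all

lemma conv_fun_integrable:
  assumes f: "h_dominated f A" and g: "h_dominated g B"
  shows "integrable lborel (\<lambda>y. f (x - y) * g y)"
proof (rule Bochner_Integration.integrable_bound)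
  show "integrable lborel (\<lambda>y. A * (K * h 2) * g y)"
    using h_dominated_integrable[OF g] by simp
  note [measurable] = h_dominatedD(1)[OF f] h_dominatedD(1)[OF g]
  show "(\<lambda>y. f (x - y) * g y) \<in> borel_measurable lborel" by measurable
  show "AE y in lborel. norm (f (x - y) * g y) \<le> norm (A * (K * h 2) * g y)"
  proof (rule AE_I2)
    fix y
    have "f (x - y) \<le> A * (K * h 2)"
      using h_dominatedD(4)[OF f, of "x - y"] mult_left_mono[OF h_bounded h_dominatedD(2)[OF f]] by (rule order_trans)
    then have "f (x - y) * g y \<le> A * (K * h 2) * g y"
      using h_dominatedD(3)[OF g] by (rule mult_right_mono)
    then show "norm (f (x - y) * g y) \<le> norm (A * (K * h 2) * g y)"
      using h_dominatedD(3)[OF f, of "x - y"] h_dominatedD(3)[OF g, of y] by simp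
  qed
qed

text \<open>The factor \<open>2 * m\<close> is the integral of the two summands in
  \<open>h_product_bound\<close>.\<close>

lemma h_dominated_conv_fun:
  assumes f: "h_dominated f A" and g: "h_dominated g B"
  shows "h_dominated (conv_fun f g) (2 * A * B * K * m)"
  unfolding h_dominated_def
proof (intro conjI allI)
  note [measurable] = h_dominatedD(1)[OF f] h_dominatedD(1)[OF g]
  show "conv_fun f g \<in> borel_measurable borel"
    unfolding conv_fun_def by measurable
  show "0 \<le> 2 * A * B * K * m"
    using h_dominatedD(2)[OF f] h_dominatedD(2)[OF g] K_ge_1 m_nonneg by simp
  fix x
  show "0 \<le> conv_fun f g x"
    unfolding conv_fun_def using h_dominatedD(3)[OF f] h_dominatedD(3)[OF g] by (intro Bochner_Integration.integral_nonneg) simp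
  show "conv_fun f g x \<le> 2 * A * B * K * m * h x"
  proof (cases "2 < x")
    case True
    have "conv_fun f g x \<le> (\<integral>y. A * B * (K * h x * (h y + h (x - y))) \<partial>lborel)"
      unfolding conv_fun_def
    proof (rule integral_mono)
      show "integrable lborel (\<lambda>y. f (x - y) * g y)" by (rule conv_fun_integrable[OF f g])
      show "integrable lborel (\<lambda>y. A * B * (K * h x * (h y + h (x - y))))"
        using integrable_h integrable_reflect(1)[OF integrable_h, of x] by simp
      fix y
      have "f (x - y) * g y \<le> (A * h (x - y)) * (B * h y)"
        using h_dominatedD[OF f] h_dominatedD[OF g] h_nonneg by (intro mult_mono) auto
      also have "\<dots> = A * B * (h (x - y) * h y)" by simp
      also have "\<dots> \<le> A * B * (K * h x * (h y + h (x - y)))"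
        using h_product_bound[OF True] h_dominatedD(2)[OF f] h_dominatedD(2)[OF g] by (intro mult_left_mono) auto
      finally show "f (x - y) * g y \<le> A * B * (K * h x * (h y + h (x - y)))" .
    qed
    also have "\<dots> = A * B * (K * h x * (m + m))"
      using integrable_h integrable_reflect[OF integrable_h, of x] by (simp add: m_def)
    finally show ?thesis by (simp add: algebra_simps)
  next
    case False
    have zero: "f z = 0" "g z = 0" if "z \<le> 1" for z
      using that h_dominatedD(3,4)[OF f, of z] h_dominatedD(3,4)[OF g, of z] h_zero[of z] by auto
    \<comment> \<open>Both arguments would have to exceed \<open>1\<close>, impossible when their
      sum is at most \<open>2\<close>.\<close>
    have "f (x - y) * g y = 0" for y
      using zero[of y] zero[of "x - y"] False by (cases "y \<le> 1") auto
    then have "conv_fun f g x = 0" by (simp only: conv_fun_def) simp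
    then show ?thesis
      using h_dominatedD(2)[OF f] h_dominatedD(2)[OF g] K_ge_1 m_nonneg h_nonneg by simp
  qed
qed

text \<open>The half \<open>S x\<close> of the line is \<open>{..x/2}\<close> for one summand and \<open>{..<x/2}\<close> for the other.\<close>

lemma half_convolution_tendsto:
  assumes f: "h_dominated f A" and g: "h_dominated g B"
    and lim: "((\<lambda>x. f x / h x) \<longlongrightarrow> l) at_top"
    and S: "\<And>x. {..<x / 2} \<subseteq> S x" "\<And>x. S x \<subseteq> {..x / 2}" and [measurable]: "\<And>x. S x \<in> sets borel"
  shows "((\<lambda>x. (\<integral>y. indicator (S x) y * (f (x - y) * g y) \<partial>lborel) / h x) \<longlongrightarrow> l * (\<integral>y. g y \<partial>lborel)) at_top"
proof -
  note [measurable] = h_dominatedD(1)[OF f] h_dominatedD(1)[OF g]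
  have "((\<lambda>x. \<integral>y. indicator (S x) y * (f (x - y) * g y) / h x \<partial>lborel) \<longlongrightarrow> (\<integral>y. l * g y \<partial>lborel)) at_top"
  \<comment> \<open>On \<open>S x\<close> the argument \<open>x - y\<close> is at least
    \<open>x / 2\<close>, hence \<open>f (x - y)\<close> is at most \<open>A * K * h x\<close> and
    the majorant no longer depends on \<open>x\<close>.\<close>
  proof (rule integral_dominated_convergence_at_top[where w="\<lambda>y. A * K * g y"])
    show "integrable lborel (\<lambda>y. A * K * g y)"
      using h_dominated_integrable[OF g] by simp
    show "\<forall>\<^sub>F x in at_top. AE y in lborel. norm (indicator (S x) y * (f (x - y) * g y) / h x) \<le> A * K * g y"
      using eventually_gt_at_top[of 2]
    proof eventually_elim
      case (elim x)
      show ?case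
      proof (rule AE_I2)
        fix y
        have hx: "0 < h x" using elim by (intro h_pos) auto
        show "norm (indicator (S x) y * (f (x - y) * g y) / h x) \<le> A * K * g y"
        proof (cases "y \<in> S x")
          case True
          then have y: "y \<le> x / 2" using S(2)[of x] by auto
          have "f (x - y) \<le> A * h (x - y)" by (rule h_dominatedD(4)[OF f])
          also have "\<dots> \<le> A * (K * h x)"
            using y elim by (intro mult_left_mono h_le_K_of_half_le h_dominatedD(2)[OF f]) auto
          finally have "f (x - y) * g y \<le> A * (K * h x) * g y"
            using h_dominatedD(3)[OF g] by (intro mult_right_mono) auto
          then have "f (x - y) * g y / h x \<le> A * K * g y"
            using hx by (simp add: pos_divide_le_eq mult_ac)
          moreover have "0 \<le> f (x - y) * g y / h x"
            using hx h_dominatedD(3)[OF f] h_dominatedD(3)[OF g] by simp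
          ultimately show ?thesis using True by simp
        qed (use K_ge_1 h_dominatedD(2)[OF f] h_dominatedD(3)[OF g] in simp)
      qed
    qed
    show "AE y in lborel. ((\<lambda>x. indicator (S x) y * (f (x - y) * g y) / h x) \<longlongrightarrow> l * g y) at_top"
    proof (rule AE_I2)
      fix y :: real
      have "filterlim (\<lambda>x. x - y) at_top at_top"
        using filterlim_tendsto_add_at_top[OF tendsto_const[of "- y"] filterlim_ident] by simp
      then have "((\<lambda>x. f (x - y) / h (x - y)) \<longlongrightarrow> l) at_top"
        by (rule filterlim_compose[OF lim])
      then have "((\<lambda>x. f (x - y) / h (x - y) * (h (x - y) / h x) * g y) \<longlongrightarrow> l * 1 * g y) at_top"
        by (intro tendsto_intros h_shift)
      moreover have "\<forall>\<^sub>F x in at_top. f (x - y) / h (x - y) * (h (x - y) / h x) * g y =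
          indicator (S x) y * (f (x - y) * g y) / h x"
        using eventually_gt_at_top[of "2 * y"] eventually_gt_at_top[of "y + 1"]
      proof eventually_elim
        case (elim x)
        then have "y \<in> S x" using S(1)[of x] by auto
        moreover have "h (x - y) \<noteq> 0" using h_pos[of "x - y"] elim by simp
        ultimately show ?case by simp
      qed
      ultimately show "((\<lambda>x. indicator (S x) y * (f (x - y) * g y) / h x) \<longlongrightarrow> l * g y) at_top"
        using Lim_transform_eventually by fastforce
    qed
  qed measurable
  then show ?thesis by simp
qed

text \<open>One large summand: far out, either argument carries almost all of \<open>x\<close> while
  the other is integrated freely. Each alternative contributes one of the two terms of the
  limit.\<close>

lemma conv_fun_tendsto:
  assumes f: "h_dominated f A" and g: "h_dominated g B"
    and f_lim: "((\<lambda>x. f x / h x) \<longlongrightarrow> l) at_top" and g_lim: "((\<lambda>x. g x / h x) \<longlongrightarrow> r) at_top"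
  shows "((\<lambda>x. conv_fun f g x / h x) \<longlongrightarrow> l * (\<integral>y. g y \<partial>lborel) + r * (\<integral>y. f y \<partial>lborel)) at_top"
proof -
  have eq: "conv_fun f g x = (\<integral>y. indicator {..x / 2} y * (f (x - y) * g y) \<partial>lborel)
      + (\<integral>y. indicator {..<x / 2} y * (g (x - y) * f y) \<partial>lborel)" for x
  proof -
    note i = conv_fun_integrable[OF f g, of x]
    have i1: "integrable lborel (\<lambda>y. indicator {..x / 2} y * (f (x - y) * g y))"
      and i2: "integrable lborel (\<lambda>y. indicator {x / 2<..} y * (f (x - y) * g y))"
      using integrable_mult_indicator[OF _ i, of "{..x / 2}"] integrable_mult_indicator[OF _ i, of "{x / 2<..}"] by auto
    have "conv_fun f g x = (\<integral>y. indicator {..x / 2} y * (f (x - y) * g y) + indicator {x / 2<..} y * (f (x - y) * g y) \<partial>lborel)"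
      unfolding conv_fun_def by (intro Bochner_Integration.integral_cong) (auto simp: indicator_def)
    also have "\<dots> = (\<integral>y. indicator {..x / 2} y * (f (x - y) * g y) \<partial>lborel)
      + (\<integral>y. indicator {x / 2<..} y * (f (x - y) * g y) \<partial>lborel)"
      using i1 i2 by simp
    \<comment> \<open>Reflection at \<open>x / 2\<close> exchanges the roles of \<open>f\<close> and
      \<open>g\<close>, so one lemma treats both halves.\<close>
    also have "(\<integral>y. indicator {x / 2<..} y * (f (x - y) * g y) \<partial>lborel) =
        (\<integral>y. indicator {x / 2<..} (x - y) * (f (x - (x - y)) * g (x - y)) \<partial>lborel)"
      using integrable_reflect(2)[OF i2, of x] by simp
    also have "\<dots> = (\<integral>y. indicator {..<x / 2} y * (g (x - y) * f y) \<partial>lborel)"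
      by (intro Bochner_Integration.integral_cong) (auto simp: indicator_def)
    finally show ?thesis .
  qed
  have "((\<lambda>x. (\<integral>y. indicator {..x / 2} y * (f (x - y) * g y) \<partial>lborel) / h x
      + (\<integral>y. indicator {..<x / 2} y * (g (x - y) * f y) \<partial>lborel) / h x)
      \<longlongrightarrow> l * (\<integral>y. g y \<partial>lborel) + r * (\<integral>y. f y \<partial>lborel)) at_top"
    by (intro tendsto_add half_convolution_tendsto[OF f g f_lim] half_convolution_tendsto[OF g f g_lim]) auto
  then show ?thesis by (simp add: eq add_divide_distrib)
qed

text \<open>\<open>hpow n\<close> is the \<open>(n + 1)\<close>-fold power; the zeroth one is a
  point mass and has no density.\<close>

primrec hpow :: "nat \<Rightarrow> real \<Rightarrow> real" where
  "hpow 0 = h"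
| "hpow (Suc n) = conv_fun h (hpow n)"

lemma h_dominated_h: "h_dominated h 1"
  by (simp add: h_dominated_def h_nonneg)

lemma h_dominated_hpow: "h_dominated (hpow n) ((2 * K * m) ^ n)"
proof (induction n)
  case 0
  show ?case by (simp add: h_dominated_h)
next
  case (Suc n)
  then show ?case
    using h_dominated_conv_fun[OF h_dominated_h Suc] by (simp add: mult_ac)
qed

end

text \<open>The rate \<open>b\<close> in \<open>h_lower\<close> is arbitrary: the bound serves only
  to compare \<open>g\<close> with tails that decay faster than every exponential.\<close>

locale tilted_subexponential = subexponential_density +
  fixes \<gamma> b c :: real
  assumes \<gamma>_nonneg: "0 \<le> \<gamma>" and b_nonneg: "0 \<le> b" and c_pos: "0 < c"
    and h_lower: "\<And>x. 1 < x \<Longrightarrow> c * exp (- (b * x)) \<le> h x"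
begin

definition p :: "real \<Rightarrow> real" where "p x = exp (- (\<gamma> * x)) * h x"

definition \<nu> :: "real measure" where "\<nu> = density lborel (\<lambda>x. ennreal (p x))"

abbreviation \<Lambda> :: real where "\<Lambda> \<equiv> measure \<nu> UNIV"

lemma sets_\<nu> [simp, measurable_cong]: "sets \<nu> = sets borel"
  by (simp add: \<nu>_def)

text \<open>Like \<open>h\<close>, the function vanishes up to \<open>1\<close>, and to the right of
  \<open>1\<close> the tilt is at most \<open>1\<close> because \<open>\<gamma>\<close> is
  nonnegative.\<close>

lemma h_dominated_tilted_integrable:
  assumes "h_dominated f A"
  shows "integrable lborel (\<lambda>x. exp (- (\<gamma> * x)) * f x)"
proof (rule Bochner_Integration.integrable_bound)
  show "integrable lborel f" by (rule h_dominated_integrable[OF assms])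
  note [measurable] = h_dominatedD(1)[OF assms]
  show "(\<lambda>x. exp (- (\<gamma> * x)) * f x) \<in> borel_measurable lborel" by measurable
  show "AE x in lborel. norm (exp (- (\<gamma> * x)) * f x) \<le> norm (f x)"
  proof (rule AE_I2)
    fix x
    show "norm (exp (- (\<gamma> * x)) * f x) \<le> norm (f x)"
    proof (cases "x \<le> 1")
      case True
      then have "f x = 0" using h_dominatedD(3,4)[OF assms, of x] h_zero[of x] by simp
      then show ?thesis by simp
    next
      case False
      then have "exp (- (\<gamma> * x)) \<le> 1" using \<gamma>_nonneg by simp
      then show ?thesis
        using h_dominatedD(3)[OF assms, of x] by (simp add: abs_mult mult_left_le_one_le)
    qed
  qed
qed

lemma p_nonneg: "0 \<le> p x"
  by (simp add: p_def h_nonneg)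

lemma p_pos: "1 < x \<Longrightarrow> 0 < p x"
  by (simp add: p_def h_pos)

lemma integrable_p: "integrable lborel p"
  unfolding p_def by (rule h_dominated_tilted_integrable[OF h_dominated_h])

lemma finite_measure_density_real:
  fixes f :: "real \<Rightarrow> real"
  assumes "integrable lborel f" "\<And>x. 0 \<le> f x"
  shows "finite_measure (density lborel (\<lambda>x. ennreal (f x)))"
proof
  have "emeasure (density lborel (\<lambda>x. ennreal (f x))) (space (density lborel (\<lambda>x. ennreal (f x)))) = (\<integral>\<^sup>+x. ennreal (f x) \<partial>lborel)"
    using assms by (simp add: emeasure_density)
  also have "\<dots> = ennreal (\<integral>x. f x \<partial>lborel)"
    using assms by (intro nn_integral_eq_integral) auto
  finally show "emeasure (density lborel (\<lambda>x. ennreal (f x))) (space (density lborel (\<lambda>x. ennreal (f x)))) \<noteq> \<infinity>"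
    by simp
qed

lemma finite_\<nu>: "finite_measure \<nu>"
  unfolding \<nu>_def by (intro finite_measure_density_real integrable_p p_nonneg)

text \<open>In the convolution integral the tilts at \<open>x - y\<close> and \<open>y\<close>
  multiply to the tilt at \<open>x\<close>, which does not involve \<open>y\<close>.\<close>

lemma conv_pow_\<nu>:
  "conv_pow \<nu> (Suc n) = density lborel (\<lambda>x. ennreal (exp (- (\<gamma> * x)) * hpow n x))"
proof (induction n)
  case 0
  show ?case
    using convolution_return_zero[OF finite_\<nu>] by (simp add: \<nu>_def p_def)
next
  case (Suc n)
  note hd = h_dominated_hpow[of n]
  note [measurable] = h_dominatedD(1)[OF hd]
  have "conv_pow \<nu> (Suc (Suc n)) =
      (density lborel (\<lambda>x. ennreal (p x)) \<star> density lborel (\<lambda>x. ennreal (exp (- (\<gamma> * x)) * hpow n x)))"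
    using Suc by (simp add: \<nu>_def)
  also have "\<dots> = density lborel (\<lambda>x. \<integral>\<^sup>+y. ennreal (p (x - y)) * ennreal (exp (- (\<gamma> * y)) * hpow n y) \<partial>lborel)"
  proof (rule convolution_density)
    show "(\<lambda>x. ennreal (p x)) \<in> borel_measurable borel" unfolding p_def by measurable
    show "finite_measure (density lborel (\<lambda>x. ennreal (p x)))" using finite_\<nu> by (simp add: \<nu>_def)
    show "finite_measure (density lborel (\<lambda>x. ennreal (exp (- (\<gamma> * x)) * hpow n x)))"
      using finite_measure_conv_pow[OF finite_\<nu> sets_\<nu>, of "Suc n"] by (simp only: Suc)
  qed measurable
  also have "(\<lambda>x. \<integral>\<^sup>+y. ennreal (p (x - y)) * ennreal (exp (- (\<gamma> * y)) * hpow n y) \<partial>lborel) =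
      (\<lambda>x. ennreal (exp (- (\<gamma> * x)) * hpow (Suc n) x))"
  proof
    fix x
    have "(\<integral>\<^sup>+y. ennreal (p (x - y)) * ennreal (exp (- (\<gamma> * y)) * hpow n y) \<partial>lborel) =
        (\<integral>\<^sup>+y. ennreal (exp (- (\<gamma> * x))) * ennreal (h (x - y) * hpow n y) \<partial>lborel)"
    proof (rule nn_integral_cong)
      fix y
      have "exp (- (\<gamma> * (x - y))) * exp (- (\<gamma> * y)) = exp (- (\<gamma> * x))"
        by (simp add: exp_add[symmetric] algebra_simps)
      then have "p (x - y) * (exp (- (\<gamma> * y)) * hpow n y) = exp (- (\<gamma> * x)) * (h (x - y) * hpow n y)"
        unfolding p_def by (metis (no_types, opaque_lifting) mult.assoc mult.left_commute)
      then show "ennreal (p (x - y)) * ennreal (exp (- (\<gamma> * y)) * hpow n y) =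
          ennreal (exp (- (\<gamma> * x))) * ennreal (h (x - y) * hpow n y)"
        using p_nonneg h_nonneg h_dominatedD(3)[OF hd] by (simp add: ennreal_mult[symmetric])
    qed
    also have "\<dots> = ennreal (exp (- (\<gamma> * x))) * ennreal (conv_fun h (hpow n) x)"
      unfolding conv_fun_def
      using conv_fun_integrable[OF h_dominated_h hd] h_nonneg h_dominatedD(3)[OF hd]
      by (subst nn_integral_cmult, measurable) (subst nn_integral_eq_integral, auto)
    finally show "(\<integral>\<^sup>+y. ennreal (p (x - y)) * ennreal (exp (- (\<gamma> * y)) * hpow n y) \<partial>lborel) =
        ennreal (exp (- (\<gamma> * x)) * hpow (Suc n) x)"
      using h_dominatedD(3)[OF h_dominated_hpow[of "Suc n"]] by (simp add: ennreal_mult)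
  qed
  finally show ?case .
qed

lemma nn_integral_exp_conv_pow_\<nu>:
  "(\<integral>\<^sup>+x. ennreal (exp (\<gamma> * x)) \<partial>conv_pow \<nu> (Suc n)) = ennreal (\<integral>x. hpow n x \<partial>lborel)"
proof -
  note hd = h_dominated_hpow[of n]
  note [measurable] = h_dominatedD(1)[OF hd]
  have "(\<integral>\<^sup>+x. ennreal (exp (\<gamma> * x)) \<partial>conv_pow \<nu> (Suc n)) =
      (\<integral>\<^sup>+x. ennreal (exp (- (\<gamma> * x)) * hpow n x) * ennreal (exp (\<gamma> * x)) \<partial>lborel)"
    unfolding conv_pow_\<nu> by (subst nn_integral_density) auto
  also have "\<dots> = (\<integral>\<^sup>+x. ennreal (hpow n x) \<partial>lborel)"
    using h_dominatedD(3)[OF hd]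
    by (intro nn_integral_cong) (simp add: ennreal_mult[symmetric] exp_minus field_simps)
  also have "\<dots> = ennreal (\<integral>x. hpow n x \<partial>lborel)"
    using h_dominatedD(3)[OF hd] h_dominated_integrable[OF hd] by (intro nn_integral_eq_integral) auto
  finally show ?thesis .
qed

lemma nn_integral_exp_\<nu>: "(\<integral>\<^sup>+x. ennreal (exp (\<gamma> * x)) \<partial>\<nu>) = ennreal m"
  using nn_integral_exp_conv_pow_\<nu>[of 0] convolution_return_zero[OF finite_\<nu>] by (simp add: m_def)

text \<open>The weight of order \<gamma> undoes the tilt, so this integral is an exponential moment
  of a convolution power; multiplicativity of such moments replaces a Fubini argument for
  \<open>conv_fun\<close>.\<close>

lemma hpow_integral: "(\<integral>x. hpow n x \<partial>lborel) = m ^ Suc n"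
proof -
  have "ennreal (\<integral>x. hpow n x \<partial>lborel) = ennreal (m ^ Suc n)"
    using nn_integral_exp_conv_pow[OF finite_\<nu> sets_\<nu>, where \<theta>=\<gamma> and n="Suc n"] m_nonneg
    by (simp add: nn_integral_exp_conv_pow_\<nu> nn_integral_exp_\<nu> ennreal_power del: conv_pow.simps power_Suc)
  moreover have "0 \<le> (\<integral>x. hpow n x \<partial>lborel)"
    using h_dominatedD(3)[OF h_dominated_hpow] by (intro Bochner_Integration.integral_nonneg) auto
  ultimately show ?thesis
    using m_nonneg by (subst (asm) ennreal_inj) auto
qed

lemma hpow_tendsto: "((\<lambda>x. hpow n x / h x) \<longlongrightarrow> real (Suc n) * m ^ n) at_top"
proof -
  have h: "((\<lambda>x. h x / h x) \<longlongrightarrow> 1) at_top"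
  proof (rule tendsto_eventually)
    show "\<forall>\<^sub>F x in at_top. h x / h x = 1"
      using eventually_gt_at_top[of 1] by eventually_elim (use h_pos in fastforce)
  qed
  show ?thesis
  proof (induction n)
    case 0
    show ?case using h by simp
  next
    case (Suc n)
    \<comment> \<open>The first summand is \<open>m ^ Suc n\<close>, the second \<open>Suc n\<close>
      times the same power; together they give the next coefficient.\<close>
    have "((\<lambda>x. conv_fun h (hpow n) x / h x) \<longlongrightarrow>
        1 * (\<integral>y. hpow n y \<partial>lborel) + real (Suc n) * m ^ n * (\<integral>y. h y \<partial>lborel)) at_top"
      by (rule conv_fun_tendsto[OF h_dominated_h h_dominated_hpow h Suc])
    then show ?case
      by (simp add: hpow_integral m_def[symmetric] algebra_simps)
  qed
qed

end

subsection \<open>Tail asymptotics\<close>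

context tilted_subexponential
begin

text \<open>Tail of \<open>\<nu>\<close>, the reference function for all asymptotics;
  \<open>T n\<close> below is the tail of the \<open>(n + 1)\<close>-fold power, so
  \<open>T 0\<close> is \<open>g\<close>.\<close>

definition g :: "real \<Rightarrow> real" where
  "g x = (\<integral>z. indicator {x<..} z * p z \<partial>lborel)"

definition T :: "nat \<Rightarrow> real \<Rightarrow> real" where
  "T n x = (\<integral>z. indicator {x<..} z * (exp (- (\<gamma> * z)) * hpow n z) \<partial>lborel)"

lemma g_nonneg: "0 \<le> g x"
  unfolding g_def by (intro Bochner_Integration.integral_nonneg) (simp add: p_nonneg)

lemma g_pos: "1 \<le> x \<Longrightarrow> 0 < g x"
  unfolding g_def by (rule tail_integral_pos[OF integrable_p p_pos])

lemma integrable_tail: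
  fixes f :: "real \<Rightarrow> real"
  assumes "integrable lborel f"
  shows "integrable lborel (\<lambda>z. indicator {x<..} z * f z)"
  using integrable_mult_indicator[OF _ assms, of "{x<..}"] by auto

lemma measure_conv_pow_tail: "measure (conv_pow \<nu> (Suc n)) {x<..} = T n x"
proof -
  note hd = h_dominated_hpow[of n]
  note [measurable] = h_dominatedD(1)[OF hd]
  have nn: "0 \<le> indicator {x<..} z * (exp (- (\<gamma> * z)) * hpow n z)" for z
    using h_dominatedD(3)[OF hd] by simp
  have "emeasure (conv_pow \<nu> (Suc n)) {x<..} = (\<integral>\<^sup>+z. ennreal (indicator {x<..} z * (exp (- (\<gamma> * z)) * hpow n z)) \<partial>lborel)"
    unfolding conv_pow_\<nu>
    by (subst emeasure_density, measurable) (intro nn_integral_cong, simp add: indicator_def)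
  also have "\<dots> = ennreal (T n x)"
    unfolding T_def
    by (intro nn_integral_eq_integral integrable_tail h_dominated_tilted_integrable[OF hd]) (use nn in auto)
  finally have "emeasure (conv_pow \<nu> (Suc n)) {x<..} = ennreal (T n x)" .
  moreover have "0 \<le> T n x"
    unfolding T_def by (rule Bochner_Integration.integral_nonneg) (rule nn)
  ultimately show ?thesis by (simp only: measure_def enn2real_ennreal)
qed

lemma T_nonneg: "0 \<le> T n x"
  unfolding measure_conv_pow_tail[symmetric] by simp

lemma T_tendsto: "((\<lambda>x. T n x / g x) \<longlongrightarrow> real (Suc n) * m ^ n) at_top"
  unfolding T_def g_def
proof (rule tendsto_tail_integral_ratio[OF h_dominated_tilted_integrable[OF h_dominated_hpow] integrable_p p_pos])
  have "exp (- (\<gamma> * z)) * hpow n z / p z = hpow n z / h z" for z by (simp add: p_def)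
  then show "((\<lambda>z. exp (- (\<gamma> * z)) * hpow n z / p z) \<longlongrightarrow> real (Suc n) * m ^ n) at_top"
    using hpow_tendsto by simp
qed

lemma T_bound: "T n x \<le> (2 * K * m) ^ n * g x"
proof -
  note hd = h_dominated_hpow[of n]
  have "T n x \<le> (\<integral>z. (2 * K * m) ^ n * (indicator {x<..} z * p z) \<partial>lborel)"
    unfolding T_def
  proof (rule integral_mono)
    show "integrable lborel (\<lambda>z. (2 * K * m) ^ n * (indicator {x<..} z * p z))"
      by (intro integrable_mult_right integrable_tail integrable_p)
    show "integrable lborel (\<lambda>z. indicator {x<..} z * (exp (- (\<gamma> * z)) * hpow n z))"
      by (intro integrable_tail h_dominated_tilted_integrable[OF hd])
    fix z
    have "exp (- (\<gamma> * z)) * hpow n z \<le> exp (- (\<gamma> * z)) * ((2 * K * m) ^ n * h z)"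
      by (intro mult_left_mono h_dominatedD(4)[OF hd]) auto
    then show "indicator {x<..} z * (exp (- (\<gamma> * z)) * hpow n z) \<le> (2 * K * m) ^ n * (indicator {x<..} z * p z)"
      by (simp add: p_def indicator_def mult_ac)
  qed
  also have "\<dots> = (2 * K * m) ^ n * g x" by (simp add: g_def)
  finally show ?thesis .
qed

text \<open>Weight of the \<open>(n + 1)\<close>-fold power: the index is shifted to agree with
  \<open>hpow\<close> and \<open>T\<close>, the no-jump term being left out.\<close>

definition w :: "nat \<Rightarrow> real" where "w n = exp (- \<Lambda>) / fact (Suc n)"

lemma w_nonneg: "0 \<le> w n" by (simp add: w_def)

lemma tail_compound_poisson_sums:
  assumes "0 \<le> x"
  shows "(\<lambda>n. w n * T n x) sums tail (compound_poisson \<nu>) x"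
proof -
  have "(\<lambda>n. exp (- \<Lambda>) / fact n * (\<integral>z. indicator {x<..} z \<partial>conv_pow \<nu> n))
      sums (\<integral>z. indicator {x<..} z \<partial>compound_poisson \<nu>)"
    by (rule integral_compound_poisson_sums[OF finite_\<nu> sets_\<nu>]) auto
  then have "(\<lambda>n. exp (- \<Lambda>) / fact n * measure (conv_pow \<nu> n) {x<..}) sums tail (compound_poisson \<nu>) x"
    by (simp add: tail_def)
  \<comment> \<open>The atom at \<open>0\<close> misses the half line beyond \<open>x\<close>; this
    is where \<open>x \<ge> 0\<close> is needed.\<close>
  moreover have "measure (conv_pow \<nu> 0) {x<..} = 0"
    using assms by (simp add: measure_return)
  ultimately have "(\<lambda>n. exp (- \<Lambda>) / fact (Suc n) * measure (conv_pow \<nu> (Suc n)) {x<..}) sums tail (compound_poisson \<nu>) x"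
    by (subst sums_Suc_iff) simp
  then show ?thesis
    by (simp only: measure_conv_pow_tail w_def)
qed

lemma summable_w: "summable (\<lambda>n. w n * a ^ n)"
proof (rule summable_comparison_test')
  have "summable (\<lambda>n. exp (- \<Lambda>) * (\<bar>a\<bar> ^ n / fact n))"
    using exp_sums[of "\<bar>a\<bar>"] by (intro summable_mult) (rule sums_summable)
  then show "summable (\<lambda>n. exp (- \<Lambda>) * (\<bar>a\<bar> ^ n / fact n))" .
  fix n :: nat
  have "1 / fact (Suc n) \<le> (1 / fact n :: real)"
    by (intro divide_left_mono fact_mono) auto
  then have "1 / fact (Suc n) * (exp (- \<Lambda>) * \<bar>a\<bar> ^ n) \<le> 1 / fact n * (exp (- \<Lambda>) * \<bar>a\<bar> ^ n)"
    by (rule mult_right_mono) auto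
  then show "norm (w n * a ^ n) \<le> exp (- \<Lambda>) * (\<bar>a\<bar> ^ n / fact n)"
    by (simp add: w_def abs_mult power_abs del: fact_Suc)
qed

lemma tail_compound_poisson_tendsto:
  "((\<lambda>x. tail (compound_poisson \<nu>) x / g x) \<longlongrightarrow> exp (m - \<Lambda>)) at_top"
proof -
  let ?a = "\<lambda>n x. w n * (T n x / g x)"
  let ?l = "\<lambda>n. w n * (real (Suc n) * m ^ n)"
  have "((\<lambda>x. \<Sum>n. ?a n x) \<longlongrightarrow> (\<Sum>n. ?l n)) at_top"
  \<comment> \<open>Dominated convergence for series, with the bound of \<open>T_bound\<close>
    uniform in \<open>x \<ge> 1\<close>.\<close>
  proof (rule tannerys_theorem[THEN conjunct2, THEN conjunct2])
    show "((\<lambda>x. ?a n x) \<longlongrightarrow> ?l n) at_top" for n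
      by (intro tendsto_intros T_tendsto)
    show "\<forall>\<^sub>F (n, x) in sequentially \<times>\<^sub>F at_top. norm (?a n x) \<le> w n * (2 * K * m) ^ n"
    proof (rule eventually_mono[OF eventually_prodI[OF eventually_True eventually_ge_at_top[of 1]]])
      fix z :: "nat \<times> real" assume z: "True \<and> 1 \<le> snd z"
      obtain n x where [simp]: "z = (n, x)" by (cases z)
      have le: "T n x / g x \<le> (2 * K * m) ^ n"
        using T_bound[of n x] g_pos[of x] z by (simp add: pos_divide_le_eq)
      then show "case z of (n, x) \<Rightarrow> norm (?a n x) \<le> w n * (2 * K * m) ^ n"
        using mult_left_mono[OF le w_nonneg[of n]] w_nonneg[of n] T_nonneg[of n x] g_nonneg[of x]
        by (simp add: abs_mult)
    qed
    show "summable (\<lambda>n. w n * (2 * K * m) ^ n)" by (rule summable_w)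
  qed simp
  moreover have "(\<Sum>n. ?l n) = exp (m - \<Lambda>)"
  proof -
    \<comment> \<open>The factor \<open>Suc n\<close> from the single large jump cancels against
      \<open>fact (Suc n)\<close>, which leaves the exponential series.\<close>
    have "?l n = exp (- \<Lambda>) * (m ^ n / fact n)" for n
      by (simp add: w_def divide_simps)
    then have "?l sums (exp (- \<Lambda>) * exp m)"
      using sums_mult[OF exp_sums[of m], of "exp (- \<Lambda>)"] by simp
    then show ?thesis by (simp add: sums_unique[symmetric] exp_diff exp_minus divide_inverse mult.commute)
  qed
  moreover have "\<forall>\<^sub>F x in at_top. (\<Sum>n. ?a n x) = tail (compound_poisson \<nu>) x / g x"
    using eventually_ge_at_top[of 0]
  proof eventually_elim
    case (elim x)
    show ?case
      using sums_divide[OF tail_compound_poisson_sums[OF elim], of "g x"] by (simp add: sums_unique[symmetric])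
  qed
  ultimately show ?thesis
    using Lim_transform_eventually by fastforce
qed

text \<open>A bound on the whole half line, and not just the limit, is needed as a majorant when the
  tail is integrated against \<open>M\<close>.\<close>

lemma tail_compound_poisson_bound:
  obtains C where "0 \<le> C" and "\<And>x. 0 \<le> x \<Longrightarrow> tail (compound_poisson \<nu>) x \<le> C * g x"
proof (rule that)
  let ?C = "\<Sum>n. w n * (2 * K * m) ^ n"
  have nn: "0 \<le> w n * (2 * K * m) ^ n" for n
    using w_nonneg K_ge_1 m_nonneg by simp
  show "0 \<le> ?C" by (rule suminf_nonneg[OF summable_w nn])
  fix x :: real assume "0 \<le> x"
  show "tail (compound_poisson \<nu>) x \<le> ?C * g x"
  proof (rule sums_le[OF _ tail_compound_poisson_sums[OF \<open>0 \<le> x\<close>]])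
    show "(\<lambda>n. w n * (2 * K * m) ^ n * g x) sums (?C * g x)"
      by (intro sums_mult2 summable_sums summable_w)
    show "w n * T n x \<le> w n * (2 * K * m) ^ n * g x" for n
      using mult_left_mono[OF T_bound w_nonneg] by (simp add: mult.assoc)
  qed
qed

section \<open>Shifts and lower bound of the Levy tail\<close>

lemma g_shift_eq: "g (x - y) = (\<integral>z. indicator {x<..} z * (exp (\<gamma> * y) * (exp (- (\<gamma> * z)) * h (z - y))) \<partial>lborel)"
proof -
  have "g (x - y) = (\<integral>z. indicator {x - y<..} (- y + 1 * z) * p (- y + 1 * z) \<partial>lborel)"
    unfolding g_def by (subst lborel_integral_real_affine[of 1 _ "- y"]) simp_all
  also have "\<dots> = (\<integral>z. indicator {x<..} z * (exp (\<gamma> * y) * (exp (- (\<gamma> * z)) * h (z - y))) \<partial>lborel)"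
  proof (rule Bochner_Integration.integral_cong[OF refl])
    fix z
    have "exp (- (\<gamma> * (z - y))) = exp (\<gamma> * y) * exp (- (\<gamma> * z))"
      by (simp add: exp_add[symmetric] algebra_simps)
    then show "indicator {x - y<..} (- y + 1 * z) * p (- y + 1 * z) =
        indicator {x<..} z * (exp (\<gamma> * y) * (exp (- (\<gamma> * z)) * h (z - y)))"
      by (auto simp: p_def indicator_def add.commute[of "- y"])
  qed
  finally show ?thesis .
qed

lemma integrable_shifted: "integrable lborel (\<lambda>z. exp (\<gamma> * y) * (exp (- (\<gamma> * z)) * h (z - y)))"
proof -
  have "integrable lborel (\<lambda>z. p (- y + 1 * z))"
    using integrable_p by (subst lborel_integrable_real_affine_iff) auto
  also have "(\<lambda>z. p (- y + 1 * z)) = (\<lambda>z. exp (\<gamma> * y) * (exp (- (\<gamma> * z)) * h (z - y)))"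
  proof
    fix z
    have "exp (- (\<gamma> * (z - y))) = exp (\<gamma> * y) * exp (- (\<gamma> * z))"
      by (simp add: exp_add[symmetric] algebra_simps)
    then show "p (- y + 1 * z) = exp (\<gamma> * y) * (exp (- (\<gamma> * z)) * h (z - y))"
      by (simp add: p_def add.commute[of "- y"])
  qed
  finally show ?thesis .
qed

text \<open>For \<open>z > x\<close> the shift satisfies \<open>y \<le> z / 2\<close>, so doubling
  applies pointwise under the integral, also for negative \<open>y\<close>. The resulting factor
  \<open>exp (\<gamma> * y)\<close> is integrable against \<open>M\<close>.\<close>

lemma g_shift_bound:
  assumes "2 < x" "y \<le> x / 2"
  shows "g (x - y) \<le> K * exp (\<gamma> * y) * g x"
proof -
  have "g (x - y) \<le> (\<integral>z. K * exp (\<gamma> * y) * (indicator {x<..} z * p z) \<partial>lborel)"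
    unfolding g_shift_eq
  proof (rule integral_mono)
    show "integrable lborel (\<lambda>z. K * exp (\<gamma> * y) * (indicator {x<..} z * p z))"
      by (intro integrable_mult_right integrable_tail integrable_p)
    show "integrable lborel (\<lambda>z. indicator {x<..} z * (exp (\<gamma> * y) * (exp (- (\<gamma> * z)) * h (z - y))))"
      by (intro integrable_tail integrable_shifted)
    fix z
    show "indicator {x<..} z * (exp (\<gamma> * y) * (exp (- (\<gamma> * z)) * h (z - y))) \<le> K * exp (\<gamma> * y) * (indicator {x<..} z * p z)"
    proof (cases "x < z")
      case True
      have "h (z - y) \<le> K * h z"
        using True assms by (intro h_le_K_of_half_le) auto
      then have "exp (\<gamma> * y) * (exp (- (\<gamma> * z)) * h (z - y)) \<le> exp (\<gamma> * y) * (exp (- (\<gamma> * z)) * (K * h z))"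
        by (intro mult_left_mono) auto
      then show ?thesis using True by (simp add: p_def mult_ac)
    qed simp
  qed
  also have "\<dots> = K * exp (\<gamma> * y) * g x" by (simp add: g_def)
  finally show ?thesis .
qed

lemma g_shift_tendsto: "((\<lambda>x. g (x - y) / g x) \<longlongrightarrow> exp (\<gamma> * y)) at_top"
  unfolding g_shift_eq unfolding g_def
proof (rule tendsto_tail_integral_ratio[OF integrable_shifted integrable_p p_pos])
  have "exp (\<gamma> * y) * (exp (- (\<gamma> * z)) * h (z - y)) / p z = exp (\<gamma> * y) * (h (z - y) / h z)" for z
    by (simp add: p_def)
  then show "((\<lambda>z. exp (\<gamma> * y) * (exp (- (\<gamma> * z)) * h (z - y)) / p z) \<longlongrightarrow> exp (\<gamma> * y)) at_top"
    using tendsto_mult_left[OF h_shift[of y], of "exp (\<gamma> * y)"] by simp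
qed

lemma g_lower:
  assumes "1 \<le> x"
  shows "c * exp (- ((\<gamma> + b) * (x + 1))) \<le> g x"
proof -
  have "c * exp (- ((\<gamma> + b) * (x + 1))) = (\<integral>z. indicator {x<..x + 1} z * (c * exp (- ((\<gamma> + b) * (x + 1)))) \<partial>lborel)"
    by simp
  also have "\<dots> \<le> g x"
    unfolding g_def
  proof (rule integral_mono)
    show "integrable lborel (\<lambda>z. indicator {x<..x + 1} z * (c * exp (- ((\<gamma> + b) * (x + 1)))))"
      by (intro integrable_mult_left integrable_real_indicator) auto
    fix z
    show "indicator {x<..x + 1} z * (c * exp (- ((\<gamma> + b) * (x + 1)))) \<le> indicator {x<..} z * p z"
    proof (cases "z \<in> {x<..x + 1}")
      case True
      have "(\<gamma> + b) * z \<le> (\<gamma> + b) * (x + 1)"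
        using True \<gamma>_nonneg b_nonneg by (intro mult_left_mono) auto
      then have "c * exp (- ((\<gamma> + b) * (x + 1))) \<le> c * exp (- ((\<gamma> + b) * z))"
        using c_pos by simp
      also have "\<dots> = exp (- (\<gamma> * z)) * (c * exp (- (b * z)))"
        by (simp add: exp_add[symmetric] distrib_right)
      also have "\<dots> \<le> p z"
        unfolding p_def using True assms by (intro mult_left_mono h_lower) auto
      finally show ?thesis using True by simp
    qed (simp add: p_nonneg)
  qed (intro integrable_tail integrable_p)
  finally show ?thesis .
qed

section \<open>A further factor with finite exponential moments\<close>

context
  fixes M :: "real measure"
  assumes M: "real_distribution M"
    and exp_moments: "\<And>\<theta>. 0 \<le> \<theta> \<Longrightarrow> (\<integral>\<^sup>+x. ennreal (exp (\<theta> * x)) \<partial>M) < \<infinity>"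
begin

lemma upper_half_negligible: "((\<lambda>x. measure M {y. x / 2 < y} / g x) \<longlongrightarrow> 0) at_top"
proof -
  interpret real_distribution M by (rule M)
  \<comment> \<open>Markov's inequality at \<open>x / 2\<close> halves the order: the decay is
    \<open>exp (- ((\<gamma> + b + 1) * x))\<close>, better by \<open>exp (- x)\<close> than the
    lower bound for \<open>g\<close>.\<close>
  define \<theta> where "\<theta> = 2 * (\<gamma> + b + 1)"
  have "0 \<le> \<theta>" using \<gamma>_nonneg b_nonneg by (simp add: \<theta>_def)
  from exp_moments[OF this] obtain B where B: "(\<integral>\<^sup>+x. ennreal (exp (\<theta> * x)) \<partial>M) = ennreal B" "0 \<le> B"
    by (metis ennreal_cases infinity_ennreal_def less_irrefl)
  let ?D = "B * exp (\<gamma> + b) / c"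
  show ?thesis
  proof (rule tendsto_sandwich)
    show "((\<lambda>x. 0) \<longlongrightarrow> (0::real)) at_top" by simp
    have "((\<lambda>x. ?D * exp (- x)) \<longlongrightarrow> ?D * 0) at_top"
      by (intro tendsto_intros filterlim_compose[OF exp_at_bot] filterlim_uminus_at_bot_at_top)
    then show "((\<lambda>x. ?D * exp (- x)) \<longlongrightarrow> 0) at_top" by simp
    show "\<forall>\<^sub>F x in at_top. 0 \<le> measure M {y. x / 2 < y} / g x"
      using g_nonneg by simp
    show "\<forall>\<^sub>F x in at_top. measure M {y. x / 2 < y} / g x \<le> ?D * exp (- x)"
      using eventually_ge_at_top[of 1]
    proof eventually_elim
      case (elim x)
      have "measure M {y. x / 2 < y} \<le> measure M {y. \<theta> * (x / 2) \<le> \<theta> * y}"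
        using \<open>0 \<le> \<theta>\<close> by (intro finite_measure_mono Collect_mono impI mult_left_mono) auto
      also have "\<dots> \<le> exp (- (\<theta> * (x / 2))) * B"
        using B by (intro measure_exp_Markov M) auto
      also have "\<dots> = ?D * exp (- x) * (c * exp (- ((\<gamma> + b) * (x + 1))))"
      proof -
        have "exp (- (\<theta> * (x / 2))) = exp (\<gamma> + b) * (exp (- x) * exp (- ((\<gamma> + b) * (x + 1))))"
          by (simp add: \<theta>_def exp_add[symmetric] algebra_simps)
        then show ?thesis using c_pos by simp
      qed
      also have "\<dots> \<le> ?D * exp (- x) * g x"
        using B(2) c_pos by (intro mult_left_mono g_lower elim) auto
      finally show ?case using g_pos[OF elim] by (simp add: pos_divide_le_eq)
    qed
  qed
qed

lemma nn_integral_exp_convolution_compound_poisson: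
  "(\<integral>\<^sup>+x. ennreal (exp (\<gamma> * x)) \<partial>(M \<star> compound_poisson \<nu>)) =
    ennreal (exp (m - \<Lambda>) * (\<integral>x. exp (\<gamma> * x) \<partial>M))"
  and integrable_exp_M: "integrable M (\<lambda>x. exp (\<gamma> * x))"
proof -
  interpret real_distribution M by (rule M)
  show i: "integrable M (\<lambda>x. exp (\<gamma> * x))"
    using exp_moments[OF \<gamma>_nonneg] by (intro integrableI_bounded) auto
  have "(\<integral>\<^sup>+x. ennreal (exp (\<gamma> * x)) \<partial>(M \<star> compound_poisson \<nu>)) =
      (\<integral>\<^sup>+x. ennreal (exp (\<gamma> * x)) \<partial>M) * ennreal (exp (m - \<Lambda>))"
    using real_distribution_compound_poisson[OF finite_\<nu> sets_\<nu>]
    by (subst nn_integral_exp_convolution)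
      (auto simp: nn_integral_exp_compound_poisson[OF finite_\<nu> sets_\<nu> nn_integral_exp_\<nu> m_nonneg]
        finite_measure_axioms real_distribution_def prob_space.finite_measure)
  then show "(\<integral>\<^sup>+x. ennreal (exp (\<gamma> * x)) \<partial>(M \<star> compound_poisson \<nu>)) =
      ennreal (exp (m - \<Lambda>) * (\<integral>x. exp (\<gamma> * x) \<partial>M))"
    using i by (simp add: nn_integral_eq_integral ennreal_mult mult.commute)
qed

text \<open>With the value \<open>y\<close> of the \<open>M\<close>-summand fixed, the shift of
  \<open>g\<close> yields the weight \<open>exp (\<gamma> * y)\<close>. Values
  \<open>y > x / 2\<close>, where that comparison fails, are handled through the light tail of
  \<open>M\<close> alone.\<close>

lemma tail_convolution_compound_poisson:
  "((\<lambda>x. tail (M \<star> compound_poisson \<nu>) x / g x) \<longlongrightarrow> exp (m - \<Lambda>) * (\<integral>x. exp (\<gamma> * x) \<partial>M)) at_top"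
proof -
  interpret real_distribution M by (rule M)
  let ?P = "compound_poisson \<nu>"
  interpret P: real_distribution ?P by (rule real_distribution_compound_poisson[OF finite_\<nu> sets_\<nu>])
  have tail_meas[measurable]: "tail ?P \<in> borel_measurable borel"
  proof -
    have "mono (\<lambda>x. - tail ?P x)"
      unfolding tail_def by (intro monoI) (auto intro!: P.finite_measure_mono)
    then have "(\<lambda>x. - (- tail ?P x)) \<in> borel_measurable borel"
      by (intro borel_measurable_uminus borel_measurable_mono)
    then show ?thesis by simp
  qed
  have tail_le: "0 \<le> tail ?P x" "tail ?P x \<le> 1" for x by (auto simp: tail_def)
  have int: "integrable M (\<lambda>y. tail ?P (x - y))" for x
    by (rule integrable_const_bound[where B=1]) (use tail_le in auto)
  have conv: "tail (M \<star> ?P) x = (\<integral>y. tail ?P (x - y) \<partial>M)" for x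
  proof -
    have "emeasure (M \<star> ?P) {x<..} = (\<integral>\<^sup>+y. emeasure ?P {a. a + y \<in> {x<..}} \<partial>M)"
      by (intro convolution_emeasure) (auto simp: finite_measure_axioms P.finite_measure_axioms)
    also have "\<dots> = (\<integral>\<^sup>+y. ennreal (tail ?P (x - y)) \<partial>M)"
    proof (rule nn_integral_cong)
      fix y
      have "{a. a + y \<in> {x<..}} = {x - y<..}" by auto
      then show "emeasure ?P {a. a + y \<in> {x<..}} = ennreal (tail ?P (x - y))"
        by (simp add: P.emeasure_eq_measure tail_def)
    qed
    also have "\<dots> = ennreal (\<integral>y. tail ?P (x - y) \<partial>M)"
      using int tail_le by (intro nn_integral_eq_integral) auto
    finally show ?thesis
      using tail_le by (simp add: tail_def measure_def Bochner_Integration.integral_nonneg)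
  qed
  obtain C where C: "0 \<le> C" "\<And>x. 0 \<le> x \<Longrightarrow> tail ?P x \<le> C * g x"
    using tail_compound_poisson_bound by blast
  have shift_top: "filterlim (\<lambda>x. x - y) at_top at_top" for y :: real
    using filterlim_tendsto_add_at_top[OF tendsto_const[of "- y"] filterlim_ident] by simp
  have low: "((\<lambda>x. \<integral>y. indicator {..x / 2} y * tail ?P (x - y) / g x \<partial>M) \<longlongrightarrow> (\<integral>y. exp (m - \<Lambda>) * exp (\<gamma> * y) \<partial>M)) at_top"
  proof (rule integral_dominated_convergence_at_top[where w="\<lambda>y. C * K * exp (\<gamma> * y)"])
    show "integrable M (\<lambda>y. C * K * exp (\<gamma> * y))" using integrable_exp_M by simp
    show "\<forall>\<^sub>F x in at_top. AE y in M. norm (indicator {..x / 2} y * tail ?P (x - y) / g x) \<le> C * K * exp (\<gamma> * y)"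
      using eventually_gt_at_top[of 2]
    proof eventually_elim
      case (elim x)
      have gx: "0 < g x" using elim by (intro g_pos) auto
      show ?case
      proof (rule AE_I2)
        fix y
        show "norm (indicator {..x / 2} y * tail ?P (x - y) / g x) \<le> C * K * exp (\<gamma> * y)"
        proof (cases "y \<le> x / 2")
          case True
          have "tail ?P (x - y) \<le> C * g (x - y)" using True elim by (intro C) auto
          also have "\<dots> \<le> C * (K * exp (\<gamma> * y) * g x)"
            using True elim by (intro mult_left_mono g_shift_bound C) auto
          finally have "tail ?P (x - y) / g x \<le> C * K * exp (\<gamma> * y)"
            using gx by (simp add: pos_divide_le_eq mult_ac)
          then show ?thesis using True gx tail_le by simp
        qed (use C K_ge_1 in simp)
      qed
    qed
    show "AE y in M. ((\<lambda>x. indicator {..x / 2} y * tail ?P (x - y) / g x) \<longlongrightarrow> exp (m - \<Lambda>) * exp (\<gamma> * y)) at_top"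
    proof (rule AE_I2)
      fix y
      have "((\<lambda>x. tail ?P (x - y) / g (x - y) * (g (x - y) / g x)) \<longlongrightarrow> exp (m - \<Lambda>) * exp (\<gamma> * y)) at_top"
        by (intro tendsto_mult g_shift_tendsto filterlim_compose[OF tail_compound_poisson_tendsto shift_top])
      moreover have "\<forall>\<^sub>F x in at_top. tail ?P (x - y) / g (x - y) * (g (x - y) / g x) =
          indicator {..x / 2} y * tail ?P (x - y) / g x"
        using eventually_gt_at_top[of "2 * y"] eventually_gt_at_top[of "y + 1"]
      proof eventually_elim
        case (elim x)
        then show ?case using g_pos[of "x - y"] by simp
      qed
      ultimately show "((\<lambda>x. indicator {..x / 2} y * tail ?P (x - y) / g x) \<longlongrightarrow> exp (m - \<Lambda>) * exp (\<gamma> * y)) at_top"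
        using Lim_transform_eventually by fastforce
    qed
  qed measurable
  \<comment> \<open>Here the compound Poisson tail is bounded by \<open>1\<close>.\<close>
  have high: "((\<lambda>x. \<integral>y. indicator {x / 2<..} y * tail ?P (x - y) / g x \<partial>M) \<longlongrightarrow> 0) at_top"
  proof (rule tendsto_sandwich[OF _ _ tendsto_const upper_half_negligible])
    show "\<forall>\<^sub>F x in at_top. 0 \<le> (\<integral>y. indicator {x / 2<..} y * tail ?P (x - y) / g x \<partial>M)"
      using tail_le g_nonneg by (intro always_eventually allI Bochner_Integration.integral_nonneg) auto
    show "\<forall>\<^sub>F x in at_top. (\<integral>y. indicator {x / 2<..} y * tail ?P (x - y) / g x \<partial>M) \<le> measure M {y. x / 2 < y} / g x"
    proof (intro always_eventually allI)
      fix x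
      have "(\<integral>y. indicator {x / 2<..} y * tail ?P (x - y) / g x \<partial>M) \<le> (\<integral>y. indicator {x / 2<..} y / g x \<partial>M)"
        using tail_le g_nonneg
        by (intro integral_mono integrable_divide_zero integrable_const_bound[where B=1])
          (auto intro!: divide_right_mono mult_left_le simp: indicator_def)
      also have "\<dots> = measure M {y. x / 2 < y} / g x"
        by (simp add: greaterThan_def)
      finally show "(\<integral>y. indicator {x / 2<..} y * tail ?P (x - y) / g x \<partial>M) \<le> measure M {y. x / 2 < y} / g x" .
    qed
  qed
  have "tail (M \<star> ?P) x / g x = (\<integral>y. indicator {..x / 2} y * tail ?P (x - y) / g x \<partial>M)
      + (\<integral>y. indicator {x / 2<..} y * tail ?P (x - y) / g x \<partial>M)" for x
  proof -
    have i: "integrable M (\<lambda>y. indicator {..x / 2} y * tail ?P (x - y))"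
      "integrable M (\<lambda>y. indicator {x / 2<..} y * tail ?P (x - y))"
      using integrable_mult_indicator[OF _ int, of "{..x / 2}"] integrable_mult_indicator[OF _ int, of "{x / 2<..}"] by auto
    have "tail (M \<star> ?P) x = (\<integral>y. indicator {..x / 2} y * tail ?P (x - y) + indicator {x / 2<..} y * tail ?P (x - y) \<partial>M)"
      unfolding conv by (intro Bochner_Integration.integral_cong) (auto simp: indicator_def)
    also have "\<dots> = (\<integral>y. indicator {..x / 2} y * tail ?P (x - y) \<partial>M) + (\<integral>y. indicator {x / 2<..} y * tail ?P (x - y) \<partial>M)"
      using i by simp
    finally show ?thesis by (simp add: add_divide_distrib)
  qed
  then show ?thesis
    using tendsto_add[OF low high] by simp
qed

end

end

lemma finite_real_distribution:
  assumes "real_distribution M"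
  shows "finite_measure M" "sets M = sets borel"
  using assms by (auto simp: real_distribution_def real_distribution_axioms_def prob_space.finite_measure)

theorem (in tilted_subexponential) convolution_compound_poisson_in_class_S:
  assumes M: "real_distribution M"
    and exp_moments: "\<And>\<theta>. 0 \<le> \<theta> \<Longrightarrow> (\<integral>\<^sup>+x. ennreal (exp (\<theta> * x)) \<partial>M) < \<infinity>"
  shows "(M \<star> compound_poisson \<nu>) \<in> class_S \<gamma>"
proof -
  define \<mu> where "\<mu> = (M \<star> compound_poisson \<nu>)"
  have cp: "real_distribution (compound_poisson \<nu>)"
    by (rule real_distribution_compound_poisson[OF finite_\<nu> sets_\<nu>])
  have mu: "real_distribution \<mu>"
    unfolding \<mu>_def by (intro real_distribution_convolution M cp)
  interpret real_distribution \<mu> by (rule mu)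
  define C where "C = exp (m - \<Lambda>) * (\<integral>x. exp (\<gamma> * x) \<partial>M)"
  have nnC: "(\<integral>\<^sup>+x. ennreal (exp (\<gamma> * x)) \<partial>\<mu>) = ennreal C"
    unfolding \<mu>_def C_def by (rule nn_integral_exp_convolution_compound_poisson[OF M exp_moments])
  have int: "integrable \<mu> (\<lambda>x. exp (\<gamma> * x))"
    by (rule integrableI_bounded) (auto simp: nnC)
  have C_nn: "0 \<le> C"
    unfolding C_def by (intro mult_nonneg_nonneg Bochner_Integration.integral_nonneg) auto
  have C: "(\<integral>x. exp (\<gamma> * x) \<partial>\<mu>) = C"
    by (intro integral_eq_nn_integral[THEN trans]) (auto simp: nnC C_nn)
  \<comment> \<open>A strictly positive function cannot integrate to zero against a probability;
    \<open>C\<close> is inverted below.\<close>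
  have "C \<noteq> 0"
  proof
    assume "C = 0"
    then have "AE x in \<mu>. ennreal (exp (\<gamma> * x)) = 0"
      using nnC nn_integral_0_iff_AE[of "\<lambda>x. ennreal (exp (\<gamma> * x))" \<mu>] by simp
    then have "AE x in \<mu>. False" by eventually_elim simp
    then show False using prob_space by simp
  qed
  then have C_pos: "0 < C" using C_nn by simp
  have lim: "((\<lambda>x. tail \<mu> x / g x) \<longlongrightarrow> C) at_top"
    unfolding \<mu>_def C_def by (rule tail_convolution_compound_poisson[OF M exp_moments])
  have tail_pos: "0 < tail \<mu> x" for x
  proof -
    have "\<forall>\<^sub>F z in at_top. 0 < tail \<mu> z / g z" using lim C_pos by (rule order_tendstoD)
    then have "\<forall>\<^sub>F z in at_top. 0 < tail \<mu> z / g z \<and> x \<le> z \<and> 1 \<le> z"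
      by (intro eventually_conj eventually_ge_at_top)
    then obtain z where z: "0 < tail \<mu> z / g z" "x \<le> z" "1 \<le> z"
      using eventually_happens'[OF trivial_limit_at_top_linorder] by blast
    then have "0 < tail \<mu> z" using g_pos[of z] by (simp add: zero_less_divide_iff)
    also have "tail \<mu> z \<le> tail \<mu> x"
      unfolding tail_def using z by (intro finite_measure_mono) auto
    finally show ?thesis .
  qed
  have inv_lim: "((\<lambda>x. g x / tail \<mu> x) \<longlongrightarrow> inverse C) at_top"
    using tendsto_inverse[OF lim] C_pos by simp
  have L: "\<mu> \<in> class_L \<gamma>"
    unfolding class_L_def
  proof (intro CollectI conjI allI mu tail_pos)
    fix y :: real
    have "filterlim (\<lambda>x. x + y) at_top at_top"
      using filterlim_tendsto_add_at_top[OF tendsto_const[of y] filterlim_ident] by (simp add: add.commute)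
    then have "((\<lambda>x. tail \<mu> (x + y) / g (x + y)) \<longlongrightarrow> C) at_top"
      by (rule filterlim_compose[OF lim])
    moreover have "((\<lambda>x. g (x + y) / g x) \<longlongrightarrow> exp (- (\<gamma> * y))) at_top"
      using g_shift_tendsto[of "- y"] by simp
    ultimately have "((\<lambda>x. tail \<mu> (x + y) / g (x + y) * (g (x + y) / g x) * (g x / tail \<mu> x))
        \<longlongrightarrow> C * exp (- (\<gamma> * y)) * inverse C) at_top"
      by (intro tendsto_mult inv_lim)
    moreover have "\<forall>\<^sub>F x in at_top. tail \<mu> (x + y) / g (x + y) * (g (x + y) / g x) * (g x / tail \<mu> x) =
        tail \<mu> (x + y) / tail \<mu> x"
      using eventually_ge_at_top[of 1] eventually_ge_at_top[of "1 - y"]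
    proof eventually_elim
      case (elim x)
      then show ?case using g_pos[of x] g_pos[of "x + y"] by simp
    qed
    moreover have "C * exp (- (\<gamma> * y)) * inverse C = exp (- (\<gamma> * y))" using C_pos by simp
    ultimately show "((\<lambda>x. tail \<mu> (x + y) / tail \<mu> x) \<longlongrightarrow> exp (- (\<gamma> * y))) at_top"
      using Lim_transform_eventually by fastforce
  qed
  \<comment> \<open>All conditions on \<open>h\<close> are homogeneous except the lower bound, which
    only improves, so \<open>K\<close>, \<open>b\<close> and \<open>c\<close> are kept.\<close>
  interpret two: tilted_subexponential "\<lambda>x. 2 * h x" K \<gamma> b c
  proof
    show "2 * h y \<le> 2 * h x" if "1 < x" "x \<le> y" for x y using h_antimono[OF that] by simp
    show "2 * h (x / 2) \<le> K * (2 * h x)" if "2 < x" for x using h_half[OF that] by simp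
    show "c * exp (- (b * x)) \<le> 2 * h x" if "1 < x" for x using h_lower[OF that] h_nonneg[of x] by linarith
  qed (use h_zero h_pos h_shift integrable_h \<gamma>_nonneg b_nonneg c_pos in auto)
  have g2: "two.g x = 2 * g x" for x
    by (simp add: two.g_def g_def two.p_def p_def mult.left_commute[of _ 2])
  \<comment> \<open>Doubling the Levy measure doubles the exponent, so this law is the convolution
    square.\<close>
  have char2: "char (compound_poisson two.\<nu>) t = char (compound_poisson \<nu>) t * char (compound_poisson \<nu>) t" for t
  proof -
    have [measurable]: "p \<in> borel_measurable lborel" "two.p \<in> borel_measurable lborel"
      using borel_measurable_integrable integrable_p two.integrable_p by blast+
    have p2: "two.p x = 2 * p x" for x by (simp add: two.p_def p_def)
    have "(CLINT x|two.\<nu>. iexp (t * x) - 1) = (CLINT x|lborel. two.p x *\<^sub>R (iexp (t * x) - 1))"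
      unfolding two.\<nu>_def by (rule integral_density) (auto simp: two.p_nonneg)
    also have "\<dots> = (CLINT x|lborel. 2 * (p x *\<^sub>R (iexp (t * x) - 1)))"
      by (simp add: p2 scaleR_conv_of_real mult.assoc)
    also have "\<dots> = 2 * (CLINT x|lborel. p x *\<^sub>R (iexp (t * x) - 1))"
      by (rule integral_mult_right_zero)
    also have "(CLINT x|lborel. p x *\<^sub>R (iexp (t * x) - 1)) = (CLINT x|\<nu>. iexp (t * x) - 1)"
      unfolding \<nu>_def by (rule integral_density[symmetric]) (auto simp: p_nonneg)
    finally show ?thesis
      by (simp add: char_compound_poisson[OF finite_\<nu> sets_\<nu>] char_compound_poisson[OF two.finite_\<nu> two.sets_\<nu>] exp_double power2_eq_square)
  qed
  have M2: "real_distribution (M \<star> M)" by (intro real_distribution_convolution M)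
  have exp_moments2: "(\<integral>\<^sup>+x. ennreal (exp (\<theta> * x)) \<partial>(M \<star> M)) < \<infinity>" if "0 \<le> \<theta>" for \<theta>
    using exp_moments[OF that] by (simp add: nn_integral_exp_convolution finite_real_distribution[OF M] ennreal_mult_less_top)
  have cp2: "real_distribution (compound_poisson two.\<nu>)"
    by (rule real_distribution_compound_poisson[OF two.finite_\<nu> two.sets_\<nu>])
  have mumu: "(\<mu> \<star> \<mu>) = ((M \<star> M) \<star> compound_poisson two.\<nu>)"
  proof (rule Levy_uniqueness)
    show "char (\<mu> \<star> \<mu>) = char ((M \<star> M) \<star> compound_poisson two.\<nu>)"
      unfolding \<mu>_def
      by (rule ext) (simp add: char_convolution convolution_finite char2
          finite_real_distribution[OF M] finite_real_distribution[OF cp] finite_real_distribution[OF cp2])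
  qed (intro real_distribution_convolution mu M cp2)+
  define D where "D = exp (two.m - two.\<Lambda>) * (\<integral>x. exp (\<gamma> * x) \<partial>(M \<star> M))"
  have D_nn: "0 \<le> D"
    unfolding D_def by (intro mult_nonneg_nonneg Bochner_Integration.integral_nonneg) auto
  \<comment> \<open>The moment of \<open>\<mu> \<star> \<mu>\<close> is evaluated twice, through the
    new decomposition and by multiplicativity; this identifies the limit constant.\<close>
  have "ennreal D = (\<integral>\<^sup>+x. ennreal (exp (\<gamma> * x)) \<partial>(\<mu> \<star> \<mu>))"
    unfolding mumu D_def by (rule two.nn_integral_exp_convolution_compound_poisson[OF M2 exp_moments2, symmetric])
  also have "\<dots> = ennreal (C * C)"
    using C_nn by (simp add: nn_integral_exp_convolution finite_real_distribution[OF mu] nnC ennreal_mult)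
  finally have D: "D = C * C" using D_nn C_nn by (subst (asm) ennreal_inj) auto
  have "((\<lambda>x. tail (\<mu> \<star> \<mu>) x / two.g x) \<longlongrightarrow> C * C) at_top"
    unfolding mumu D[symmetric] D_def by (rule two.tail_convolution_compound_poisson[OF M2 exp_moments2])
  then have "((\<lambda>x. 2 * (tail (\<mu> \<star> \<mu>) x / two.g x) * (g x / tail \<mu> x)) \<longlongrightarrow> 2 * (C * C) * inverse C) at_top"
    by (intro tendsto_mult inv_lim tendsto_const)
  moreover have "\<forall>\<^sub>F x in at_top. 2 * (tail (\<mu> \<star> \<mu>) x / two.g x) * (g x / tail \<mu> x) = tail (\<mu> \<star> \<mu>) x / tail \<mu> x"
    using eventually_ge_at_top[of 1]
  proof eventually_elim
    case (elim x)
    then show ?case using g_pos[of x] by (simp add: g2)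
  qed
  moreover have "2 * (C * C) * inverse C = 2 * C" using C_pos by simp
  ultimately have "((\<lambda>x. tail (\<mu> \<star> \<mu>) x / tail \<mu> x) \<longlongrightarrow> 2 * C) at_top"
    using Lim_transform_eventually by fastforce
  then have "\<mu> \<in> class_S \<gamma>"
    unfolding class_S_def using mu int L C by simp
  then show ?thesis by (simp add: \<mu>_def)
qed

subsection \<open>Thorin measures\<close>

text \<open>Every point outside the support has an open null neighbourhood; Lindelof's theorem
  reduces their union to a countable one.\<close>

lemma emeasure_open_disjoint_support:
  assumes sets: "sets M = sets borel" and "open U" and disj: "U \<inter> measure_support M = {}"
  shows "emeasure M U = 0"
proof -
  define F where "F = {V. open V \<and> emeasure M V = 0}"
  obtain F' where F': "F' \<subseteq> F" "countable F'" "\<Union>F' = \<Union>F"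
    using Lindelof[of F] by (auto simp: F_def)
  have "(\<Union>V\<in>F'. V) \<in> null_sets M"
    using F' by (intro null_sets_UN') (auto simp: F_def null_sets_def sets)
  moreover have "U \<subseteq> \<Union>F"
  proof
    fix x assume "x \<in> U"
    then have "x \<notin> measure_support M" using disj by auto
    then obtain V where "open V" "x \<in> V" "emeasure M V = 0"
      by (auto simp: measure_support_def)
    then show "x \<in> \<Union>F" by (auto simp: F_def)
  qed
  ultimately show ?thesis
    using F' emeasure_mono[of U "\<Union>F'" M] by (simp add: null_sets_def)
qed

text \<open>On bounded sets the integrands of the Thorin condition stay away from zero: at least
  \<open>1\<close> on (0, 1] and at least \<open>1 / d\<^sup>2\<close> on (1, d].\<close>

lemma thorin_half_emeasure_atMost:
  assumes "thorin_half_measure \<tau>"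
  shows "emeasure \<tau> {..c} < \<infinity>"
proof -
  have sets[measurable_cong]: "sets \<tau> = sets borel" and zero: "emeasure \<tau> {..0} = 0"
    and i1: "(\<integral>\<^sup>+ s. ennreal (1 + \<bar>ln s\<bar>) * indicator {0<..1} s \<partial>\<tau>) < \<infinity>"
    and i2: "(\<integral>\<^sup>+ s. ennreal (1 / s\<^sup>2) * indicator {1<..} s \<partial>\<tau>) < \<infinity>"
    using assms by (auto simp: thorin_half_measure_def)
  define d where "d = max c 1"
  have d: "1 \<le> d" "c \<le> d" by (auto simp: d_def)
  have e1: "emeasure \<tau> {0<..1} < \<infinity>"
  proof -
    have "emeasure \<tau> {0<..1} = (\<integral>\<^sup>+ s. indicator {0<..1} s \<partial>\<tau>)" by (simp add: sets)
    also have "\<dots> \<le> (\<integral>\<^sup>+ s. ennreal (1 + \<bar>ln s\<bar>) * indicator {0<..1} s \<partial>\<tau>)"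
    proof (rule nn_integral_mono)
      fix s :: real
      have "ennreal 1 \<le> ennreal (1 + \<bar>ln s\<bar>)" by (intro ennreal_leI) simp
      then show "indicator {0<..1} s \<le> ennreal (1 + \<bar>ln s\<bar>) * indicator {0<..1} s"
        by (cases "s \<in> {0<..1}") (simp_all only: indicator_simps mult_1_right mult_zero_right ennreal_1 order_refl not_False_eq_True)
    qed
    also note i1
    finally show ?thesis .
  qed
  have e2: "emeasure \<tau> {1<..d} < \<infinity>"
  proof -
    have "emeasure \<tau> {1<..d} = (\<integral>\<^sup>+ s. indicator {1<..d} s \<partial>\<tau>)" by (simp add: sets)
    also have "\<dots> \<le> (\<integral>\<^sup>+ s. ennreal (d\<^sup>2) * (ennreal (1 / s\<^sup>2) * indicator {1<..} s) \<partial>\<tau>)"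
    proof (rule nn_integral_mono)
      fix s :: real
      have "1 \<le> d\<^sup>2 * (1 / s\<^sup>2)" if "1 < s" "s \<le> d"
        using that power_mono[of s d 2] by (simp add: pos_le_divide_eq)
      then show "indicator {1<..d} s \<le> ennreal (d\<^sup>2) * (ennreal (1 / s\<^sup>2) * indicator {1<..} s)"
        by (auto simp: indicator_def ennreal_mult[symmetric] simp flip: ennreal_1 intro!: ennreal_leI)
    qed
    also have "\<dots> = ennreal (d\<^sup>2) * (\<integral>\<^sup>+ s. ennreal (1 / s\<^sup>2) * indicator {1<..} s \<partial>\<tau>)"
      by (rule nn_integral_cmult) measurable
    also have "\<dots> < \<infinity>" using i2 by (simp add: ennreal_mult_less_top)
    finally show ?thesis .
  qed
  have "emeasure \<tau> {..c} \<le> emeasure \<tau> ({..0} \<union> ({0<..1} \<union> {1<..d}))"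
    using d by (intro emeasure_mono) (auto simp: sets)
  also have "\<dots> \<le> emeasure \<tau> {..0} + emeasure \<tau> ({0<..1} \<union> {1<..d})"
    by (intro emeasure_subadditive) (auto simp: sets)
  also have "\<dots> \<le> emeasure \<tau> {..0} + (emeasure \<tau> {0<..1} + emeasure \<tau> {1<..d})"
    by (intro add_left_mono emeasure_subadditive) (auto simp: sets)
  also have "\<dots> < \<infinity>" using zero e1 e2 by simp
  finally show ?thesis .
qed

lemma thorin_half_AE_pos:
  assumes "thorin_half_measure \<tau>"
  shows "AE s in \<tau>. 0 < s"
  using assms by (intro AE_I[of _ _ "{..0}"]) (auto simp: thorin_half_measure_def)

text \<open>Needed for measurability in \<open>x\<close> of Laplace integrals over
  \<open>\<tau>\<close>.\<close>

lemma thorin_half_sigma_finite: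
  assumes "thorin_half_measure \<tau>"
  shows "sigma_finite_measure \<tau>"
proof
  have sets: "sets \<tau> = sets borel" using assms by (simp add: thorin_half_measure_def)
  have "space \<tau> = UNIV" using sets by (metis sets_eq_imp_space_eq space_borel)
  moreover have "x \<in> (\<Union>n. {..real n})" for x :: real
    using real_arch_simple[of x] by auto
  ultimately show "\<exists>A. countable A \<and> A \<subseteq> sets \<tau> \<and> \<Union> A = space \<tau> \<and> (\<forall>a\<in>A. emeasure \<tau> a \<noteq> \<infinity>)"
    using thorin_half_emeasure_atMost[OF assms]
    by (intro exI[of _ "range (\<lambda>n::nat. {..real n})"]) (auto simp: sets less_top[symmetric])
qed

text \<open>The exponential is at most \<open>1\<close> near the origin and at most
  \<open>2 / (s * x)\<^sup>2\<close> beyond \<open>1\<close>, matching the two integrals of the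
  Thorin condition.\<close>

lemma thorin_half_integrable_exp:
  assumes "thorin_half_measure \<tau>" "0 < x"
  shows "integrable \<tau> (\<lambda>s. exp (- (s * x)))"
proof (rule integrableI_bounded)
  have sets[measurable_cong]: "sets \<tau> = sets borel"
    and i1: "(\<integral>\<^sup>+ s. ennreal (1 + \<bar>ln s\<bar>) * indicator {0<..1} s \<partial>\<tau>) < \<infinity>"
    and i2: "(\<integral>\<^sup>+ s. ennreal (1 / s\<^sup>2) * indicator {1<..} s \<partial>\<tau>) < \<infinity>"
    using assms by (auto simp: thorin_half_measure_def)
  show "(\<lambda>s. exp (- (s * x))) \<in> borel_measurable \<tau>" by measurable
  have "(\<integral>\<^sup>+ s. ennreal (norm (exp (- (s * x)))) \<partial>\<tau>) \<le> (\<integral>\<^sup>+ s. ennreal (1 + \<bar>ln s\<bar>) * indicator {0<..1} s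
      + ennreal (2 / x\<^sup>2) * (ennreal (1 / s\<^sup>2) * indicator {1<..} s) \<partial>\<tau>)"
  proof (rule nn_integral_mono_AE)
    show "AE s in \<tau>. ennreal (norm (exp (- (s * x)))) \<le> ennreal (1 + \<bar>ln s\<bar>) * indicator {0<..1} s
      + ennreal (2 / x\<^sup>2) * (ennreal (1 / s\<^sup>2) * indicator {1<..} s)"
      using thorin_half_AE_pos[OF assms(1)]
    proof eventually_elim
      case (elim s)
      show ?case
      proof (cases "s \<le> 1")
        case True
        have "exp (- (s * x)) \<le> 1" using elim assms(2) by simp
        then have "exp (- (s * x)) \<le> 1 + \<bar>ln s\<bar>" using abs_ge_zero[of "ln s"] by linarith
        moreover have "s \<in> {0<..1}" "s \<notin> {1<..}" using elim True by auto
        ultimately show ?thesis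
          by (simp only: indicator_simps mult_1_right mult_zero_right add_0_right real_norm_def abs_exp_cancel ennreal_leI not_False_eq_True)
      next
        case False
        have "(s * x)\<^sup>2 / 2 \<le> exp (s * x)"
          using exp_lower_Taylor_quadratic[of "s * x"] elim assms(2) by (smt (verit) mult_pos_pos)
        then have "inverse (exp (s * x)) \<le> inverse ((s * x)\<^sup>2 / 2)"
          using elim assms(2) by (intro le_imp_inverse_le) auto
        then have "exp (- (s * x)) \<le> 2 / x\<^sup>2 * (1 / s\<^sup>2)"
          by (simp add: exp_minus power_mult_distrib mult.commute)
        then show ?thesis using False by (auto simp: ennreal_mult[symmetric] intro!: ennreal_leI)
      qed
    qed
  qed
  also have "\<dots> = (\<integral>\<^sup>+ s. ennreal (1 + \<bar>ln s\<bar>) * indicator {0<..1} s \<partial>\<tau>)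
      + ennreal (2 / x\<^sup>2) * (\<integral>\<^sup>+ s. ennreal (1 / s\<^sup>2) * indicator {1<..} s \<partial>\<tau>)"
    by (subst nn_integral_add) (auto simp: nn_integral_cmult)
  also have "\<dots> < \<infinity>" using i1 i2 by (simp add: ennreal_mult_less_top)
  finally show "(\<integral>\<^sup>+ s. ennreal (norm (exp (- (s * x)))) \<partial>\<tau>) < \<infinity>" .
qed

lemma measurable_thorin_k:
  assumes "thorin_half_measure \<tau>p" "thorin_half_measure \<tau>m"
  shows "thorin_k \<tau>p \<tau>m \<in> borel_measurable borel"
proof -
  have *: "(\<lambda>x. \<integral>\<^sup>+ s. ennreal (exp (- (s * \<bar>x\<bar>))) \<partial>\<tau>) \<in> borel_measurable borel"
    if "thorin_half_measure \<tau>" for \<tau>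
  proof -
    interpret sigma_finite_measure \<tau> by (rule thorin_half_sigma_finite[OF that])
    have [measurable_cong]: "sets \<tau> = sets borel" using that by (simp add: thorin_half_measure_def)
    show ?thesis by measurable
  qed
  note [measurable] = *[OF assms(1)] *[OF assms(2)]
  show ?thesis unfolding thorin_k_def by measurable
qed

text \<open>Makes \<open>Inf\<close> of the support meaningful: on a set unbounded below its value
  is unspecified.\<close>

lemma measure_support_bounded_below:
  assumes "sets M = sets borel" "emeasure M {..0} = 0"
  shows "measure_support M \<subseteq> {0..}"
proof
  fix x assume x: "x \<in> measure_support M"
  show "x \<in> {0..}"
  proof (rule ccontr)
    assume "x \<notin> {0..}"
    then have "emeasure M {..<0} > 0" using x by (auto simp: measure_support_def)
    moreover have "emeasure M {..<0} \<le> emeasure M {..0}" using assms by (intro emeasure_mono) auto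
    ultimately show False using assms by simp
  qed
qed

text \<open>With \<open>\<gamma>\<close> the bottom of the support, the tilted function \<open>exp (\<gamma> x) k(x)\<close> is the Laplace transform of the
  translate of \<open>\<tau>p\<close>, a measure on the half line whose support contains \<open>0\<close>.\<close>

lemma laplace_near_zero_translated:
  assumes th: "thorin_half_measure \<tau>p" and ne: "emeasure \<tau>p UNIV \<noteq> 0"
    and \<gamma>: "\<gamma> = Inf (measure_support \<tau>p)"
  shows "laplace_near_zero (translated_measure \<tau>p \<gamma>)"
proof
  have sets[measurable_cong]: "sets \<tau>p = sets borel" and zero: "emeasure \<tau>p {..0} = 0"
    using th by (auto simp: thorin_half_measure_def)
  have sub: "measure_support \<tau>p \<subseteq> {0..}" by (rule measure_support_bounded_below[OF sets zero])
  then have bdd: "bdd_below (measure_support \<tau>p)" by (intro bdd_belowI[of _ 0]) auto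
  show "sets (translated_measure \<tau>p \<gamma>) = sets borel" by (simp add: translated_measure_def)
  have "\<gamma> \<le> s" if "s \<in> measure_support \<tau>p" for s
    unfolding \<gamma> by (rule cInf_lower[OF that bdd])
  then have "{..<\<gamma>} \<inter> measure_support \<tau>p = {}" by fastforce
  then have "emeasure \<tau>p {..<\<gamma>} = 0"
    by (intro emeasure_open_disjoint_support[OF sets]) auto
  then have "AE s in \<tau>p. \<gamma> \<le> s"
    by (intro AE_I[of _ _ "{..<\<gamma>}"]) (auto simp: sets)
  then show "AE u in translated_measure \<tau>p \<gamma>. 0 \<le> u"
    unfolding translated_measure_def by (subst AE_distr_iff) auto
  fix x :: real assume x: "0 < x"
  show "integrable (translated_measure \<tau>p \<gamma>) (\<lambda>u. exp (- (u * x)))"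
  proof -
    have "integrable \<tau>p (\<lambda>s. exp (\<gamma> * x) * exp (- (s * x)))"
      using thorin_half_integrable_exp[OF th x] by simp
    also have "(\<lambda>s. exp (\<gamma> * x) * exp (- (s * x))) = (\<lambda>s. exp (- ((s - \<gamma>) * x)))"
      by (auto simp: exp_add[symmetric] algebra_simps)
    finally show ?thesis
      unfolding translated_measure_def by (subst integrable_distr_eq) auto
  qed
next
  fix \<epsilon> :: real assume \<epsilon>: "0 < \<epsilon>"
  have sets[measurable_cong]: "sets \<tau>p = sets borel" and zero: "emeasure \<tau>p {..0} = 0"
    using th by (auto simp: thorin_half_measure_def)
  have sp: "space \<tau>p = UNIV" using sets by (metis sets_eq_imp_space_eq space_borel)
  have bdd: "bdd_below (measure_support \<tau>p)"
    using measure_support_bounded_below[OF sets zero] by (intro bdd_belowI[of _ 0]) auto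
  have nonempty: "measure_support \<tau>p \<noteq> {}"
    using emeasure_open_disjoint_support[OF sets, of UNIV] ne by auto
  \<comment> \<open>Mass directly above \<gamma>: the infimum is approached by points of the
    support, and an open neighbourhood of such a point is charged.\<close>
  obtain s where s: "s \<in> measure_support \<tau>p" "s < \<gamma> + \<epsilon>"
    using cInf_less_iff[OF nonempty bdd, of "\<gamma> + \<epsilon>"] \<epsilon> \<gamma> by auto
  then have "0 < emeasure \<tau>p {..<\<gamma> + \<epsilon>}" by (auto simp: measure_support_def)
  also have "\<dots> \<le> emeasure \<tau>p {..\<gamma> + \<epsilon>}" by (intro emeasure_mono) (auto simp: sets)
  also have "emeasure \<tau>p {..\<gamma> + \<epsilon>} = emeasure (translated_measure \<tau>p \<gamma>) {..\<epsilon>}"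
    unfolding translated_measure_def
    by (subst emeasure_distr) (auto simp: sp intro!: arg_cong[where f="emeasure \<tau>p"])
  finally have "0 < emeasure (translated_measure \<tau>p \<gamma>) {..\<epsilon>}" .
  moreover have "emeasure (translated_measure \<tau>p \<gamma>) {..\<epsilon>} < \<infinity>"
  proof -
    have "emeasure (translated_measure \<tau>p \<gamma>) {..\<epsilon>} = emeasure \<tau>p {..\<gamma> + \<epsilon>}"
      unfolding translated_measure_def
      by (subst emeasure_distr) (auto simp: sp intro!: arg_cong[where f="emeasure \<tau>p"])
    then show ?thesis using thorin_half_emeasure_atMost[OF th] by simp
  qed
  ultimately show "0 < cdf (translated_measure \<tau>p \<gamma>) \<epsilon>"
    by (simp add: cdf_def measure_def enn2real_positive_iff)
qed

text \<open>The convergent ratio for \<open>l = 2\<close> is eventually below its limit plus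
  \<open>1\<close>, whatever the index \<open>\<rho>\<close>.\<close>

lemma regularly_varying_at_0_doubling:
  assumes "regularly_varying_at_0 F" and pos: "\<And>x. 0 < x \<Longrightarrow> 0 < F x"
  obtains C \<delta> where "0 < \<delta>" and "\<And>t. 0 < t \<Longrightarrow> t \<le> \<delta> \<Longrightarrow> F (2 * t) \<le> C * F t"
proof -
  obtain \<rho> where "((\<lambda>x. F (2 * x) / F x) \<longlongrightarrow> 2 powr \<rho>) (at_right 0)"
    using assms(1) unfolding regularly_varying_at_0_def by (auto dest: spec[of _ 2])
  then have "\<forall>\<^sub>F x in at_right 0. F (2 * x) / F x < 2 powr \<rho> + 1"
    by (intro order_tendstoD(2)) auto
  then obtain d where d: "0 < d" "\<And>x. 0 < x \<Longrightarrow> x < d \<Longrightarrow> F (2 * x) / F x < 2 powr \<rho> + 1"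
    by (auto simp: eventually_at_right[of 0 1])
  show ?thesis
  proof (rule that[of "d / 2" "2 powr \<rho> + 1"])
    fix t :: real assume t: "0 < t" "t \<le> d / 2"
    have "F (2 * t) / F t < 2 powr \<rho> + 1" using t d(1) by (intro d(2)) auto
    then show "F (2 * t) \<le> (2 powr \<rho> + 1) * F t"
      using pos[OF t(1)] by (simp add: pos_divide_less_eq)
  qed (use d in simp)
qed

theorem theorem3:
  fixes \<mu> \<tau> \<tau>p \<tau>m :: "real measure" and \<gamma> :: real
  assumes "\<mu> \<in> thorin_class"
    and "has_thorin_measure \<mu> \<tau> \<tau>p \<tau>m"
    and "emeasure \<tau>p UNIV \<noteq> 0"
    and "0 \<le> \<gamma>"
    and "\<gamma> = Inf (measure_support \<tau>p)"
    and "integrable \<mu> (\<lambda>x. exp (\<gamma> * x))"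
    and "regularly_varying_at_0 (cdf (translated_measure \<tau>p \<gamma>))"
  shows "\<mu> \<in> class_S \<gamma>"
proof -
  let ?T = "translated_measure \<tau>p \<gamma>" and ?N = "thorin_levy_measure \<tau>p \<tau>m"
  have th: "thorin_half_measure \<tau>p" "thorin_half_measure \<tau>m"
    and "\<exists>b A. has_levy_triplet \<mu> b A ?N"
    using assms(2) by (auto simp: has_thorin_measure_def)
  then obtain b A where triplet: "has_levy_triplet \<mu> b A ?N" by blast
  interpret laplace_near_zero ?T
    by (rule laplace_near_zero_translated[OF th(1) assms(3,5)])
  have sets\<tau>[measurable_cong]: "sets \<tau>p = sets borel" using th by (simp add: thorin_half_measure_def)
  obtain C \<delta> where C: "0 < \<delta>" "\<And>t. 0 < t \<Longrightarrow> t \<le> \<delta> \<Longrightarrow> cdf ?T (2 * t) \<le> C * cdf ?T t"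
    using regularly_varying_at_0_doubling[OF assms(7) cdf_pos] by blast
  obtain K where K: "\<And>x. 2 \<le> x \<Longrightarrow> \<kappa> (x / 2) \<le> K * \<kappa> x"
    using \<kappa>_doubling[OF C] by blast
  have \<kappa>_eq: "\<kappa> x = (\<integral>s. exp (- ((s - \<gamma>) * x)) \<partial>\<tau>p)" for x
    by (subst \<kappa>_def) (simp add: translated_measure_def integral_distr)
  have [measurable]: "\<kappa> \<in> borel_measurable borel"
  proof -
    interpret sigma_finite_measure \<tau>p by (rule thorin_half_sigma_finite[OF th(1)])
    have "(\<lambda>x. \<integral>s. exp (- ((s - \<gamma>) * x)) \<partial>\<tau>p) \<in> borel_measurable borel" by measurable
    then show ?thesis by (simp add: \<kappa>_eq[abs_def])
  qed
  define h where "h x = (if 1 < x then \<kappa> x / x else 0)" for x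
  have [measurable]: "h \<in> borel_measurable borel" unfolding h_def by measurable
  have h_nn: "0 \<le> h x" for x using \<kappa>_pos[of x] by (auto simp: h_def)
  define P where "P = density ?N (\<lambda>x. ennreal (indicator {1<..} x))"
  have P: "P = density lborel (\<lambda>x. ennreal (exp (- (\<gamma> * x)) * h x))"
  proof -
    note [measurable] = measurable_thorin_k[OF th]
    have "P = density lborel (\<lambda>x. thorin_k \<tau>p \<tau>m x / ennreal \<bar>x\<bar> * ennreal (indicator {1<..} x))"
      unfolding P_def thorin_levy_measure_def by (rule density_density_eq) auto
    also have "(\<lambda>x. thorin_k \<tau>p \<tau>m x / ennreal \<bar>x\<bar> * ennreal (indicator {1<..} x)) =
        (\<lambda>x. ennreal (exp (- (\<gamma> * x)) * h x))"
    proof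
      fix x
      show "thorin_k \<tau>p \<tau>m x / ennreal \<bar>x\<bar> * ennreal (indicator {1<..} x) = ennreal (exp (- (\<gamma> * x)) * h x)"
      proof (cases "1 < x")
        case True
        have "thorin_k \<tau>p \<tau>m x = ennreal (\<integral>s. exp (- (s * x)) \<partial>\<tau>p)"
          using True thorin_half_integrable_exp[OF th(1), of x]
          by (simp add: thorin_k_def nn_integral_eq_integral)
        also have "(\<integral>s. exp (- (s * x)) \<partial>\<tau>p) = (\<integral>s. exp (- (\<gamma> * x)) * exp (- ((s - \<gamma>) * x)) \<partial>\<tau>p)"
          by (intro Bochner_Integration.integral_cong) (auto simp: exp_add[symmetric] algebra_simps)
        also have "\<dots> = exp (- (\<gamma> * x)) * \<kappa> x" by (simp add: \<kappa>_eq)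
        finally show ?thesis
          using True \<kappa>_pos[of x] by (simp add: h_def divide_ennreal)
      qed (simp add: h_def)
    qed
    finally show ?thesis .
  qed
  obtain M where M: "real_distribution M" "finite_measure P"
      "\<And>\<theta>. 0 \<le> \<theta> \<Longrightarrow> (\<integral>\<^sup>+x. ennreal (exp (\<theta> * x)) \<partial>M) < \<infinity>"
      "\<mu> = (M \<star> compound_poisson P)"
    using levy_large_jump_decomposition[OF triplet] unfolding P_def by blast
  have setsP: "sets P = sets borel" by (simp add: P)
  \<comment> \<open>The moment of order \<gamma> factors over \<open>M\<close> and the compound
    Poisson part, descends to \<open>P\<close>, and cancels the tilt in the density of
    \<open>P\<close>.\<close>
  have int_h: "integrable lborel h"
  proof (rule integrableI_bounded)
    note cp = finite_real_distribution[OF real_distribution_compound_poisson[OF M(2) setsP]]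
    let ?I = "\<lambda>Q. \<integral>\<^sup>+x. ennreal (exp (\<gamma> * x)) \<partial>(Q :: real measure)"
    have "?I \<mu> < \<infinity>"
      using assms(6) by (simp add: nn_integral_eq_integral)
    then have fin: "?I M * ?I (compound_poisson P) < \<infinity>"
      unfolding M(4) by (simp add: nn_integral_exp_convolution finite_real_distribution[OF M(1)] cp)
    \<comment> \<open>A finite product in \<open>ennreal\<close> says nothing about a factor whose
      partner is \<open>0\<close>.\<close>
    have "?I M \<noteq> 0"
    proof
      interpret real_distribution M by (rule M(1))
      assume "?I M = 0"
      then have "AE x in M. ennreal (exp (\<gamma> * x)) = 0"
        using nn_integral_0_iff_AE[of "\<lambda>x. ennreal (exp (\<gamma> * x))" M] by simp
      then have "AE x in M. False" by eventually_elim simp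
      then show False using prob_space by simp
    qed
    then have "?I (compound_poisson P) < \<infinity>"
      using fin by (auto simp: ennreal_mult_less_top)
    then have "?I P < \<infinity>"
      by (rule nn_integral_exp_compound_poisson_finite[OF M(2) setsP])
    also have "?I P = (\<integral>\<^sup>+x. ennreal (exp (- (\<gamma> * x)) * h x) * ennreal (exp (\<gamma> * x)) \<partial>lborel)"
      unfolding P by (subst nn_integral_density) auto
    also have "\<dots> = (\<integral>\<^sup>+x. ennreal (norm (h x)) \<partial>lborel)"
      using h_nn by (intro nn_integral_cong) (simp add: ennreal_mult[symmetric] exp_minus field_simps)
    finally show "(\<integral>\<^sup>+x. ennreal (norm (h x)) \<partial>lborel) < \<infinity>" .
  qed measurable
  have shift: "((\<lambda>x. h (x - y) / h x) \<longlongrightarrow> 1) at_top" if "0 \<le> y" for y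
  proof -
    have "((\<lambda>x. x / (x - y)) \<longlongrightarrow> 1) at_top" by real_asymp
    then have "((\<lambda>x. \<kappa> (x - y) / \<kappa> x * (x / (x - y))) \<longlongrightarrow> 1 * 1) at_top"
      using \<kappa>_long_tailed[OF K that] by (intro tendsto_mult)
    moreover have "\<forall>\<^sub>F x in at_top. \<kappa> (x - y) / \<kappa> x * (x / (x - y)) = h (x - y) / h x"
      using eventually_gt_at_top[of "y + 1"]
    proof eventually_elim
      case (elim x)
      then show ?case using that by (simp add: h_def)
    qed
    ultimately show ?thesis using Lim_transform_eventually by fastforce
  qed
  \<comment> \<open>The extra factor \<open>2\<close> comes from \<open>1 / x\<close> at
    \<open>x / 2\<close>. In the lower bound one factor \<open>exp (- x)\<close> is
    \<open>\<kappa>_lower\<close> at \<open>1\<close>, the other one bounds \<open>1 / x\<close>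
    from below.\<close>
  interpret tilted_subexponential h "2 * K" \<gamma> 2 "cdf ?T 1"
  proof
    show "h x = 0" if "x \<le> 1" for x using that by (simp add: h_def)
    show "0 < h x" if "1 < x" for x using that \<kappa>_pos[of x] by (simp add: h_def)
    show "h y \<le> h x" if "1 < x" "x \<le> y" for x y
      using that \<kappa>_antimono[of x y] \<kappa>_pos[of y] by (simp add: h_def frac_le)
    show "h (x / 2) \<le> 2 * K * h x" if "2 < x" for x
      using that K[of x] by (simp add: h_def divide_simps)
    show "((\<lambda>x. h (x - y) / h x) \<longlongrightarrow> 1) at_top" for y
    proof (cases "0 \<le> y")
      case False
      have top: "filterlim (\<lambda>x. x - y) at_top at_top"
        using filterlim_tendsto_add_at_top[OF tendsto_const[of "- y"] filterlim_ident] by simp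
      \<comment> \<open>A negative shift is the reciprocal of a positive one, based at
        \<open>x - y\<close>.\<close>
      have "((\<lambda>x. h (x - y - - y) / h (x - y)) \<longlongrightarrow> 1) at_top"
        using False by (intro filterlim_compose[OF shift top]) auto
      from tendsto_inverse[OF this] show ?thesis by simp
    qed (rule shift)
    show "cdf ?T 1 * exp (- (2 * x)) \<le> h x" if "1 < x" for x
    proof -
      have "x \<le> exp x" using exp_ge_add_one_self[of x] by linarith
      then have "x * exp (- x) \<le> exp x * exp (- x)" by (rule mult_right_mono) simp
      then have "exp (- x) \<le> 1 / x"
        using that by (simp add: exp_add[symmetric] pos_le_divide_eq mult.commute)
      have "cdf ?T 1 * exp (- (2 * x)) = exp (- x) * (exp (- (1 * x)) * cdf ?T 1)"
        by (simp add: exp_add[symmetric])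
      also have "\<dots> \<le> 1 / x * \<kappa> x"
        using that \<open>exp (- x) \<le> 1 / x\<close> cdf_pos[of 1] by (intro mult_mono \<kappa>_lower) auto
      finally show ?thesis using that by (simp add: h_def)
    qed
  qed (use assms(4) int_h cdf_pos in auto)
  have "P = \<nu>" by (simp add: P \<nu>_def p_def)
  then show ?thesis
    using convolution_compound_poisson_in_class_S[OF M(1,3)] M(4) by simp
qed

end
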